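(* Let $(S,\mathcal S)$ be a Polish space with its Borel $\sigma$-field, let $H$ be a non-atomic probability measure on $S$, and let $P$ be a random discrete probability measure on $S$ which admits a construction through normalization of a completely random measure, i.e. $P$ has the law of the homogeneous normalized random measure $\mu/\mu(S)$ with base distribution $H$ and some Lévy density $\rho$ on $(0,\infty)$ satisfying $\int_0^\infty \min(1,x)\rho(x)\,dx<\infty$ and $\int_0^\infty\rho(x)\,dx=\infty$. Let $\alpha\in(-\infty,1)$. Then the exchangeable random partition of $\mathbb N$ induced by sampling from $P$ has an exchangeable partition probability function in Gibbs product form of type $\alpha$ if and only if $\alpha\in[0,1)$ and $P$ is (has the law of) a normalized generalized Gamma process of index $\alpha$ with base distribution $H$. (In particular, no such $P$ induces a Gibbs partition of type $\alpha<0$.)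
   Context: **Homogeneous normalized random measure.** Let $\rho$ be a Lévy density on $(0,\infty)$ with $\int_0^\infty \min(1,x)\rho(x)\,dx<\infty$ and $\int_0^\infty\rho(x)\,dx=\infty$, with Laplace exponent $\psi(\lambda)=\int_0^\infty(1-e^{-\lambda x})\rho(x)\,dx$, and let $H$ be a non-atomic probability measure on $S$. Let $\mu$ be the completely random measure on $S$ whose Laplace functional is $$\mathbb E\big[e^{-\mu(g)}\big]=\exp\Big\{-\int_S\int_0^\infty(1-e^{-g(s)x})\rho(x)\,dx\,H(ds)\Big\}$$ for every measurable $g:S\to[0,\infty)$, where $\mu(g)=\int_S g\,d\mu$. Then $T:=\mu(S)$ is a.s. finite and strictly positive, infinitely divisible, with $\mathbb E(e^{-\lambda T})=e^{-\psi(\lambda)}$. The homogeneous normalized random measure with Lévy density $\rho$ and base distribution $H$ is $P(\cdot)=\mu(\cdot)/\mu(S)$. It is a.s. a discrete probability measure. **Induced partition and EPPF.** Given $P$, let $X_1,X_2,\dots$ be conditionally i.i.d. with law $P$. Let $\Pi$ be the random partition of $\mathbb N$ in which $i,j$ are in the same block iff $X_i=X_j$, and let $\Pi_n$ be its restriction to $\{1,\dots,n\}$. The exchangeable partition probability function (EPPF) is the symmetric function $p$ such that, for every $n\ge1$ and every partition $\{A_1,\dots,A_k\}$ of $\{1,\dots,n\}$ into $k$ nonempty blocks, $\Pr(\Pi_n=\{A_1,\dots,A_k\})=p(|A_1|,\dots,|A_k|)$. **Gibbs product form of type $\alpha$.** For real $\alpha<1$, the EPPF is in Gibbs product form of type $\alpha$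 if there exist nonnegative weights $V_{n,k}$ ($1\le k\le n$) such that $$p(n_1,\dots,n_k)=V_{n,k}\prod_{j=1}^k(1-\alpha)_{n_j-1\uparrow}$$ for all $1\le k\le n$ and all compositions $(n_1,\dots,n_k)$ of $n$ into positive integers, where $(x)_{m\uparrow}=x(x+1)\cdots(x+m-1)$ and $(x)_{0\uparrow}=1$. **Normalized generalized Gamma process of index $\alpha\in[0,1)$.** It is the homogeneous normalized random measure with base distribution $H$ and Lévy density as follows. - For $\alpha\in(0,1)$: $$\rho(x)=\frac{\delta\,2^{\alpha}\alpha}{\Gamma(1-\alpha)}\,x^{-1-\alpha}e^{-\frac12\zeta^{1/\alpha}x}\qquad\text{for some }\delta>0,\ \zeta\ge0.$$ Equivalently, the Laplace exponent is $\psi(b)=-\delta\zeta+\delta(\zeta^{1/\alpha}+2b)^\alpha$. The case $\zeta=0$ is the normalized $\alpha$-stable process. - For $\alpha=0$: $\rho(x)=\theta x^{-1}e^{-x}$ for some $\theta>0$. This is the normalized Gamma process, i.e. the Dirichlet process with parameter measure $\theta H$. *)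

theory Defs
  imports "HOL-Probability.Probability"
begin

section \<open>Completely random measures\<close>

text \<open>\<open>exp (-t)\<close> for an extended nonnegative \<open>t\<close>, with value \<open>0\<close> at \<open>t = \<infinity>\<close>.\<close>

definition exp_neg :: "ennreal \<Rightarrow> real" where
  "exp_neg t = (if t = \<infinity> then 0 else exp (- enn2real t))"

definition levy_density :: "(real \<Rightarrow> real) \<Rightarrow> bool" where
  "levy_density \<rho> \<longleftrightarrow>
     set_borel_measurable borel {0<..} \<rho> \<and>
     (\<forall>x>0. 0 \<le> \<rho> x) \<and>
     (\<integral>\<^sup>+x\<in>{0<..}. ennreal (min 1 x * \<rho> x) \<partial>lborel) < \<infinity> \<and>
     (\<integral>\<^sup>+x\<in>{0<..}. ennreal (\<rho> x) \<partial>lborel) = \<infinity>"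

text \<open>
  A random measure has values in all Borel measures, which need not be finite a priori, so the
  subprobability Giry monad does not apply and measurability is stated through the evaluation maps.
\<close>

definition random_measure ::
  "'w measure \<Rightarrow> ('w \<Rightarrow> 's::topological_space measure) \<Rightarrow> bool" where
  "random_measure N \<mu> \<longleftrightarrow>
     (\<forall>w\<in>space N. sets (\<mu> w) = sets borel) \<and>
     (\<forall>A\<in>sets borel. (\<lambda>w. emeasure (\<mu> w) A) \<in> borel_measurable N)"

definition completely_random_measure ::
  "'w measure \<Rightarrow> ('w \<Rightarrow> 's::topological_space measure) \<Rightarrow> bool" where
  "completely_random_measure N \<mu> \<longleftrightarrow>
     random_measure N \<mu> \<and>
     (\<forall>\<A>. finite \<A> \<and> \<A> \<subseteq> sets borel \<and> disjoint \<A> \<longrightarrow>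
        prob_space.indep_vars N (\<lambda>_. borel) (\<lambda>A w. emeasure (\<mu> w) A) \<A>)"

text \<open>
  The Laplace functional on nonnegative Borel functions \<open>g\<close>. Both the random integral and the
  exponent on the right may be infinite, in which case \<open>exp_neg\<close> is \<open>0\<close>.
\<close>

definition homogeneous_crm ::
  "'w measure \<Rightarrow> ('w \<Rightarrow> 's::topological_space measure) \<Rightarrow> 's measure \<Rightarrow> (real \<Rightarrow> real) \<Rightarrow> bool" where
  "homogeneous_crm N \<mu> H \<rho> \<longleftrightarrow>
     completely_random_measure N \<mu> \<and>
     (\<forall>g \<in> borel_measurable borel. (\<forall>s. 0 \<le> g s) \<longrightarrow>
        (\<integral>w. exp_neg (\<integral>\<^sup>+s. ennreal (g s) \<partial>\<mu> w) \<partial>N) =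
        exp_neg (\<integral>\<^sup>+s. (\<integral>\<^sup>+x\<in>{0<..}. ennreal ((1 - exp (- (g s * x))) * \<rho> x) \<partial>lborel) \<partial>H))"

section \<open>Normalized random measures\<close>

text \<open>
  \<open>Q = \<mu> / \<mu>(S)\<close> almost surely; as \<open>Q w\<close> is a probability measure, this includes
  \<open>0 < \<mu>(S) < \<infinity>\<close> almost surely.
\<close>

definition homogeneous_nrm ::
  "'w measure \<Rightarrow> ('w \<Rightarrow> 's::topological_space measure) \<Rightarrow> 's measure \<Rightarrow> (real \<Rightarrow> real) \<Rightarrow> bool" where
  "homogeneous_nrm N Q H \<rho> \<longleftrightarrow>
     prob_space N \<and> Q \<in> N \<rightarrow>\<^sub>M prob_algebra borel \<and>
     (\<exists>\<mu>. homogeneous_crm N \<mu> H \<rho> \<and>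
          (AE w in N. \<forall>A\<in>sets borel. emeasure (Q w) A = emeasure (\<mu> w) A / emeasure (\<mu> w) UNIV))"

text \<open>
  \<open>P\<close> has the law of the normalized random measure. The existential needs a fixed type for the
  auxiliary sample space; the type of measures on \<open>'s\<close> is no restriction, since every random
  measure can be replaced by the identity map under its own law.
\<close>

definition has_nrm_law ::
  "'w measure \<Rightarrow> ('w \<Rightarrow> 's::topological_space measure) \<Rightarrow> 's measure \<Rightarrow> (real \<Rightarrow> real) \<Rightarrow> bool" where
  "has_nrm_law M P H \<rho> \<longleftrightarrow>
     (\<exists>(N :: 's measure measure) Q. homogeneous_nrm N Q H \<rho> \<and>
        distr M (prob_algebra borel) P = distr N (prob_algebra borel) Q)"

definition generalized_gamma_density :: "real \<Rightarrow> real \<Rightarrow> real \<Rightarrow> real \<Rightarrow> real" where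
  "generalized_gamma_density \<alpha> \<delta> \<zeta> x =
     \<delta> * 2 powr \<alpha> * \<alpha> / Gamma (1 - \<alpha>) * x powr (- 1 - \<alpha>) * exp (- (1/2 * \<zeta> powr (1/\<alpha>) * x))"

definition gamma_levy_density :: "real \<Rightarrow> real \<Rightarrow> real" where
  "gamma_levy_density \<theta> x = \<theta> * x powr (- 1) * exp (- x)"

definition has_ngg_law ::
  "'w measure \<Rightarrow> ('w \<Rightarrow> 's::topological_space measure) \<Rightarrow> 's measure \<Rightarrow> real \<Rightarrow> bool" where
  "has_ngg_law M P H \<alpha> \<longleftrightarrow>
     (0 < \<alpha> \<and> \<alpha> < 1 \<and> (\<exists>\<delta>>0. \<exists>\<zeta>\<ge>0. has_nrm_law M P H (generalized_gamma_density \<alpha> \<delta> \<zeta>))) \<or>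
     (\<alpha> = 0 \<and> (\<exists>\<theta>>0. has_nrm_law M P H (gamma_levy_density \<theta>)))"

definition nonatomic :: "'a measure \<Rightarrow> bool" where
  "nonatomic H \<longleftrightarrow>
     \<not> (\<exists>A\<in>sets H. 0 < emeasure H A \<and>
          (\<forall>B\<in>sets H. B \<subseteq> A \<longrightarrow> emeasure H B < emeasure H A \<longrightarrow> emeasure H B = 0))"

definition discrete_measure :: "'a measure \<Rightarrow> bool" where
  "discrete_measure m \<longleftrightarrow> (\<exists>C. countable C \<and> (AE s in m. s \<in> C))"

section \<open>Sampling and the induced partition\<close>

text \<open>
  Conditionally on (the \<open>\<sigma>\<close>-algebra generated by) \<open>P\<close>, the \<open>X i\<close> are i.i.d. with law \<open>P\<close>.
  The sequence and the ground set of the partition are indexed from \<open>0\<close>, so \<open>{..<n}\<close> plays the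
  role of \<open>{1, \<dots>, n}\<close>.
\<close>

definition cond_iid ::
  "'w measure \<Rightarrow> ('w \<Rightarrow> 's::topological_space measure) \<Rightarrow> (nat \<Rightarrow> 'w \<Rightarrow> 's) \<Rightarrow> bool" where
  "cond_iid M P X \<longleftrightarrow>
     (\<forall>i. X i \<in> M \<rightarrow>\<^sub>M borel) \<and>
     (\<forall>n A. (\<forall>i<n. A i \<in> sets borel) \<longrightarrow>
        (AE w in M. real_cond_exp M (vimage_algebra (space M) P (prob_algebra borel))
                      (indicator {w \<in> space M. \<forall>i<n. X i w \<in> A i}) w
                    = (\<Prod>i<n. measure (P w) (A i))))"

definition tie_partition :: "(nat \<Rightarrow> 's) \<Rightarrow> nat set set" where
  "tie_partition x = UNIV // {(i, j). x i = x j}"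

definition restrict_partition :: "nat \<Rightarrow> nat set set \<Rightarrow> nat set set" where
  "restrict_partition n \<B> = (\<lambda>B. B \<inter> {..<n}) ` \<B> - {{}}"

text \<open>
  An EPPF as a symmetric function of the list of block sizes; its values on lists that are empty
  or contain \<open>0\<close> are irrelevant.
\<close>

definition is_eppf :: "'w measure \<Rightarrow> ('w \<Rightarrow> nat set set) \<Rightarrow> (nat list \<Rightarrow> real) \<Rightarrow> bool" where
  "is_eppf M R p \<longleftrightarrow>
     (\<forall>ns ms. mset ns = mset ms \<longrightarrow> p ns = p ms) \<and>
     (\<forall>n\<ge>1. \<forall>As. distinct As \<and> partition_on {..<n} (set As) \<longrightarrow>
        measure M {w \<in> space M. restrict_partition n (R w) = set As} = p (map card As))"

definition gibbs_product_form :: "real \<Rightarrow> (nat list \<Rightarrow> real) \<Rightarrow> bool" where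
  "gibbs_product_form \<alpha> p \<longleftrightarrow>
     (\<exists>V :: nat \<Rightarrow> nat \<Rightarrow> real.
        (\<forall>n k. 1 \<le> k \<and> k \<le> n \<longrightarrow> 0 \<le> V n k) \<and>
        (\<forall>n k ns. 1 \<le> k \<and> k \<le> n \<and> length ns = k \<and> (\<forall>m\<in>set ns. 1 \<le> m) \<and> sum_list ns = n \<longrightarrow>
           p ns = V n k * (\<Prod>j<k. pochhammer (1 - \<alpha>) (ns ! j - 1))))"

end

theory Submission
  imports Defs
begin

text \<open>
  Write \<open>\<psi>\<close> for the Laplace exponent of \<open>\<rho>\<close> and \<open>\<kappa>\<^sub>n(u) = \<integral>x\<^sup>n e\<^sup>-\<^sup>u\<^sup>x \<rho>(x) dx\<close>. Both directions rest on one
  formula (lemma \<open>probability_of_partition\<close>): for blocks of sizes \<open>n\<^sub>1, \<dots>, n\<^sub>k\<close> with sum \<open>n\<close>,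

  \<open>p(n\<^sub>1, \<dots>, n\<^sub>k) = 1/\<Gamma>(n) \<integral> u\<^sup>n\<^sup>-\<^sup>1 exp(-\<psi>(u)) \<kappa>\<^bsub>n\<^sub>1\<^esub>(u) \<cdots> \<kappa>\<^bsub>n\<^sub>k\<^esub>(u) du\<close>, the integral being over \<open>u > 0\<close>.

  To see it, cut the space into finitely many cells and ask which samples fall into a common cell.
  This pattern has a probability that is a sum, over injective assignments of cells to blocks, of
  the expectation of \<open>\<Prod> (\<mu>(B)/T)\<^sup>m\<close>, where \<open>T\<close> is the total mass of \<open>\<mu>\<close> and \<open>B\<close> is the cell of a
  block of size \<open>m\<close>. The factor \<open>1/T\<^sup>n\<close> is a Gamma integral of \<open>e\<^sup>-\<^sup>u\<^sup>T\<close>, after which independence over disjoint cells leaves a product of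
  \<open>E[\<mu>(B)\<^sup>m e\<^sup>-\<^sup>u\<^sup>\<mu>\<^sup>(\<^sup>B\<^sup>)]\<close>, each equal to \<open>e\<^sup>-\<^sup>H\<^sup>(\<^sup>B\<^sup>)\<^sup>\<psi>\<^sup>(\<^sup>u\<^sup>) (H(B) \<kappa>\<^sub>m(u) + O(H(B)\<^sup>2))\<close>.
  Since \<open>H\<close> has no atoms, the cells can be made uniformly small, and then only the linear terms
  survive (lemma \<open>tendsto_sum_inj_moments\<close>).

  If \<open>\<rho>(x) = K x\<^sup>-\<^sup>1\<^sup>-\<^sup>\<alpha> e\<^sup>-\<^sup>\<beta>\<^sup>x\<close>, then \<open>\<kappa>\<^sub>n(u)\<close> is a constant times
  \<open>(u + \<beta>)\<^sup>\<alpha>\<^sup>-\<^sup>n\<close> times the rising factorial of \<open>1 - \<alpha>\<close> of length \<open>n - 1\<close>, so the product splits into a factor that depends only on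
  \<open>n\<close> and \<open>k\<close> and the product required by the Gibbs form (lemma \<open>gibbs_form_of_tilted_stable\<close>).

  Conversely, the Gibbs form gives \<open>(1 - \<alpha>) p(3, 1, \<dots>) = (2 - \<alpha>) p(2, 2, \<dots>)\<close> with the same
  remaining sizes on both sides. As \<open>\<psi> = \<Sum> u\<^sup>j \<kappa>\<^sub>j/j!\<close>, summing over the remaining sizes
  shows that the measures \<open>(1 - \<alpha>) u\<^sup>3 \<kappa>\<^sub>3 \<kappa>\<^sub>1 e\<^sup>-\<^sup>\<psi> du\<close> and \<open>(2 - \<alpha>) u\<^sup>3 \<kappa>\<^sub>2\<^sup>2 e\<^sup>-\<^sup>\<psi> du\<close>
  assign the same integral to every power of \<open>\<psi>\<close>. They have exponential moments in \<open>\<psi>\<close>, so the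
  moment problem is determinate, and \<open>\<psi>\<close> is injective; hence
  \<open>(1 - \<alpha>) \<kappa>\<^sub>3 \<kappa>\<^sub>1 = (2 - \<alpha>) \<kappa>\<^sub>2\<^sup>2\<close> pointwise (lemma \<open>moment_ode\<close>). Because
  \<open>\<kappa>\<^sub>n' = -\<kappa>\<^sub>n\<^sub>+\<^sub>1\<close>, this is a differential equation saying that \<open>\<kappa>\<^sub>1\<close> to the power
  \<open>-1/(1 - \<alpha>)\<close> is affine, so \<open>\<kappa>\<^sub>1(u) = C (u + \<beta>)\<^sup>\<alpha>\<^sup>-\<^sup>1\<close>, and inverting the Laplace transform
  gives \<open>\<rho>(x) = K x\<^sup>-\<^sup>1\<^sup>-\<^sup>\<alpha> e\<^sup>-\<^sup>\<beta>\<^sup>x\<close> almost everywhere. The integrability conditions on \<open>\<rho>\<close>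
  leave only \<open>\<alpha> \<ge> 0\<close>, with \<open>\<beta> > 0\<close> when \<open>\<alpha> = 0\<close>; in that last case dilating \<open>\<mu>\<close>, which does not
  affect \<open>\<mu>/T\<close>, makes \<open>\<beta> = 1\<close>.
\<close>

section \<open>Determinacy of the moment problem\<close>

lemma power_mult_exp_le:
  fixes c s :: real
  assumes "0 \<le> s" "s < c"
  shows "\<exists>K>0. \<forall>x\<ge>0. x ^ m * exp (s * x) \<le> K * exp (c * x)"
proof (intro exI conjI allI impI)
  show "fact m / (c - s) ^ m > 0"
    using assms by simp
  fix x :: real assume x: "x \<ge> 0"
  define r where "r = c - s"
  have r: "r > 0" using assms by (simp add: r_def)
  have "(r * x) ^ m / fact m \<le> exp (r * x)"
  proof -
    have "(r * x) ^ m /\<^sub>R fact m \<le> exp (r * x)"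
      unfolding exp_def using x r
      by (intro sum_le_suminf[of _ "{m}", simplified] summable_exp_generic)
         (auto simp: divide_inverse mult.commute)
    thus ?thesis by (simp add: divide_inverse mult.commute)
  qed
  hence "x ^ m \<le> fact m / r ^ m * exp (r * x)"
    using r by (simp add: field_simps power_mult_distrib)
  hence "x ^ m * exp (s * x) \<le> fact m / r ^ m * exp (r * x) * exp (s * x)"
    by (intro mult_right_mono) auto
  also have "\<dots> = fact m / r ^ m * exp (c * x)"
    by (simp add: r_def exp_add[symmetric] algebra_simps)
  finally show "x ^ m * exp (s * x) \<le> fact m / (c - s) ^ m * exp (c * x)"
    by (simp add: r_def)
qed

lemma integrable_power_mult_exp:
  fixes A :: "real measure"
  assumes sets [measurable_cong]: "sets A = sets borel"
    and int: "integrable A (\<lambda>x. exp (c * \<bar>x\<bar>))" and "0 \<le> s" "s < c"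
  shows "integrable A (\<lambda>x. \<bar>x\<bar> ^ m * exp (s * \<bar>x\<bar>))"
proof -
  obtain K where K: "K > 0" "\<And>x. x \<ge> 0 \<Longrightarrow> x ^ m * exp (s * x) \<le> K * exp (c * x)"
    using power_mult_exp_le[OF assms(3,4), of m] by blast
  show ?thesis
    by (rule Bochner_Integration.integrable_bound[of _ "\<lambda>x. K * exp (c * \<bar>x\<bar>)"])
       (use int K in \<open>auto intro!: AE_I2 simp: abs_mult power_abs\<close>)
qed

text \<open>
  The power series of the exponential, integrated term by term: the twisted moments at \<open>t\<close> determine
  those at every \<open>t + s\<close> with \<open>s\<close> below the exponential rate \<open>c\<close>.
\<close>

lemma twisted_moment_sums:
  fixes A :: "real measure"
  assumes sets [measurable_cong]: "sets A = sets borel"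
    and int: "integrable A (\<lambda>x. exp (c * \<bar>x\<bar>))" and s: "\<bar>s\<bar> < c"
  shows "(\<lambda>k. (\<i> * s) ^ k / fact k * (CLINT x|A. of_real (x ^ (m + k)) * iexp (t * x)))
           sums (CLINT x|A. of_real (x ^ m) * iexp ((t + s) * x))"
proof -
  have intk: "integrable A (\<lambda>x. complex_of_real (x ^ k) * iexp (t * x))" for k
    by (rule Bochner_Integration.integrable_bound[OF
          integrable_power_mult_exp[OF sets int, of 0 k]])
       (use s in \<open>auto intro!: AE_I2 simp: norm_mult power_abs norm_power\<close>)
  define S where "S = (\<lambda>n x. \<Sum>k<n. (\<i> * s) ^ k / fact k * (complex_of_real (x ^ (m + k)) * iexp (t * x)))"
  have "(\<lambda>n. CLINT x|A. S n x) \<longlonglongrightarrow> (CLINT x|A. of_real (x ^ m) * iexp ((t + s) * x))"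
  proof (rule integral_dominated_convergence[where w = "\<lambda>x. \<bar>x\<bar> ^ m * exp (\<bar>s\<bar> * \<bar>x\<bar>)"])
    show "integrable A (\<lambda>x. \<bar>x\<bar> ^ m * exp (\<bar>s\<bar> * \<bar>x\<bar>))"
      by (rule integrable_power_mult_exp[OF sets int]) (use s in auto)
    show "AE x in A. (\<lambda>n. S n x) \<longlonglongrightarrow> of_real (x ^ m) * iexp ((t + s) * x)"
    proof (rule AE_I2)
      fix x :: real
      have "(\<lambda>k. (\<i> * s * x) ^ k /\<^sub>R fact k) sums exp (\<i> * s * x)"
        by (rule exp_converges)
      hence "(\<lambda>k. (of_real (x ^ m) * iexp (t * x)) * ((\<i> * s * x) ^ k /\<^sub>R fact k)) sums
             ((of_real (x ^ m) * iexp (t * x)) * exp (\<i> * s * x))"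
        by (rule sums_mult)
      also have "(\<lambda>k. (of_real (x ^ m) * iexp (t * x)) * ((\<i> * s * x) ^ k /\<^sub>R fact k)) =
          (\<lambda>k. (\<i> * s) ^ k / fact k * (complex_of_real (x ^ (m + k)) * iexp (t * x)))"
        by (auto simp: scaleR_conv_of_real power_mult_distrib power_add field_simps)
      also have "(of_real (x ^ m) * iexp (t * x)) * exp (\<i> * s * x) =
          of_real (x ^ m) * iexp ((t + s) * x)"
        by (simp add: exp_add[symmetric] algebra_simps)
      finally show "(\<lambda>n. S n x) \<longlonglongrightarrow> of_real (x ^ m) * iexp ((t + s) * x)"
        by (simp add: S_def sums_def)
    qed
    show "AE x in A. norm (S n x) \<le> \<bar>x\<bar> ^ m * exp (\<bar>s\<bar> * \<bar>x\<bar>)" for n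
    proof (rule AE_I2)
      fix x :: real
      have "norm (S n x) \<le> (\<Sum>k<n. norm ((\<i> * s) ^ k / fact k * (complex_of_real (x ^ (m + k)) * iexp (t * x))))"
        unfolding S_def by (rule norm_sum)
      also have "\<dots> = \<bar>x\<bar> ^ m * (\<Sum>k<n. (\<bar>s\<bar> * \<bar>x\<bar>) ^ k /\<^sub>R fact k)"
        by (auto simp: norm_mult norm_power norm_divide power_mult_distrib power_add sum_distrib_left
              divide_inverse abs_mult power_abs norm_inverse norm_fact intro!: sum.cong)
      also have "\<dots> \<le> \<bar>x\<bar> ^ m * exp (\<bar>s\<bar> * \<bar>x\<bar>)"
        unfolding exp_def
        by (intro mult_left_mono sum_le_suminf summable_exp_generic) (auto simp: divide_inverse)
      finally show "norm (S n x) \<le> \<bar>x\<bar> ^ m * exp (\<bar>s\<bar> * \<bar>x\<bar>)" .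
    qed
  qed (auto simp: S_def)
  moreover have "(CLINT x|A. S n x) =
      (\<Sum>k<n. (\<i> * s) ^ k / fact k * (CLINT x|A. of_real (x ^ (m + k)) * iexp (t * x)))" for n
    unfolding S_def by (subst Bochner_Integration.integral_sum) (use intk in auto)
  ultimately show ?thesis by (simp add: sums_def)
qed

text \<open>
  Equality of all twisted moments holds at \<open>0\<close> and propagates in steps of length less than \<open>c\<close>
  to the whole line, so the characteristic functions agree.
\<close>

lemma prob_space_eq_of_moments:
  fixes A B :: "real measure"
  assumes pA: "prob_space A" and pB: "prob_space B"
    and sA: "sets A = sets borel" and sB: "sets B = sets borel" and c: "c > 0"
    and iA: "integrable A (\<lambda>x. exp (c * \<bar>x\<bar>))" and iB: "integrable B (\<lambda>x. exp (c * \<bar>x\<bar>))"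
    and eq: "\<And>m. (\<integral>x. x ^ m \<partial>A) = (\<integral>x. x ^ m \<partial>B)"
  shows "A = B"
proof -
  define F where "F = (\<lambda>C m t. CLINT x|C. complex_of_real (x ^ m) * iexp (t * x))"
  define P where "P = (\<lambda>t. \<forall>m. F A m t = F B m t)"
  have step: "P (t + s)" if "P t" "\<bar>s\<bar> < c" for t s
    unfolding P_def
  proof
    fix m
    have "(\<lambda>k. (\<i> * s) ^ k / fact k * F A (m + k) t) sums F A m (t + s)"
      unfolding F_def using twisted_moment_sums[OF sA iA that(2)] by simp
    moreover have "(\<lambda>k. (\<i> * s) ^ k / fact k * F B (m + k) t) sums F B m (t + s)"
      unfolding F_def using twisted_moment_sums[OF sB iB that(2)] by simp
    ultimately show "F A m (t + s) = F B m (t + s)"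
      using that(1) unfolding P_def by (simp add: sums_iff)
  qed
  have P0: "P 0"
    unfolding P_def F_def using eq by (simp flip: of_real_power)
  have "P t" for t
  proof -
    (* reach t in n equal steps, each shorter than c *)
    obtain n :: nat where n: "\<bar>t\<bar> / c < n" using reals_Archimedean2 by blast
    have n0: "n > 0" using n c by (smt (verit) divide_nonneg_pos of_nat_0_less_iff)
    have small: "\<bar>t / n\<bar> < c" using n n0 c by (simp add: field_simps)
    have "P (k * (t / n))" for k :: nat
    proof (induction k)
      case 0 then show ?case using P0 by simp
    next
      case (Suc k)
      have "P (k * (t / n) + t / n)" by (rule step[OF Suc small])
      then show ?case by (simp add: algebra_simps add_divide_distrib)
    qed
    from this[of n] show ?thesis using n0 by simp
  qed
  hence "F A 0 t = F B 0 t" for t by (simp add: P_def)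
  hence "char A = char B"
    unfolding char_def F_def by (auto simp: fun_eq_iff)
  moreover have "real_distribution A" "real_distribution B"
    using pA pB sA sB by (auto simp: real_distribution_def real_distribution_axioms_def)
  ultimately show ?thesis by (intro Levy_uniqueness)
qed

lemma finite_measure_eq_of_moments:
  fixes A B :: "real measure"
  assumes fA: "finite_measure A" and fB: "finite_measure B"
    and sA: "sets A = sets borel" and sB: "sets B = sets borel" and c: "c > 0"
    and iA: "integrable A (\<lambda>x. exp (c * \<bar>x\<bar>))" and iB: "integrable B (\<lambda>x. exp (c * \<bar>x\<bar>))"
    and eq: "\<And>m. (\<integral>x. x ^ m \<partial>A) = (\<integral>x. x ^ m \<partial>B)"
  shows "A = B"
proof -
  interpret A: finite_measure A by fact
  interpret B: finite_measure B by fact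
  have sp: "space A = UNIV" "space B = UNIV"
    using sets_eq_imp_space_eq[OF sA] sets_eq_imp_space_eq[OF sB] by simp_all
  define a where "a = measure A UNIV"
  have a: "emeasure A UNIV = ennreal a" "emeasure B UNIV = ennreal a" "a \<ge> 0"
    using eq[of 0] sp by (auto simp: a_def A.emeasure_eq_measure B.emeasure_eq_measure)
  show ?thesis
  proof (cases "a = 0")
    case True
    have "emeasure A E = 0" "emeasure B E = 0" for E
      using emeasure_space[of A E] emeasure_space[of B E] a True sp by auto
    thus ?thesis using sA sB by (intro measure_eqI) auto
  next
    case False
    hence a0: "a > 0" using a by simp
    define n where "n = (\<lambda>C::real measure. density C (\<lambda>_. ennreal (1 / a)))"
    have n_eq: "emeasure C E = ennreal a * emeasure (n C) E" if "E \<in> sets C" for C E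
      unfolding n_def using that a0
      by (simp add: emeasure_density_const mult.assoc[symmetric] ennreal_mult[symmetric])
    have int_n: "(\<integral>x. x ^ m \<partial>n C) = (\<integral>x. x ^ m \<partial>C) / a" if "sets C = sets borel" for C m
    proof -
      note [measurable_cong] = that
      show ?thesis unfolding n_def using a0 by (subst integral_density) auto
    qed
    have "n A = n B"
    proof (rule prob_space_eq_of_moments[OF _ _ _ _ c])
      show "prob_space (n A)" "prob_space (n B)"
        using sp a a0 by (auto intro!: prob_spaceI simp: n_def emeasure_density_const
              sA sB ennreal_mult[symmetric])
      show "sets (n A) = sets borel" "sets (n B) = sets borel" using sA sB by (auto simp: n_def)
      note [measurable_cong] = sA sB
      show "integrable (n A) (\<lambda>x. exp (c * \<bar>x\<bar>))"
        unfolding n_def using a0 iA by (subst integrable_density) auto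
      show "integrable (n B) (\<lambda>x. exp (c * \<bar>x\<bar>))"
        unfolding n_def using a0 iB by (subst integrable_density) auto
      show "(\<integral>x. x ^ m \<partial>n A) = (\<integral>x. x ^ m \<partial>n B)" for m
        using eq by (simp add: int_n sA sB)
    qed
    thus ?thesis using sA sB n_eq by (intro measure_eqI) auto
  qed
qed

text \<open>
  For measures on the half-line the exponential moment is itself a series in the moments, so it need
  be checked for only one of the two measures.
\<close>

lemma finite_measure_eq_of_nn_moments:
  fixes A B :: "real measure"
  assumes sA: "sets A = sets borel" and sB: "sets B = sets borel" and c: "c > 0"
    and pos: "AE x in A. 0 \<le> x" "AE x in B. 0 \<le> x"
    and fin: "(\<integral>\<^sup>+x. ennreal (exp (c * x)) \<partial>A) < \<infinity>"
    and eq: "\<And>m. (\<integral>\<^sup>+x. ennreal (x ^ m) \<partial>A) = (\<integral>\<^sup>+x. ennreal (x ^ m) \<partial>B)"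
  shows "A = B"
proof -
  note [measurable_cong] = sA sB
  have ex: "(\<integral>\<^sup>+x. ennreal (exp (c * x)) \<partial>C) = (\<Sum>m. ennreal (c ^ m / fact m) * (\<integral>\<^sup>+x. ennreal (x ^ m) \<partial>C))"
    if [measurable_cong]: "sets C = sets borel" and p: "AE x in C. 0 \<le> x" for C :: "real measure"
  proof -
    have "(\<integral>\<^sup>+x. ennreal (exp (c * x)) \<partial>C) = (\<integral>\<^sup>+x. (\<Sum>m. ennreal (c ^ m / fact m) * ennreal (x ^ m)) \<partial>C)"
    proof (rule nn_integral_cong_AE, use p in eventually_elim)
      fix x :: real assume x: "0 \<le> x"
      have "(\<Sum>m. ennreal ((c * x) ^ m /\<^sub>R fact m)) = ennreal (exp (c * x))"
        using c x by (intro suminf_ennreal_eq exp_converges) auto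
      moreover have "ennreal ((c * x) ^ m /\<^sub>R fact m) = ennreal (c ^ m / fact m) * ennreal (x ^ m)" for m
        using c x by (subst ennreal_mult[symmetric]) (auto simp: power_mult_distrib field_simps)
      ultimately show "ennreal (exp (c * x)) = (\<Sum>m. ennreal (c ^ m / fact m) * ennreal (x ^ m))" by simp
    qed
    also have "\<dots> = (\<Sum>m. ennreal (c ^ m / fact m) * (\<integral>\<^sup>+x. ennreal (x ^ m) \<partial>C))"
      by (subst nn_integral_suminf) (auto simp: nn_integral_cmult)
    finally show ?thesis .
  qed
  have finB: "(\<integral>\<^sup>+x. ennreal (exp (c * x)) \<partial>B) < \<infinity>"
    using fin ex[OF sA pos(1)] ex[OF sB pos(2)] eq by simp
  have int: "integrable C (\<lambda>x. exp (c * \<bar>x\<bar>))" and fm: "finite_measure C"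
    if [measurable_cong]: "sets C = sets borel" and p: "AE x in C. 0 \<le> x"
      and f: "(\<integral>\<^sup>+x. ennreal (exp (c * x)) \<partial>C) < \<infinity>" for C :: "real measure"
  proof -
    have "(\<integral>\<^sup>+x. ennreal (exp (c * \<bar>x\<bar>)) \<partial>C) = (\<integral>\<^sup>+x. ennreal (exp (c * x)) \<partial>C)"
      by (rule nn_integral_cong_AE, use p in eventually_elim) auto
    thus i: "integrable C (\<lambda>x. exp (c * \<bar>x\<bar>))"
      using f by (intro integrableI_nonneg) auto
    have "emeasure C (space C) = (\<integral>\<^sup>+x. 1 \<partial>C)" by simp
    also have "\<dots> \<le> (\<integral>\<^sup>+x. ennreal (exp (c * \<bar>x\<bar>)) \<partial>C)"
      using c by (intro nn_integral_mono) (auto simp flip: ennreal_1)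
    also have "\<dots> < \<infinity>" using i by (auto simp: integrable_iff_bounded)
    finally show "finite_measure C" by (intro finite_measureI) auto
  qed
  have m_eq: "(\<integral>x. x ^ m \<partial>C) = enn2real (\<integral>\<^sup>+x. ennreal (x ^ m) \<partial>C)"
    if [measurable_cong]: "sets C = sets borel" and p: "AE x in C. 0 \<le> x" for C m
    by (rule integral_eq_nn_integral) (use p in auto)
  show ?thesis
    by (rule finite_measure_eq_of_moments[OF fm fm sA sB c int int])
       (use assms finB m_eq in auto)
qed

text \<open>
  A strictly increasing map sends half-lines to half-lines, so the image determines the
  distribution function.
\<close>

lemma measure_eq_of_distr_strict_mono:
  fixes A B :: "real measure" and f :: "real \<Rightarrow> real"
  assumes sA [measurable_cong]: "sets A = sets borel" and sB [measurable_cong]: "sets B = sets borel"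
    and fin: "finite_measure A" "finite_measure B"
    and pos: "AE x in A. 0 < x" "AE x in B. 0 < x"
    and f [measurable]: "f \<in> borel_measurable borel"
    and mono: "\<And>x y. 0 < x \<Longrightarrow> x < y \<Longrightarrow> f x < f y"
    and eq: "distr A borel f = distr B borel f"
  shows "A = B"
proof -
  interpret A: finite_measure A by fact
  interpret B: finite_measure B by fact
  have sp: "space A = UNIV" "space B = UNIV"
    using sets_eq_imp_space_eq[OF sA] sets_eq_imp_space_eq[OF sB] by simp_all
  have le: "measure A {..x} = measure B {..x}" for x
  proof (cases "x > 0")
    case False
    have "measure C {..x} = 0" if "sets C = sets borel" "AE x in C. 0 < x" for C :: "real measure"
    proof -
      have "AE y in C. y \<notin> {..x}" using that(2) by eventually_elim (use False in auto)
      hence "emeasure C {..x} = 0"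
        using that(1) by (subst (asm) AE_iff_null) (auto simp: null_sets_def atMost_def sets_eq_imp_space_eq[OF that(1)])
      thus ?thesis by (simp add: measure_def)
    qed
    thus ?thesis using assms by auto
  next
    case True
    have "measure C {..x} = measure (distr C borel f) {..f x}"
      if [measurable_cong]: "sets C = sets borel" and "AE x in C. 0 < x" "finite_measure C" for C :: "real measure"
    proof -
      interpret C: finite_measure C by fact
      have "measure (distr C borel f) {..f x} = measure C {y\<in>space C. f y \<le> f x}"
        by (subst measure_distr) (auto intro!: arg_cong[where f = "measure C"])
      also have "\<dots> = measure C {..x}"
      proof (rule C.finite_measure_eq_AE)
        show "AE y in C. y \<in> {y\<in>space C. f y \<le> f x} \<longleftrightarrow> y \<in> {..x}"
          using that(2)
        proof eventually_elim
          case (elim y)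
          show ?case using mono[of x y] mono[of y x] elim True that(1) sets_eq_imp_space_eq[OF that(1)]
            by (cases x y rule: linorder_cases) auto
        qed
      qed (auto simp: that(1))
      finally show ?thesis ..
    qed
    from this[OF sA pos(1) fin(1)] this[OF sB pos(2) fin(2)] show ?thesis by (simp add: eq)
  qed
  have "finite_borel_measure A" "finite_borel_measure B"
    using fin sA sB by (auto simp: finite_borel_measure_def finite_borel_measure_axioms_def)
  thus ?thesis
    using le by (intro cdf_unique') (auto simp: cdf_def)
qed

section \<open>Laplace exponents and their derivatives\<close>

text \<open>
  Differentiation under the integral sign with a local dominating function: the difference quotients
  are bounded by it because of the mean value theorem.
\<close>

lemma has_real_derivative_integral:
  fixes F F' :: "real \<Rightarrow> 'a \<Rightarrow> real"
  assumes u: "u \<in> {a<..<b}"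
    and int: "\<And>v. v \<in> {a<..<b} \<Longrightarrow> integrable M (F v)"
    and meas: "F' u \<in> borel_measurable M"
    and deriv: "AE x in M. \<forall>v\<in>{a<..<b}. ((\<lambda>v. F v x) has_real_derivative F' v x) (at v) \<and> \<bar>F' v x\<bar> \<le> w x"
    and w: "integrable M w"
  shows "((\<lambda>v. \<integral>x. F v x \<partial>M) has_real_derivative (\<integral>x. F' u x \<partial>M)) (at u)"
proof -
  have "((\<lambda>v. ((\<integral>x. F v x \<partial>M) - (\<integral>x. F u x \<partial>M)) / (v - u)) \<longlongrightarrow> (\<integral>x. F' u x \<partial>M)) (at u within {a<..<b})"
    unfolding tendsto_at_iff_sequentially comp_def
  proof (intro allI impI)
    fix X assume X: "\<forall>i. X i \<in> {a<..<b} - {u}" and lim: "X \<longlonglongrightarrow> u"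
    define D where "D = (\<lambda>i x. (F (X i) x - F u x) / (X i - u))"
    have [measurable]: "F v \<in> borel_measurable M" if "v \<in> {a<..<b}" for v
      using int[OF that] by auto
    have [measurable]: "D i \<in> borel_measurable M" for i
      unfolding D_def using X u by auto
    have "(\<lambda>i. \<integral>x. D i x \<partial>M) \<longlonglongrightarrow> (\<integral>x. F' u x \<partial>M)"
    proof (rule integral_dominated_convergence[OF meas _ w])
      show "AE x in M. (\<lambda>i. D i x) \<longlonglongrightarrow> F' u x"
        using deriv
      proof eventually_elim
        case (elim x)
        have "((\<lambda>v. F v x) has_real_derivative F' u x) (at u)" using elim u by blast
        hence "((\<lambda>v. (F v x - F u x) / (v - u)) \<longlongrightarrow> F' u x) (at u)"
          by (simp add: has_field_derivative_iff)
        thus ?case unfolding tendsto_at_iff_sequentially D_def comp_def using X lim by auto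
      qed
      show "AE x in M. norm (D i x) \<le> w x" for i
        using deriv
      proof eventually_elim
        case (elim x)
        have "norm (F (X i) x - F u x) \<le> w x * norm (X i - u)"
          by (rule field_differentiable_bound[of "{a<..<b}" _ "\<lambda>v. F' v x"])
             (use elim X u in \<open>auto intro: has_field_derivative_at_within\<close>)
        thus ?case using X by (simp add: D_def field_simps)
      qed
    qed auto
    moreover have "(\<integral>x. D i x \<partial>M) = ((\<integral>x. F (X i) x \<partial>M) - (\<integral>x. F u x \<partial>M)) / (X i - u)" for i
      unfolding D_def using int X u by simp
    ultimately show "(\<lambda>i. ((\<integral>x. F (X i) x \<partial>M) - (\<integral>x. F u x \<partial>M)) / (X i - u)) \<longlonglongrightarrow> (\<integral>x. F' u x \<partial>M)"
      by simp
  qed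
  moreover have "at u within {a<..<b} = at u"
    using u by (intro at_within_open) auto
  ultimately show ?thesis
    by (simp only: has_field_derivative_iff)
qed

text \<open>
  The mass at \<open>0\<close> is left unrestricted, so that probability laws on the half-line are covered too.
  The exponent and moments below then serve both for the jump intensity and for the law of a random
  mass \<open>\<mu>(B)\<close>.
\<close>

definition levy_measure :: "real measure \<Rightarrow> bool" where
  "levy_measure L \<longleftrightarrow> sets L = sets borel \<and> (AE x in L. 0 \<le> x) \<and> integrable L (\<lambda>x. min 1 x)"

definition laplace_exponent :: "real measure \<Rightarrow> real \<Rightarrow> real" where
  "laplace_exponent L u = (\<integral>x. 1 - exp (- (u * x)) \<partial>L)"

definition tilted_moment :: "real measure \<Rightarrow> nat \<Rightarrow> real \<Rightarrow> real" where
  "tilted_moment L n u = (\<integral>x. x ^ n * exp (- (u * x)) \<partial>L)"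

lemma levy_measureD:
  assumes "levy_measure L"
  shows "sets L = sets borel" "AE x in L. 0 \<le> x" "integrable L (\<lambda>x. min 1 x)"
  using assms by (auto simp: levy_measure_def)

lemma power_exp_le_min:
  fixes u :: real assumes "u > 0" "n > 0"
  shows "\<exists>K>0. \<forall>x\<ge>0. x ^ n * exp (- (u * x)) \<le> K * min 1 x"
proof -
  obtain K1 where K1: "K1 > 0" "\<And>x. x \<ge> 0 \<Longrightarrow> x ^ n \<le> K1 * exp (u * x)"
    using power_mult_exp_le[of 0 u n] assms by auto
  obtain K2 where K2: "K2 > 0" "\<And>x. x \<ge> 0 \<Longrightarrow> x ^ (n - 1) \<le> K2 * exp (u * x)"
    using power_mult_exp_le[of 0 u "n - 1"] assms by auto
  show ?thesis
  proof (intro exI conjI allI impI)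
    show "max K1 K2 > 0" using K1 by simp
    fix x :: real assume x: "x \<ge> 0"
    have "x ^ n * exp (- (u * x)) \<le> K1"
      using K1(2)[OF x] by (simp add: exp_minus field_simps)
    moreover have "x ^ n * exp (- (u * x)) \<le> K2 * x"
    proof -
      have "x ^ n = x * x ^ (n - 1)" using assms by (cases n) auto
      also have "\<dots> \<le> x * (K2 * exp (u * x))" by (intro mult_left_mono K2 x)
      finally show ?thesis by (simp add: exp_minus field_simps)
    qed
    moreover have "K1 \<le> max K1 K2" "K2 * x \<le> max K1 K2 * x" using x by (auto intro: mult_right_mono)
    ultimately show "x ^ n * exp (- (u * x)) \<le> max K1 K2 * min 1 x"
      by (auto simp: min_def)
  qed
qed

lemma integrable_tilted_moment:
  assumes L: "levy_measure L" and "u > 0" "n > 0"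
  shows "integrable L (\<lambda>x. x ^ n * exp (- (u * x)))"
proof -
  note [measurable_cong] = levy_measureD(1)[OF L]
  obtain K where K: "K > 0" "\<And>x. x \<ge> 0 \<Longrightarrow> x ^ n * exp (- (u * x)) \<le> K * min 1 x"
    using power_exp_le_min[OF assms(2,3)] by blast
  show ?thesis
  proof (rule Bochner_Integration.integrable_bound)
    show "integrable L (\<lambda>x. K * min 1 x)" using levy_measureD(3)[OF L] by simp
    show "AE x in L. norm (x ^ n * exp (- (u * x))) \<le> norm (K * min 1 x)"
      using levy_measureD(2)[OF L] by eventually_elim (use K in \<open>auto simp: abs_mult\<close>)
  qed auto
qed

lemma integrable_laplace_exponent:
  assumes L: "levy_measure L" and "u > 0"
  shows "integrable L (\<lambda>x. 1 - exp (- (u * x)))"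
proof -
  note [measurable_cong] = levy_measureD(1)[OF L]
  show ?thesis
  proof (rule Bochner_Integration.integrable_bound)
    show "integrable L (\<lambda>x. max 1 u * min 1 x)" using levy_measureD(3)[OF L] by simp
    show "AE x in L. norm (1 - exp (- (u * x))) \<le> norm (max 1 u * min 1 x)"
      using levy_measureD(2)[OF L]
    proof eventually_elim
      case (elim x)
      have "0 \<le> u * x" using elim \<open>u > 0\<close> by simp
      moreover have "1 - exp (- (u * x)) \<le> u * x" using exp_ge_add_one_self[of "- (u * x)"] by simp
      moreover have "u * x \<le> max 1 u * x" "(1::real) \<le> max 1 u" using elim by (auto intro: mult_right_mono)
      ultimately have "0 \<le> 1 - exp (- (u * x))" "1 - exp (- (u * x)) \<le> max 1 u * min 1 x"
        using exp_gt_zero[of "- (u * x)"] by (simp, smt (verit) mult_cancel_left1 min_def)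
      thus ?case by simp
    qed
  qed auto
qed

lemma has_derivative_tilted_moment:
  assumes L: "levy_measure L" and u: "u > 0" and n: "n > 0"
  shows "(tilted_moment L n has_real_derivative - tilted_moment L (Suc n) u) (at u)"
proof -
  note [measurable_cong] = levy_measureD(1)[OF L]
  have "((\<lambda>v. \<integral>x. x ^ n * exp (- (v * x)) \<partial>L) has_real_derivative
           (\<integral>x. - (x ^ Suc n * exp (- (u * x))) \<partial>L)) (at u)"
  proof (rule has_real_derivative_integral[where a = "u / 2" and b = "2 * u"
          and F = "\<lambda>v x. x ^ n * exp (- (v * x))" and F' = "\<lambda>v x. - (x ^ Suc n * exp (- (v * x)))"
          and w = "\<lambda>x. x ^ Suc n * exp (- (u / 2 * x))"])
    show "AE x in L. \<forall>v\<in>{u/2<..<2*u}. ((\<lambda>v. x ^ n * exp (- (v * x))) has_real_derivative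
              - (x ^ Suc n * exp (- (v * x)))) (at v) \<and>
            \<bar>- (x ^ Suc n * exp (- (v * x)))\<bar> \<le> x ^ Suc n * exp (- (u / 2 * x))"
      using levy_measureD(2)[OF L]
    proof (eventually_elim, intro ballI conjI)
      fix x v :: real assume x: "0 \<le> x" and v: "v \<in> {u/2<..<2*u}"
      show "((\<lambda>v. x ^ n * exp (- (v * x))) has_real_derivative - (x ^ Suc n * exp (- (v * x)))) (at v)"
        by (auto intro!: derivative_eq_intros)
      have "u / 2 * x \<le> v * x" using x v by (intro mult_right_mono) auto
      thus "\<bar>- (x ^ Suc n * exp (- (v * x)))\<bar> \<le> x ^ Suc n * exp (- (u / 2 * x))"
        using x by (auto simp: abs_mult intro!: mult_left_mono)
    qed
    show "integrable L (\<lambda>x. x ^ Suc n * exp (- (u / 2 * x)))"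
      by (rule integrable_tilted_moment[OF L]) (use u in auto)
    show "integrable L (\<lambda>x. x ^ n * exp (- (v * x)))" if "v \<in> {u/2<..<2*u}" for v
      by (rule integrable_tilted_moment[OF L]) (use u n that in auto)
  qed (use u in auto)
  thus ?thesis by (simp add: tilted_moment_def[abs_def])
qed

lemma has_derivative_laplace_exponent:
  assumes L: "levy_measure L" and u: "u > 0"
  shows "(laplace_exponent L has_real_derivative tilted_moment L 1 u) (at u)"
proof -
  note [measurable_cong] = levy_measureD(1)[OF L]
  have "((\<lambda>v. \<integral>x. 1 - exp (- (v * x)) \<partial>L) has_real_derivative
           (\<integral>x. x * exp (- (u * x)) \<partial>L)) (at u)"
  proof (rule has_real_derivative_integral[where a = "u / 2" and b = "2 * u"
          and F = "\<lambda>v x. 1 - exp (- (v * x))" and F' = "\<lambda>v x. x * exp (- (v * x))"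
          and w = "\<lambda>x. x ^ 1 * exp (- (u / 2 * x))"])
    show "AE x in L. \<forall>v\<in>{u/2<..<2*u}. ((\<lambda>v. 1 - exp (- (v * x))) has_real_derivative
              (x * exp (- (v * x)))) (at v) \<and>
            \<bar>x * exp (- (v * x))\<bar> \<le> x ^ 1 * exp (- (u / 2 * x))"
      using levy_measureD(2)[OF L]
    proof (eventually_elim, intro ballI conjI)
      fix x v :: real assume x: "0 \<le> x" and v: "v \<in> {u/2<..<2*u}"
      show "((\<lambda>v. 1 - exp (- (v * x))) has_real_derivative (x * exp (- (v * x)))) (at v)"
        by (auto intro!: derivative_eq_intros)
      have "u / 2 * x \<le> v * x" using x v by (intro mult_right_mono) auto
      thus "\<bar>x * exp (- (v * x))\<bar> \<le> x ^ 1 * exp (- (u / 2 * x))"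
        using x by (auto simp: abs_mult intro!: mult_left_mono)
    qed
    show "integrable L (\<lambda>x. x ^ 1 * exp (- (u / 2 * x)))"
      by (rule integrable_tilted_moment[OF L]) (use u in auto)
    show "integrable L (\<lambda>x. 1 - exp (- (v * x)))" if "v \<in> {u/2<..<2*u}" for v
      by (rule integrable_laplace_exponent[OF L]) (use u that in auto)
  qed (use u in auto)
  thus ?thesis by (simp add: tilted_moment_def[abs_def] laplace_exponent_def[abs_def])
qed

lemma tilted_moment_nonneg:
  assumes "levy_measure L" shows "0 \<le> tilted_moment L n u"
  unfolding tilted_moment_def
proof (rule integral_nonneg_AE)
  show "AE x in L. 0 \<le> x ^ n * exp (- (u * x))"
    using levy_measureD(2)[OF assms] by eventually_elim simp
qed

lemma tilted_moment_pos:
  assumes L: "levy_measure L" and u: "u > 0" and n: "n > 0" and pos: "AE x in L. 0 < x"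
    and nz: "emeasure L UNIV \<noteq> 0"
  shows "0 < tilted_moment L n u"
proof -
  note [measurable_cong] = levy_measureD(1)[OF L]
  have sp: "space L = UNIV" using sets_eq_imp_space_eq[OF levy_measureD(1)[OF L]] by simp
  have "tilted_moment L n u \<noteq> 0"
  proof
    assume "tilted_moment L n u = 0"
    moreover have "AE x in L. 0 \<le> x ^ n * exp (- (u * x))"
      using pos by eventually_elim auto
    ultimately have "AE x in L. x ^ n * exp (- (u * x)) = 0"
      unfolding tilted_moment_def
      by (subst (asm) integral_nonneg_eq_0_iff_AE[OF integrable_tilted_moment[OF L u n]]) auto
    with pos have "AE x in L. False" by eventually_elim auto
    hence "emeasure L (space L) = 0" by (subst (asm) AE_iff_measurable[OF _ refl]) auto
    thus False using nz sp by simp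
  qed
  thus ?thesis using tilted_moment_nonneg[OF L, of n u] by simp
qed

lemma laplace_exponent_nonneg:
  assumes "levy_measure L" "u > 0" shows "0 \<le> laplace_exponent L u"
  unfolding laplace_exponent_def
proof (rule integral_nonneg_AE)
  show "AE x in L. 0 \<le> 1 - exp (- (u * x))"
    using levy_measureD(2)[OF assms(1)] by eventually_elim (use assms(2) in simp)
qed

lemma laplace_exponent_strict_mono:
  assumes L: "levy_measure L" and pos: "\<And>u. u > 0 \<Longrightarrow> 0 < tilted_moment L 1 u" and "0 < u" "u < v"
  shows "laplace_exponent L u < laplace_exponent L v"
proof (rule DERIV_pos_imp_increasing[OF \<open>u < v\<close>])
  fix x assume "u \<le> x"
  with \<open>0 < u\<close> have "0 < x" by simp
  thus "\<exists>y. (laplace_exponent L has_real_derivative y) (at x) \<and> 0 < y"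
    using has_derivative_laplace_exponent[OF L] pos by blast
qed

lemma continuous_on_tilted_moment:
  assumes "levy_measure L" "n > 0" shows "continuous_on {0<..} (tilted_moment L n)"
  by (rule DERIV_continuous_on[OF has_field_derivative_at_within[OF has_derivative_tilted_moment]])
     (use assms in auto)

lemma ennreal_laplace_exponent:
  assumes L: "levy_measure L" and u: "u > 0"
  shows "ennreal (laplace_exponent L u) = (\<integral>\<^sup>+x. ennreal (1 - exp (- (u * x))) \<partial>L)"
  unfolding laplace_exponent_def
proof (rule nn_integral_eq_integral[symmetric, OF integrable_laplace_exponent[OF assms]])
  show "AE x in L. 0 \<le> 1 - exp (- (u * x))"
    using levy_measureD(2)[OF L] by eventually_elim (use u in simp)
qed

lemma ennreal_tilted_moment:
  assumes L: "levy_measure L" and u: "u > 0" and "n > 0"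
  shows "ennreal (tilted_moment L n u) = (\<integral>\<^sup>+x. ennreal (x ^ n * exp (- (u * x))) \<partial>L)"
  unfolding tilted_moment_def
proof (rule nn_integral_eq_integral[symmetric, OF integrable_tilted_moment[OF assms]])
  show "AE x in L. 0 \<le> x ^ n * exp (- (u * x))"
    using levy_measureD(2)[OF L] by eventually_elim simp
qed

text \<open>
  Expand \<open>1 - e\<^sup>-\<^sup>u\<^sup>x = e\<^sup>-\<^sup>u\<^sup>x (e\<^sup>u\<^sup>x - 1)\<close>. This identity is what lets sums over block sizes produce
  powers of the Laplace exponent.
\<close>

lemma laplace_exponent_series:
  assumes L: "levy_measure L" and u: "u > 0"
  shows "ennreal (laplace_exponent L u) =
           (\<Sum>j. ennreal (1 / fact (Suc j)) * ennreal (u ^ Suc j * tilted_moment L (Suc j) u))"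
proof -
  note [measurable_cong] = levy_measureD(1)[OF L]
  have "ennreal (laplace_exponent L u) =
      (\<integral>\<^sup>+x. (\<Sum>j. ennreal (u ^ Suc j / fact (Suc j)) * ennreal (x ^ Suc j * exp (- (u * x)))) \<partial>L)"
    unfolding ennreal_laplace_exponent[OF assms]
  proof (rule nn_integral_cong_AE, use levy_measureD(2)[OF L] in eventually_elim)
    fix x :: real assume x: "0 \<le> x"
    have "(\<lambda>j. (u * x) ^ Suc j /\<^sub>R fact (Suc j)) sums (exp (u * x) - 1)"
      using exp_converges[of "u * x"] by (subst sums_Suc_iff) auto
    hence "(\<lambda>j. (u * x) ^ Suc j /\<^sub>R fact (Suc j) * exp (- (u * x))) sums ((exp (u * x) - 1) * exp (- (u * x)))"
      by (rule sums_mult2)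
    also have "(exp (u * x) - 1) * exp (- (u * x)) = 1 - exp (- (u * x))"
      by (simp add: algebra_simps exp_add[symmetric])
    finally have "(\<Sum>j. ennreal ((u * x) ^ Suc j /\<^sub>R fact (Suc j) * exp (- (u * x)))) = ennreal (1 - exp (- (u * x)))"
      using u x by (intro suminf_ennreal_eq) auto
    moreover have "ennreal ((u * x) ^ Suc j /\<^sub>R fact (Suc j) * exp (- (u * x))) =
          ennreal (u ^ Suc j / fact (Suc j)) * ennreal (x ^ Suc j * exp (- (u * x)))" for j
      using u x by (subst ennreal_mult[symmetric]) (auto simp: power_mult_distrib divide_inverse algebra_simps simp del: power_Suc fact_Suc)
    ultimately show "ennreal (1 - exp (- (u * x))) =
        (\<Sum>j. ennreal (u ^ Suc j / fact (Suc j)) * ennreal (x ^ Suc j * exp (- (u * x))))"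
      by simp
  qed
  also have "\<dots> = (\<Sum>j. ennreal (u ^ Suc j / fact (Suc j)) * ennreal (tilted_moment L (Suc j) u))"
    using ennreal_tilted_moment[OF L u]
    by (subst nn_integral_suminf) (auto simp: nn_integral_cmult simp del: power_Suc)
  also have "\<dots> = (\<Sum>j. ennreal (1 / fact (Suc j)) * ennreal (u ^ Suc j * tilted_moment L (Suc j) u))"
    using u tilted_moment_nonneg[OF L]
    by (intro suminf_cong) (auto simp: ennreal_mult[symmetric] simp del: power_Suc fact_Suc)
  finally show ?thesis .
qed

lemma power_tilted_moment_le_laplace_exponent:
  assumes L: "levy_measure L" and u: "u > 0"
  shows "u ^ Suc j * tilted_moment L (Suc j) u \<le> fact (Suc j) * laplace_exponent L u"
proof -
  have "ennreal (1 / fact (Suc j)) * ennreal (u ^ Suc j * tilted_moment L (Suc j) u) \<le> ennreal (laplace_exponent L u)"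
    unfolding laplace_exponent_series[OF assms] by (intro sum_le_suminf[of _ "{j}", simplified]) auto
  hence "1 / fact (Suc j) * (u ^ Suc j * tilted_moment L (Suc j) u) \<le> laplace_exponent L u"
    using u tilted_moment_nonneg[OF L] laplace_exponent_nonneg[OF L u]
    by (subst (asm) ennreal_mult[symmetric]) (auto simp del: power_Suc fact_Suc)
  thus ?thesis by (simp add: field_simps del: power_Suc fact_Suc)
qed

section \<open>A differential equation and the uniqueness of Laplace transforms\<close>

text \<open>
  The integrand is the derivative of \<open>-e\<^sup>-\<^sup>c\<^sup>G/c\<close>, whose values lie in \<open>[-1/c, 0]\<close>.
\<close>

lemma nn_integral_derivative_mult_exp_le:
  fixes G g :: "real \<Rightarrow> real"
  assumes deriv: "\<And>u. u > 0 \<Longrightarrow> (G has_real_derivative g u) (at u)"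
    and cont: "continuous_on {0<..} g" and g0: "\<And>u. u > 0 \<Longrightarrow> 0 \<le> g u"
    and G0: "\<And>u. u > 0 \<Longrightarrow> 0 \<le> G u" and c: "c > 0"
  shows "(\<integral>\<^sup>+u\<in>{0<..}. ennreal (g u * exp (- (c * G u))) \<partial>lborel) \<le> ennreal (1 / c)"
proof -
  define f where "f = (\<lambda>u. indicator {0<..} u * (g u * exp (- (c * G u))))"
  define I where "I = (\<lambda>n::nat. {1 / (Suc n) .. real (Suc n)})"
  have "continuous_on {0<..} G"
    by (rule DERIV_continuous_on[OF has_field_derivative_at_within[OF deriv]]) auto
  hence cg: "continuous_on {0<..} (\<lambda>u. g u * exp (- (c * G u)))"
    by (intro continuous_intros cont)
  have f_meas [measurable]: "f \<in> borel_measurable borel"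
    using borel_measurable_continuous_on_indicator[OF _ cg] unfolding f_def by simp
  have bound: "(\<integral>\<^sup>+u. ennreal (f u) * indicator (I n) u \<partial>lborel) \<le> ennreal (1 / c)" for n
  proof -
    have "(\<integral>\<^sup>+u. ennreal (f u) * indicator (I n) u \<partial>lborel) =
       ennreal (- exp (- (c * G (real (Suc n)))) / c - (- exp (- (c * G (1 / real (Suc n)))) / c))"
      unfolding I_def
    proof (rule nn_integral_FTC_Icc[OF f_meas])
      fix x assume "x \<in> {1 / real (Suc n)..real (Suc n)}"
      hence x: "1 / real (Suc n) \<le> x" "x \<le> real (Suc n)" by auto
      have x0: "x > 0" using x(1) by (smt (verit) divide_pos_pos of_nat_0_less_iff zero_less_Suc)
      have "((\<lambda>x. - exp (- (c * G x)) / c) has_real_derivative g x * exp (- (c * G x))) (at x)"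
        by (rule derivative_eq_intros deriv[OF x0] refl)+ (use c in \<open>auto simp: field_simps\<close>)
      thus "((\<lambda>x. - exp (- (c * G x)) / c) has_real_derivative f x) (at x)"
        using x0 by (simp add: f_def)
      show "0 \<le> f x" using g0[OF x0] by (simp add: f_def)
    next
      have "1 / real (Suc n) \<le> 1" by simp
      also have "1 \<le> real (Suc n)" by simp
      finally show "1 / real (Suc n) \<le> real (Suc n)" .
    qed
    also have "\<dots> \<le> ennreal (1 / c)"
      using G0[of "1 / real (Suc n)"] c
      by (intro ennreal_leI) (simp add: divide_simps, smt (verit) exp_gt_zero exp_le_one_iff mult_nonneg_nonneg)
    finally show ?thesis .
  qed
  have "(\<integral>\<^sup>+u\<in>{0<..}. ennreal (g u * exp (- (c * G u))) \<partial>lborel) =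
        (\<integral>\<^sup>+u. (SUP n. ennreal (f u) * indicator (I n) u) \<partial>lborel)"
  proof (rule nn_integral_cong)
    fix u :: real
    show "ennreal (g u * exp (- (c * G u))) * indicator {0<..} u = (SUP n. ennreal (f u) * indicator (I n) u)"
    proof (cases "u > 0")
      case True
      obtain n :: nat where n: "max u (1 / u) \<le> n" using real_arch_simple by blast
      have "1 / real (Suc n) \<le> u" using n True by (simp add: field_simps)
      hence un: "u \<in> I n" using n by (auto simp: I_def)
      have "(SUP n. ennreal (f u) * indicator (I n) u) = ennreal (f u)"
      proof (rule antisym)
        show "(SUP n. ennreal (f u) * indicator (I n) u) \<le> ennreal (f u)"
          by (intro SUP_least) (auto simp: indicator_def)
        show "ennreal (f u) \<le> (SUP n. ennreal (f u) * indicator (I n) u)"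
          by (rule SUP_upper2[of n]) (use un in auto)
      qed
      thus ?thesis using True by (simp add: f_def)
    qed (simp add: f_def)
  qed
  also have "\<dots> = (SUP n. \<integral>\<^sup>+u. ennreal (f u) * indicator (I n) u \<partial>lborel)"
  proof (rule nn_integral_monotone_convergence_SUP)
    show "incseq (\<lambda>n u. ennreal (f u) * indicator (I n) u)"
    proof (intro incseq_SucI le_funI mult_left_mono)
      fix n u
      have "I n \<subseteq> I (Suc n)"
        unfolding I_def by (auto simp: field_simps intro: order_trans[rotated])
      thus "indicator (I n) u \<le> (indicator (I (Suc n)) u :: ennreal)"
        by (auto simp: indicator_def)
    qed simp
  qed (auto simp: I_def)
  also have "\<dots> \<le> ennreal (1 / c)" by (intro SUP_least bound)
  finally show ?thesis .
qed

text \<open>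
  The equation is the vanishing of the second derivative of \<open>k1\<close> to the power \<open>-1/(1 - \<alpha>)\<close>, where
  \<open>k2\<close> and \<open>k3\<close> are \<open>-k1'\<close> and \<open>k1''\<close>. Positivity of the resulting affine function on the half-line
  gives \<open>\<beta> \<ge> 0\<close>.
\<close>

lemma power_solution_of_ode:
  fixes k1 k2 k3 :: "real \<Rightarrow> real"
  assumes a: "\<alpha> < 1"
    and d1: "\<And>u. u > 0 \<Longrightarrow> (k1 has_real_derivative - k2 u) (at u)"
    and d2: "\<And>u. u > 0 \<Longrightarrow> (k2 has_real_derivative - k3 u) (at u)"
    and pos: "\<And>u. u > 0 \<Longrightarrow> 0 < k1 u" "\<And>u. u > 0 \<Longrightarrow> 0 < k2 u"
    and ode: "\<And>u. u > 0 \<Longrightarrow> (1 - \<alpha>) * (k3 u * k1 u) = (2 - \<alpha>) * (k2 u)\<^sup>2"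
  obtains C \<beta> where "C > 0" "\<beta> \<ge> 0" "\<And>u. u > 0 \<Longrightarrow> k1 u = C * (u + \<beta>) powr (\<alpha> - 1)"
proof -
  (* y is the power of k1 that turns out to be affine, and z is its derivative *)
  define r where "r = 1 / (1 - \<alpha>)"
  have r: "r > 0" using a by (simp add: r_def)
  define y where "y = (\<lambda>u. k1 u powr (- r))"
  define z where "z = (\<lambda>u. r * k1 u powr (- r - 1) * k2 u)"
  have dy: "(y has_real_derivative z u) (at u)" if u: "u > 0" for u
    unfolding y_def z_def using pos(1)[OF u]
    by (auto intro!: derivative_eq_intros d1[OF u])
  have dz: "(z has_real_derivative 0) (at u)" if u: "u > 0" for u
  proof -
    have "(z has_real_derivative (r * ((- r - 1) * k1 u powr (- r - 1 - 1) * (- k2 u)) * k2 u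
            + r * k1 u powr (- r - 1) * (- k3 u))) (at u)"
      unfolding z_def using pos(1)[OF u]
      by (auto intro!: derivative_eq_intros d1[OF u] d2[OF u])
    also have "k1 u powr (- r - 1) = k1 u powr (- r - 1 - 1) * k1 u"
      using powr_add[of "k1 u" "- r - 1 - 1" 1] pos(1)[OF u] by (metis diff_add_cancel powr_one less_imp_le)
    also have "r * ((- r - 1) * k1 u powr (- r - 1 - 1) * (- k2 u)) * k2 u
            + r * (k1 u powr (- r - 1 - 1) * k1 u) * (- k3 u) =
          r * k1 u powr (- r - 1 - 1) * ((r + 1) * (k2 u)\<^sup>2 - k3 u * k1 u)"
      by (simp add: algebra_simps power2_eq_square)
    also have "(r + 1) * (k2 u)\<^sup>2 - k3 u * k1 u = 0"
      using ode[OF u] a by (simp add: r_def field_simps)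
    finally show ?thesis by simp
  qed
  have const: "f u = f 1" if "u > 0" and d: "\<And>v. v > 0 \<Longrightarrow> (f has_real_derivative 0) (at v)"
    for f :: "real \<Rightarrow> real" and u
  proof -
    have "f u = f 1"
      by (rule has_field_derivative_zero_constant[of "{0<..}" f, THEN exE])
         (use that in \<open>auto intro: has_field_derivative_at_within\<close>)
    thus ?thesis .
  qed
  define b where "b = z 1"
  have zb: "z u = b" if "u > 0" for u using const[OF that dz] by (simp add: b_def)
  have b: "b > 0" unfolding b_def z_def using r pos[of 1] by simp
  define a0 where "a0 = y 1 - b"
  have yab: "y u = a0 + b * u" if "u > 0" for u
  proof -
    have "((\<lambda>u. y u - b * u) has_real_derivative 0) (at v)" if "v > 0" for v
      using dy[OF that] zb[OF that] by (auto intro!: derivative_eq_intros)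
    from const[OF that this] show ?thesis by (simp add: a0_def)
  qed
  have ypos: "y u > 0" if "u > 0" for u using pos(1)[OF that] by (simp add: y_def)
  have a0: "a0 \<ge> 0"
  proof (rule ccontr)
    assume "\<not> a0 \<ge> 0"
    hence p: "- a0 / b > 0" using b by (intro divide_pos_pos) auto
    have "y (- a0 / b) = 0" using yab[OF p] b by simp
    thus False using ypos[OF p] by simp
  qed
  show ?thesis
  proof (rule that)
    show "b powr (\<alpha> - 1) > 0" using b by simp
    show "a0 / b \<ge> 0" using a0 b by simp
    fix u :: real assume u: "u > 0"
    have "k1 u = y u powr (\<alpha> - 1)"
    proof -
      have "- r * (\<alpha> - 1) = 1" using a by (simp add: r_def field_simps)
      thus ?thesis using pos(1)[OF u] by (simp add: y_def powr_powr)
    qed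
    also have "y u = b * (u + a0 / b)" using yab[OF u] b by (simp add: field_simps)
    also have "\<dots> powr (\<alpha> - 1) = b powr (\<alpha> - 1) * (u + a0 / b) powr (\<alpha> - 1)"
      using b a0 u by (simp add: powr_mult)
    finally show "k1 u = b powr (\<alpha> - 1) * (u + a0 / b) powr (\<alpha> - 1)" .
  qed
qed

text \<open>
  Tilting by \<open>e\<^sup>-\<^sup>x\<close> makes the measures finite, and the substitution \<open>y = e\<^sup>-\<^sup>x\<close> turns the Laplace
  transform at integers into the moments of a measure on the unit interval.
\<close>

lemma measure_eq_of_laplace:
  fixes A B :: "real measure"
  assumes sA [measurable_cong]: "sets A = sets borel" and sB [measurable_cong]: "sets B = sets borel"
    and pos: "AE x in A. 0 < x" "AE x in B. 0 < x"
    and fin: "\<And>u. u > 0 \<Longrightarrow> (\<integral>\<^sup>+x. ennreal (exp (- (u * x))) \<partial>A) < \<infinity>"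
    and eq: "\<And>u. u > 0 \<Longrightarrow> (\<integral>\<^sup>+x. ennreal (exp (- (u * x))) \<partial>A) = (\<integral>\<^sup>+x. ennreal (exp (- (u * x))) \<partial>B)"
  shows "A = B"
proof -
  (* the tilted measure has total mass equal to the Laplace transform at 1 *)
  define t where "t = (\<lambda>C::real measure. density C (\<lambda>x. ennreal (exp (- x))))"
  have st [measurable_cong]: "sets (t C) = sets C" for C by (simp add: t_def)
  have post: "AE x in t C. 0 < x" if "AE x in C. 0 < x" "sets C = sets borel" for C
  proof -
    note [measurable_cong] = that(2)
    show ?thesis unfolding t_def
      by (subst AE_density) (use that(1) in \<open>auto elim: AE_mp\<close>)
  qed
  have int_t: "(\<integral>\<^sup>+x. ennreal (exp (- x) ^ m) \<partial>t C) = (\<integral>\<^sup>+x. ennreal (exp (- (real (Suc m) * x))) \<partial>C)"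
    if "sets C = sets borel" for C m
  proof -
    note [measurable_cong] = that
    show ?thesis unfolding t_def
      by (subst nn_integral_density)
         (auto simp: ennreal_mult[symmetric] exp_of_nat_mult[symmetric] exp_add[symmetric] algebra_simps)
  qed
  have mom: "(\<integral>\<^sup>+x. ennreal (x ^ m) \<partial>distr (t C) borel (\<lambda>x. exp (- x))) =
        (\<integral>\<^sup>+x. ennreal (exp (- (real (Suc m) * x))) \<partial>C)" if "sets C = sets borel" for C m
  proof -
    note [measurable_cong] = that
    show ?thesis by (subst nn_integral_distr) (auto simp: int_t that)
  qed
  have "distr (t A) borel (\<lambda>x. exp (- x)) = distr (t B) borel (\<lambda>x. exp (- x))"
  proof (rule finite_measure_eq_of_nn_moments[where c = 1])
    show "AE x in distr (t A) borel (\<lambda>x. exp (- x)). 0 \<le> x"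
         "AE x in distr (t B) borel (\<lambda>x. exp (- x)). 0 \<le> x"
      by (subst AE_distr_iff; simp)+
    show "(\<integral>\<^sup>+x. ennreal (x ^ m) \<partial>distr (t A) borel (\<lambda>x. exp (- x))) =
          (\<integral>\<^sup>+x. ennreal (x ^ m) \<partial>distr (t B) borel (\<lambda>x. exp (- x)))" for m
      by (subst (1 2) mom) (auto simp: sA sB intro!: eq)
    have "(\<integral>\<^sup>+x. ennreal (exp (1 * x)) \<partial>distr (t A) borel (\<lambda>x. exp (- x))) =
          (\<integral>\<^sup>+x. ennreal (exp (exp (- x))) \<partial>t A)"
      by (subst nn_integral_distr) auto
    also have "\<dots> \<le> (\<integral>\<^sup>+x. ennreal (exp 1) \<partial>t A)"
      by (rule nn_integral_mono_AE, use post[OF pos(1) sA] in eventually_elim) auto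
    also have "\<dots> = ennreal (exp 1) * (\<integral>\<^sup>+x. ennreal (exp (- x) ^ 0) \<partial>t A)"
      by simp
    also have "\<dots> < \<infinity>"
      using int_t[OF sA, of 0] fin[of 1] by (simp add: ennreal_mult_less_top del: power_0)
    finally show "(\<integral>\<^sup>+x. ennreal (exp (1 * x)) \<partial>distr (t A) borel (\<lambda>x. exp (- x))) < \<infinity>" .
  qed auto
  hence "distr (distr (t A) borel (\<lambda>x. exp (- x))) borel uminus =
         distr (distr (t B) borel (\<lambda>x. exp (- x))) borel uminus" by simp
  hence eqd: "distr (t A) borel (\<lambda>x. - exp (- x)) = distr (t B) borel (\<lambda>x. - exp (- x))"
    by (simp add: distr_distr comp_def)
  have fm: "finite_measure (t C)" if "(\<integral>\<^sup>+x. ennreal (exp (- (1 * x))) \<partial>C) < \<infinity>" "sets C = sets borel" for C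
  proof (rule finite_measureI)
    have "emeasure (t C) (space (t C)) = (\<integral>\<^sup>+x. ennreal (exp (- x) ^ 0) \<partial>t C)" by simp
    thus "emeasure (t C) (space (t C)) \<noteq> \<infinity>" using int_t[OF that(2), of 0] that(1) by (simp del: power_0)
  qed
  have "t A = t B"
    by (rule measure_eq_of_distr_strict_mono[OF trans[OF st sA] trans[OF st sB] _ _ _ _ _ _ eqd])
       (use fm[of A] fm[of B] fin[of 1] eq[of 1] sA sB post pos in auto)
  moreover have "density (t C) (\<lambda>x. ennreal (exp x)) = C" if "sets C = sets borel" for C
  proof -
    note [measurable_cong] = that
    have "density (t C) (\<lambda>x. ennreal (exp x)) = density C (\<lambda>_. 1)"
      unfolding t_def by (subst density_density_eq) (auto simp: ennreal_mult[symmetric] exp_minus intro!: density_cong)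
    thus ?thesis by (simp add: density_1)
  qed
  ultimately show ?thesis using sA sB by metis
qed

section \<open>Sums over injective labellings\<close>

abbreviation inj_labellings :: "'a set \<Rightarrow> 'b set \<Rightarrow> ('a \<Rightarrow> 'b) set" where
  "inj_labellings A I \<equiv> {\<phi>\<in>A \<rightarrow>\<^sub>E I. inj_on \<phi> A}"

lemma finite_inj_labellings: "finite A \<Longrightarrow> finite I \<Longrightarrow> finite (inj_labellings A I)"
  using finite_PiE[of A "\<lambda>_. I"] by (auto intro: finite_subset[rotated])


text \<open>
  Split an injective labelling into its restriction and the label of the new element, which
  ranges over the labels not yet taken.
\<close>

lemma sum_inj_PiE_insert:
  fixes f :: "'a \<Rightarrow> 'b \<Rightarrow> 'c::comm_semiring_1"
  assumes A: "finite A" "a \<notin> A" and I: "finite I"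
  shows "(\<Sum>\<phi>\<in>inj_labellings (insert a A) I. \<Prod>x\<in>insert a A. f x (\<phi> x)) =
         (\<Sum>\<phi>\<in>inj_labellings A I. (\<Prod>x\<in>A. f x (\<phi> x)) * (\<Sum>j\<in>I - \<phi> ` A. f a j))"
proof -
  let ?S = "SIGMA \<phi>:inj_labellings A I. I - \<phi> ` A"
  note fin = finite_inj_labellings[OF A(1) I]
  have bij: "bij_betw (\<lambda>(\<phi>, j). \<phi>(a := j)) ?S (inj_labellings (insert a A) I)"
  proof (rule bij_betwI[where g = "\<lambda>\<phi>. (\<phi>(a := undefined), \<phi> a)"])
    show "(\<lambda>(\<phi>, j). \<phi>(a := j)) \<in> ?S \<rightarrow> inj_labellings (insert a A) I"
    proof (clarify, intro conjI)
      fix \<phi> j assume \<phi>: "\<phi> \<in> A \<rightarrow>\<^sub>E I" "inj_on \<phi> A" and j: "j \<in> I" "j \<notin> \<phi> ` A"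
      show "\<phi>(a := j) \<in> insert a A \<rightarrow>\<^sub>E I"
        using \<phi> j by (auto simp: PiE_iff extensional_def)
      have "inj_on (\<phi>(a := j)) A" "(\<phi>(a := j)) ` A = \<phi> ` A"
        using A \<phi> by (auto simp: inj_on_def)
      thus "inj_on (\<phi>(a := j)) (insert a A)" using j A by auto
    qed
    show "(\<lambda>\<phi>. (\<phi>(a := undefined), \<phi> a)) \<in> inj_labellings (insert a A) I \<rightarrow> ?S"
    proof
      fix \<phi> assume "\<phi> \<in> inj_labellings (insert a A) I"
      hence \<phi>: "\<phi> \<in> insert a A \<rightarrow>\<^sub>E I" "inj_on \<phi> (insert a A)" by auto
      have img: "(\<phi>(a := undefined)) ` A = \<phi> ` A"
        using A by (intro image_cong) auto
      have "\<phi>(a := undefined) \<in> A \<rightarrow>\<^sub>E I"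
        using \<phi>(1) A by (auto simp: PiE_iff extensional_def)
      moreover have "inj_on (\<phi>(a := undefined)) A"
        using \<phi>(2) A by (subst inj_on_cong[of A _ \<phi>]) auto
      moreover have "\<phi> a \<in> I - (\<phi>(a := undefined)) ` A"
        unfolding img using \<phi> A by auto
      ultimately show "(\<phi>(a := undefined), \<phi> a) \<in> ?S" by auto
    qed
  qed (use A in \<open>auto simp: PiE_iff extensional_def\<close>)
  have "(\<Sum>\<phi>\<in>inj_labellings (insert a A) I. \<Prod>x\<in>insert a A. f x (\<phi> x)) =
        (\<Sum>(\<phi>, j)\<in>?S. \<Prod>x\<in>insert a A. f x ((\<phi>(a := j)) x))"
    by (subst sum.reindex_bij_betw[OF bij, symmetric]) (simp add: case_prod_beta')
  also have "\<dots> = (\<Sum>(\<phi>, j)\<in>?S. (\<Prod>x\<in>A. f x (\<phi> x)) * f a j)"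
  proof (intro sum.cong refl, clarify)
    fix \<phi> j
    have "(\<Prod>x\<in>A. f x ((\<phi>(a := j)) x)) = (\<Prod>x\<in>A. f x (\<phi> x))"
      using A by (intro prod.cong) auto
    thus "(\<Prod>x\<in>insert a A. f x ((\<phi>(a := j)) x)) = (\<Prod>x\<in>A. f x (\<phi> x)) * f a j"
      using A by (simp add: mult.commute)
  qed
  also have "\<dots> = (\<Sum>\<phi>\<in>inj_labellings A I. \<Sum>j\<in>I - \<phi> ` A. (\<Prod>x\<in>A. f x (\<phi> x)) * f a j)"
    using fin I by (subst sum.Sigma) auto
  finally show ?thesis by (simp add: sum_distrib_left)
qed

text \<open>
  If every single label has small weight, excluding the finitely many labels already taken is
  negligible, so the sum over injective labellings behaves like the sum over all of them, which is a
  product.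
\<close>

lemma tendsto_sum_inj_PiE:
  fixes f :: "nat \<Rightarrow> 'a \<Rightarrow> 'b \<Rightarrow> real"
  assumes A: "finite A" and I: "\<And>m. finite (I m)"
    and nonneg: "\<And>m x j. x \<in> A \<Longrightarrow> j \<in> I m \<Longrightarrow> 0 \<le> f m x j"
    and small: "\<And>m x j. x \<in> A \<Longrightarrow> j \<in> I m \<Longrightarrow> f m x j \<le> \<epsilon> m" and \<epsilon>: "\<epsilon> \<longlonglongrightarrow> 0"
    and lim: "\<And>x. x \<in> A \<Longrightarrow> (\<lambda>m. \<Sum>j\<in>I m. f m x j) \<longlonglongrightarrow> \<kappa> x"
  shows "(\<lambda>m. \<Sum>\<phi>\<in>inj_labellings A (I m). \<Prod>x\<in>A. f m x (\<phi> x)) \<longlonglongrightarrow> (\<Prod>x\<in>A. \<kappa> x)"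
  using A nonneg small lim
proof (induction A rule: finite_induct)
  case empty
  show ?case by simp
next
  case (insert a A)
  define S where "S = (\<lambda>m. \<Sum>\<phi>\<in>inj_labellings A (I m). \<Prod>x\<in>A. f m x (\<phi> x))"
  define T where "T = (\<lambda>m. \<Sum>\<phi>\<in>inj_labellings (insert a A) (I m). \<Prod>x\<in>insert a A. f m x (\<phi> x))"
  define R where "R = (\<lambda>m. \<Sum>j\<in>I m. f m a j)"
  have S: "S \<longlonglongrightarrow> (\<Prod>x\<in>A. \<kappa> x)" unfolding S_def using insert by auto
  have R: "R \<longlonglongrightarrow> \<kappa> a" unfolding R_def using insert by auto
  have T: "T m = (\<Sum>\<phi>\<in>inj_labellings A (I m). (\<Prod>x\<in>A. f m x (\<phi> x)) * (\<Sum>j\<in>I m - \<phi> ` A. f m a j))" for m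
    unfolding T_def by (rule sum_inj_PiE_insert) (use insert I in auto)
  have pos: "0 \<le> (\<Prod>x\<in>A. f m x (\<phi> x))" if "\<phi> \<in> A \<rightarrow>\<^sub>E I m" for m \<phi>
    using that insert.prems(1) by (intro prod_nonneg) (auto simp: PiE_iff)
  have upper: "T m \<le> S m * R m" for m
    unfolding T S_def R_def sum_distrib_right
    using insert.prems(1) pos I
    by (intro sum_mono mult_left_mono sum_mono2) auto
  (* at most card A labels are excluded, each of weight at most \<epsilon> m *)
  have lower: "S m * (R m - card A * \<epsilon> m) \<le> T m" for m
    unfolding T S_def sum_distrib_right
  proof (intro sum_mono mult_left_mono)
    fix \<phi> assume \<phi>: "\<phi> \<in> inj_labellings A (I m)"
    hence sub: "\<phi> ` A \<subseteq> I m" by auto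
    have "(\<Sum>j\<in>\<phi> ` A. f m a j) \<le> card A * \<epsilon> m"
    proof -
      have "(\<Sum>j\<in>\<phi> ` A. f m a j) \<le> card (\<phi> ` A) * \<epsilon> m"
        by (rule sum_bounded_above) (use insert.prems(2) sub in blast)
      also have "card (\<phi> ` A) = card A" using \<phi> by (intro card_image) auto
      finally show ?thesis .
    qed
    thus "R m - card A * \<epsilon> m \<le> (\<Sum>j\<in>I m - \<phi> ` A. f m a j)"
      unfolding R_def using sum_diff[OF I sub, of "f m a"] by simp
    show "0 \<le> (\<Prod>x\<in>A. f m x (\<phi> x))" using pos \<phi> by auto
  qed
  have "T \<longlonglongrightarrow> (\<Prod>x\<in>A. \<kappa> x) * \<kappa> a"
  proof (rule tendsto_sandwich)
    show "\<forall>\<^sub>F m in sequentially. S m * (R m - card A * \<epsilon> m) \<le> T m" using lower by simp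
    show "\<forall>\<^sub>F m in sequentially. T m \<le> S m * R m" using upper by simp
    show "(\<lambda>m. S m * R m) \<longlonglongrightarrow> (\<Prod>x\<in>A. \<kappa> x) * \<kappa> a" by (intro tendsto_mult S R)
    have "(\<lambda>m. S m * (R m - card A * \<epsilon> m)) \<longlonglongrightarrow> (\<Prod>x\<in>A. \<kappa> x) * (\<kappa> a - real (card A) * 0)"
      by (rule tendsto_mult[OF S tendsto_diff[OF R tendsto_mult_left[OF \<epsilon>]]])
    thus "(\<lambda>m. S m * (R m - card A * \<epsilon> m)) \<longlonglongrightarrow> (\<Prod>x\<in>A. \<kappa> x) * \<kappa> a" by simp
  qed
  thus ?case using insert by (simp add: T_def mult.commute)
qed

section \<open>Moments in terms of cumulants\<close>

text \<open>
  The usual recursion for moments in terms of cumulants \<open>k 1, k 2, \<dots>\<close>.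
\<close>

fun moment_of_cumulants :: "(nat \<Rightarrow> real) \<Rightarrow> nat \<Rightarrow> real" where
  "moment_of_cumulants k 0 = 1"
| "moment_of_cumulants k (Suc n) =
     (\<Sum>i\<le>n. of_nat (n choose i) * k (Suc i) * moment_of_cumulants k (n - i))"

lemma moment_of_cumulants_nonneg:
  assumes "\<And>i. 0 \<le> k i"
  shows "0 \<le> moment_of_cumulants k n"
proof (induction n rule: less_induct)
  case (less n)
  show ?case using less assms by (cases n) (auto intro!: sum_nonneg)
qed

lemma moment_of_cumulants_mono:
  assumes "\<And>i. 0 \<le> k i" "\<And>i. k i \<le> l i"
  shows "moment_of_cumulants k n \<le> moment_of_cumulants l n"
proof (induction n rule: less_induct)
  case (less n)
  have l: "0 \<le> l i" for i using assms order_trans by blast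
  show ?case
  proof (cases n)
    case (Suc m)
    have "moment_of_cumulants k (Suc m) \<le> moment_of_cumulants l (Suc m)"
      unfolding moment_of_cumulants.simps
      by (intro sum_mono mult_mono) (use Suc less assms l moment_of_cumulants_nonneg in auto)
    thus ?thesis using Suc by simp
  qed simp
qed

lemma moment_of_scaled_cumulants_le:
  assumes k: "\<And>i. 0 \<le> k i" and h: "0 \<le> h" "h \<le> 1" and n: "n > 0"
  shows "moment_of_cumulants (\<lambda>i. h * k i) n \<le> h * moment_of_cumulants k n"
proof -
  obtain m where m: "n = Suc m" using n by (cases n) auto
  have "moment_of_cumulants (\<lambda>i. h * k i) (m - i) \<le> moment_of_cumulants k (m - i)" for i
    using k h by (intro moment_of_cumulants_mono) (auto intro: mult_left_le_one_le)
  hence "(\<Sum>i\<le>m. of_nat (m choose i) * (h * k (Suc i)) * moment_of_cumulants (\<lambda>i. h * k i) (m - i))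
      \<le> (\<Sum>i\<le>m. of_nat (m choose i) * (h * k (Suc i)) * moment_of_cumulants k (m - i))"
    using k h by (intro sum_mono mult_left_mono) auto
  thus ?thesis unfolding m by (simp add: sum_distrib_left mult_ac)
qed

text \<open>
  Every product of two or more cumulants carries a factor \<open>h\<^sup>2\<close>, so only the single cumulant survives
  to first order in \<open>h\<close>.
\<close>

lemma moment_of_scaled_cumulants_diff:
  assumes k: "\<And>i. 0 \<le> k i" and h: "0 \<le> h" "h \<le> 1" and n: "n > 0"
  shows "h * k n \<le> moment_of_cumulants (\<lambda>i. h * k i) n"
    and "moment_of_cumulants (\<lambda>i. h * k i) n \<le> h * k n + h\<^sup>2 * moment_of_cumulants k n"
proof -
  obtain m where m: "n = Suc m" using n by (cases n) auto
  let ?Q = "moment_of_cumulants (\<lambda>i. h * k i)"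
  have split: "?Q n = (\<Sum>i<m. of_nat (m choose i) * (h * k (Suc i)) * ?Q (m - i)) + h * k n"
    unfolding m by (simp add: lessThan_Suc_atMost[symmetric] del: moment_of_cumulants.simps(1))
       (simp add: lessThan_Suc_atMost)
  have Q0: "0 \<le> ?Q i" for i using k h by (intro moment_of_cumulants_nonneg) auto
  show "h * k n \<le> ?Q n"
    unfolding split using k h Q0 by (auto intro!: sum_nonneg)
  have "(\<Sum>i<m. of_nat (m choose i) * (h * k (Suc i)) * ?Q (m - i)) \<le>
        (\<Sum>i<m. of_nat (m choose i) * (h * k (Suc i)) * (h * moment_of_cumulants k (m - i)))"
    by (intro sum_mono mult_left_mono moment_of_scaled_cumulants_le) (use k h in auto)
  also have "\<dots> = h\<^sup>2 * (\<Sum>i<m. of_nat (m choose i) * k (Suc i) * moment_of_cumulants k (m - i))"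
    by (simp add: sum_distrib_left power2_eq_square mult_ac)
  also have "\<dots> \<le> h\<^sup>2 * moment_of_cumulants k n"
    unfolding m moment_of_cumulants.simps
    by (intro mult_left_mono sum_mono2) (use k moment_of_cumulants_nonneg in auto)
  finally show "?Q n \<le> h * k n + h\<^sup>2 * moment_of_cumulants k n"
    unfolding split by simp
qed

text \<open>
  Cells of masses \<open>h m j\<close> with total \<open>1\<close> and vanishing maximum: the first order terms sum to the
  cumulant, and the quadratic remainders sum to at most the maximal mass times a constant.
\<close>

lemma tendsto_sum_inj_moments:
  fixes h :: "nat \<Rightarrow> 'b \<Rightarrow> real" and n :: "'a \<Rightarrow> nat"
  assumes k: "\<And>i. 0 \<le> k i" and A: "finite A" and n: "\<And>x. x \<in> A \<Longrightarrow> n x > 0" and I: "\<And>m. finite (I m)"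
    and h: "\<And>m j. j \<in> I m \<Longrightarrow> 0 \<le> h m j" "\<And>m. (\<Sum>j\<in>I m. h m j) = 1"
    and small: "\<And>m j. j \<in> I m \<Longrightarrow> h m j \<le> \<eta> m" and \<eta>: "\<eta> \<longlonglongrightarrow> 0"
  shows "(\<lambda>m. \<Sum>\<phi>\<in>inj_labellings A (I m). \<Prod>x\<in>A. moment_of_cumulants (\<lambda>i. h m (\<phi> x) * k i) (n x))
           \<longlonglongrightarrow> (\<Prod>x\<in>A. k (n x))"
proof -
  define C where "C = (\<Sum>x\<in>A. moment_of_cumulants k (n x))"
  have C0: "0 \<le> C" unfolding C_def by (intro sum_nonneg moment_of_cumulants_nonneg k)
  have C: "moment_of_cumulants k (n x) \<le> C" if "x \<in> A" for x
    unfolding C_def using A that by (intro member_le_sum moment_of_cumulants_nonneg k) auto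
  have h1: "h m j \<le> 1" if "j \<in> I m" for m j
    using member_le_sum[of j "I m" "h m"] h that I by auto
  have ne: "\<eta> m \<ge> 0" for m
  proof -
    have "I m \<noteq> {}" using h(2)[of m] by auto
    then obtain j where "j \<in> I m" by auto
    thus ?thesis using h(1) small order_trans by blast
  qed
  show ?thesis
  proof (rule tendsto_sum_inj_PiE[where f = "\<lambda>m x j. moment_of_cumulants (\<lambda>i. h m j * k i) (n x)"
          and \<epsilon> = "\<lambda>m. \<eta> m * C"])
    show "(\<lambda>m. \<eta> m * C) \<longlonglongrightarrow> 0" using tendsto_mult_right[OF \<eta>, of C] by simp
    show "moment_of_cumulants (\<lambda>i. h m j * k i) (n x) \<le> \<eta> m * C" if "x \<in> A" "j \<in> I m" for m x j
    proof -
      have "moment_of_cumulants (\<lambda>i. h m j * k i) (n x) \<le> h m j * moment_of_cumulants k (n x)"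
        by (intro moment_of_scaled_cumulants_le) (use that k h h1 n in auto)
      also have "\<dots> \<le> \<eta> m * C"
        using that small C ne by (intro mult_mono moment_of_cumulants_nonneg k) auto
      finally show ?thesis .
    qed
    show "0 \<le> moment_of_cumulants (\<lambda>i. h m j * k i) (n x)" if "x \<in> A" "j \<in> I m" for m x j
      by (intro moment_of_cumulants_nonneg mult_nonneg_nonneg) (use that h k in auto)
    show "(\<lambda>m. \<Sum>j\<in>I m. moment_of_cumulants (\<lambda>i. h m j * k i) (n x)) \<longlonglongrightarrow> k (n x)" if x: "x \<in> A" for x
    proof (rule tendsto_sandwich)
      have "(\<Sum>j\<in>I m. h m j * k (n x)) \<le> (\<Sum>j\<in>I m. moment_of_cumulants (\<lambda>i. h m j * k i) (n x))" for m
        by (intro sum_mono moment_of_scaled_cumulants_diff) (use x h h1 k n in auto)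
      thus "\<forall>\<^sub>F m in sequentially. k (n x) \<le> (\<Sum>j\<in>I m. moment_of_cumulants (\<lambda>i. h m j * k i) (n x))"
        by (simp add: sum_distrib_right[symmetric] h(2))
      have "(\<Sum>j\<in>I m. moment_of_cumulants (\<lambda>i. h m j * k i) (n x)) \<le> k (n x) + \<eta> m * C" for m
      proof -
        have "(\<Sum>j\<in>I m. moment_of_cumulants (\<lambda>i. h m j * k i) (n x)) \<le> (\<Sum>j\<in>I m. h m j * (k (n x) + \<eta> m * C))"
        proof (rule sum_mono)
          fix j assume j: "j \<in> I m"
          have "moment_of_cumulants (\<lambda>i. h m j * k i) (n x) \<le> h m j * k (n x) + (h m j)\<^sup>2 * moment_of_cumulants k (n x)"
            by (intro moment_of_scaled_cumulants_diff) (use x j h h1 k n in auto)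
          also have "(h m j)\<^sup>2 * moment_of_cumulants k (n x) \<le> h m j * (\<eta> m * C)"
            unfolding power2_eq_square mult.assoc
            using j x h(1) small C ne by (intro mult_left_mono mult_mono moment_of_cumulants_nonneg k) auto
          finally show "moment_of_cumulants (\<lambda>i. h m j * k i) (n x) \<le> h m j * (k (n x) + \<eta> m * C)"
            by (simp add: algebra_simps)
        qed
        also have "\<dots> = k (n x) + \<eta> m * C" by (simp add: sum_distrib_right[symmetric] h(2))
        finally show ?thesis .
      qed
      thus "\<forall>\<^sub>F m in sequentially. (\<Sum>j\<in>I m. moment_of_cumulants (\<lambda>i. h m j * k i) (n x)) \<le> k (n x) + \<eta> m * C"
        by simp
      have "(\<lambda>m. k (n x) + \<eta> m * C) \<longlonglongrightarrow> k (n x) + 0 * C" by (intro tendsto_intros \<eta>)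
      thus "(\<lambda>m. k (n x) + \<eta> m * C) \<longlonglongrightarrow> k (n x)" by simp
    qed simp
  qed (use A I in auto)
qed

section \<open>Moments of a completely random measure\<close>

lemma sum_pascal:
  fixes a b :: "nat \<Rightarrow> 'a::comm_semiring_1"
  shows "(\<Sum>i\<le>n. of_nat (n choose i) * (a (Suc i) * b (n - i) + a i * b (Suc n - i))) =
         (\<Sum>i\<le>Suc n. of_nat (Suc n choose i) * (a i * b (Suc n - i)))"
proof -
  have "(\<Sum>i\<le>Suc n. of_nat (Suc n choose i) * (a i * b (Suc n - i))) =
        a 0 * b (Suc n) + (\<Sum>i\<le>n. of_nat (Suc n choose Suc i) * (a (Suc i) * b (n - i)))"
    by (subst sum.atMost_Suc_shift) simp
  also have "(\<Sum>i\<le>n. of_nat (Suc n choose Suc i) * (a (Suc i) * b (n - i))) =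
        (\<Sum>i\<le>n. of_nat (n choose i) * (a (Suc i) * b (n - i))) +
        (\<Sum>i\<le>n. of_nat (n choose Suc i) * (a (Suc i) * b (n - i)))"
    by (simp add: sum.distrib[symmetric] algebra_simps)
  also have "a 0 * b (Suc n) + (\<dots>) = (\<Sum>i\<le>n. of_nat (n choose i) * (a (Suc i) * b (n - i))) +
        (a 0 * b (Suc n) + (\<Sum>i\<le>n. of_nat (n choose Suc i) * (a (Suc i) * b (n - i))))"
    by (simp add: algebra_simps)
  also have "a 0 * b (Suc n) + (\<Sum>i\<le>n. of_nat (n choose Suc i) * (a (Suc i) * b (n - i))) =
       (\<Sum>i\<le>Suc n. of_nat (n choose i) * (a i * b (Suc n - i)))"
    by (simp add: sum.atMost_Suc_shift del: sum.atMost_Suc)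
  also have "\<dots> = (\<Sum>i\<le>n. of_nat (n choose i) * (a i * b (Suc n - i)))"
    by (simp add: binomial_eq_0)
  finally show ?thesis by (simp add: sum.distrib distrib_left)
qed

text \<open>
  If \<open>A\<close> is the law of an infinitely divisible variable with exponent \<open>h \<psi>\<close>, its tilted cumulants are
  \<open>h\<close> times the tilted moments of \<open>L\<close>. The recursion is obtained by differentiating
  \<open>W' = - h \<kappa>\<^sub>1 W\<close> repeatedly, where \<open>W\<close> is the Laplace transform of \<open>A\<close>.
\<close>

lemma tilted_moment_compound:
  assumes A: "levy_measure A" and L: "levy_measure L"
    and lap: "\<And>u. u > 0 \<Longrightarrow> laplace_exponent A u = 1 - exp (- (h * laplace_exponent L u))"
    and n: "n > 0" and u: "u > 0"
  shows "tilted_moment A n u =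
           exp (- (h * laplace_exponent L u)) * moment_of_cumulants (\<lambda>i. h * tilted_moment L i u) n"
proof -
  define W where "W = (\<lambda>n u. if n = 0 then 1 - laplace_exponent A u else tilted_moment A n u)"
  have W0: "W 0 u = exp (- (h * laplace_exponent L u))" if "u > 0" for u
    using lap[OF that] by (simp add: W_def)
  have dW: "(W n has_real_derivative - W (Suc n) u) (at u)" if u: "u > 0" for n u
  proof (cases "n = 0")
    case True
    show ?thesis unfolding W_def using has_derivative_laplace_exponent[OF A u] True
      by (auto intro!: derivative_eq_intros)
  next
    case False
    thus ?thesis unfolding W_def using has_derivative_tilted_moment[OF A u, of n] by simp
  qed
  let ?k = "\<lambda>i u. h * tilted_moment L (Suc i) u"
  have dk: "(?k i has_real_derivative - ?k (Suc i) u) (at u)" if u: "u > 0" for i u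
    using has_derivative_tilted_moment[OF L u, of "Suc i"] by (auto intro!: derivative_eq_intros)
  have rec: "W (Suc n) u = (\<Sum>i\<le>n. of_nat (n choose i) * (?k i u * W (n - i) u))" if "u > 0" for n u
    using that
  proof (induction n arbitrary: u)
    case 0
    have ev: "\<forall>\<^sub>F v in nhds u. v > 0" using 0 by (intro eventually_nhds_in_open[of "{0<..}", simplified]) auto
    have "((\<lambda>u. exp (- (h * laplace_exponent L u))) has_real_derivative
            - (?k 0 u * exp (- (h * laplace_exponent L u)))) (at u)"
      using has_derivative_laplace_exponent[OF L 0] by (auto intro!: derivative_eq_intros)
    also have "?this \<longleftrightarrow> (W 0 has_real_derivative - (?k 0 u * exp (- (h * laplace_exponent L u)))) (at u)"
      by (rule DERIV_cong_ev[OF refl _ refl]) (use ev W0 in \<open>auto elim: eventually_mono\<close>)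
    finally have "- W (Suc 0) u = - (?k 0 u * exp (- (h * laplace_exponent L u)))"
      by (rule DERIV_unique[OF dW[OF 0]])
    thus ?case using W0[OF 0] by simp
  next
    case (Suc n)
    have ev: "\<forall>\<^sub>F v in nhds u. v > 0" using Suc.prems by (intro eventually_nhds_in_open[of "{0<..}", simplified]) auto
    have "((\<lambda>u. \<Sum>i\<le>n. of_nat (n choose i) * (?k i u * W (n - i) u)) has_real_derivative
            (\<Sum>i\<le>n. of_nat (n choose i) * (- ?k (Suc i) u * W (n - i) u + - W (Suc (n - i)) u * ?k i u))) (at u)"
      by (intro DERIV_sum DERIV_cmult DERIV_mult dk dW Suc.prems)
    also have "?this \<longleftrightarrow> (W (Suc n) has_real_derivative
            (\<Sum>i\<le>n. of_nat (n choose i) * (- ?k (Suc i) u * W (n - i) u + - W (Suc (n - i)) u * ?k i u))) (at u)"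
      by (rule DERIV_cong_ev[OF refl _ refl]) (use ev Suc.IH in \<open>auto elim!: eventually_mono\<close>)
    finally have "- W (Suc (Suc n)) u =
        (\<Sum>i\<le>n. of_nat (n choose i) * (- ?k (Suc i) u * W (n - i) u + - W (Suc (n - i)) u * ?k i u))"
      by (rule DERIV_unique[OF dW[OF Suc.prems]])
    also have "\<dots> = - (\<Sum>i\<le>n. of_nat (n choose i) * (?k (Suc i) u * W (n - i) u + ?k i u * W (Suc n - i) u))"
      by (subst sum_negf[symmetric], intro sum.cong refl) (auto simp: algebra_simps Suc_diff_le)
    also have "\<dots> = - (\<Sum>i\<le>Suc n. of_nat (Suc n choose i) * (?k i u * W (Suc n - i) u))"
      by (subst sum_pascal[of n "\<lambda>i. ?k i u" "\<lambda>i. W i u"]) simp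
    finally show ?case by simp
  qed
  have "W n u = exp (- (h * laplace_exponent L u)) * moment_of_cumulants (\<lambda>i. h * tilted_moment L i u) n" for n
  proof (induction n rule: less_induct)
    case (less n)
    show ?case
    proof (cases n)
      case 0 thus ?thesis using W0[OF u] by simp
    next
      case (Suc m)
      have "W (Suc m) u = (\<Sum>i\<le>m. of_nat (m choose i) * (?k i u * (exp (- (h * laplace_exponent L u)) *
              moment_of_cumulants (\<lambda>i. h * tilted_moment L i u) (m - i))))"
        unfolding rec[OF u] by (intro sum.cong refl) (use less Suc in auto)
      thus ?thesis unfolding Suc by (simp add: sum_distrib_left mult_ac)
    qed
  qed
  from this[of n] show ?thesis using n by (simp add: W_def)
qed

definition levy_measure_of :: "(real \<Rightarrow> real) \<Rightarrow> real measure" where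
  "levy_measure_of \<rho> = density lborel (\<lambda>x. ennreal (indicator {0<..} x * \<rho> x))"

lemma levy_densityD:
  assumes "levy_density \<rho>"
  shows "(\<lambda>x. indicator {0<..} x * \<rho> x) \<in> borel_measurable borel"
    and "0 \<le> indicator {0<..} x * \<rho> x"
    and "\<And>f. f \<in> borel_measurable borel \<Longrightarrow>
          (\<integral>\<^sup>+x. f x \<partial>levy_measure_of \<rho>) = (\<integral>\<^sup>+x\<in>{0<..}. f x * ennreal (\<rho> x) \<partial>lborel)"
proof -
  show m: "(\<lambda>x. indicator {0<..} x * \<rho> x) \<in> borel_measurable borel"
    using assms by (simp add: levy_density_def set_borel_measurable_def)
  show "0 \<le> indicator {0<..} x * \<rho> x" using assms by (auto simp: levy_density_def indicator_def)
  fix f :: "real \<Rightarrow> ennreal" assume [measurable]: "f \<in> borel_measurable borel"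
  have m': "(\<lambda>x. ennreal (indicator {0<..} x * \<rho> x)) \<in> borel_measurable lborel"
    using m by measurable
  show "(\<integral>\<^sup>+x. f x \<partial>levy_measure_of \<rho>) = (\<integral>\<^sup>+x\<in>{0<..}. f x * ennreal (\<rho> x) \<partial>lborel)"
    unfolding levy_measure_of_def
    by (subst nn_integral_density[OF m']) (auto intro!: nn_integral_cong simp: indicator_def mult_ac)
qed

lemma levy_measure_levy_measure_of:
  assumes "levy_density \<rho>"
  shows "levy_measure (levy_measure_of \<rho>)" "AE x in levy_measure_of \<rho>. 0 < x"
    "emeasure (levy_measure_of \<rho>) UNIV = \<infinity>"
proof -
  have m': "(\<lambda>x. ennreal (indicator {0<..} x * \<rho> x)) \<in> borel_measurable lborel"
    using levy_densityD(1)[OF assms] by measurable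
  show pos: "AE x in levy_measure_of \<rho>. 0 < x"
    unfolding levy_measure_of_def by (subst AE_density[OF m']) (auto simp: indicator_def)
  have s [measurable_cong]: "sets (levy_measure_of \<rho>) = sets borel" by (simp add: levy_measure_of_def)
  have "(\<integral>\<^sup>+x. ennreal (min 1 x) \<partial>levy_measure_of \<rho>) = (\<integral>\<^sup>+x\<in>{0<..}. ennreal (min 1 x * \<rho> x) \<partial>lborel)"
    unfolding levy_densityD(3)[OF assms, of "\<lambda>x. ennreal (min 1 x)", simplified] using assms
    by (intro nn_integral_cong) (auto simp: indicator_def ennreal_mult levy_density_def)
  also have "\<dots> < \<infinity>" using assms by (simp add: levy_density_def)
  finally have fin: "(\<integral>\<^sup>+x. ennreal (min 1 x) \<partial>levy_measure_of \<rho>) < \<infinity>" .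
  have "integrable (levy_measure_of \<rho>) (\<lambda>x. min 1 x)"
    by (rule integrableI_nonneg) (use fin pos in \<open>auto elim: AE_mp\<close>)
  thus "levy_measure (levy_measure_of \<rho>)"
    unfolding levy_measure_def using s pos by (auto elim: AE_mp)
  show "emeasure (levy_measure_of \<rho>) UNIV = \<infinity>"
    using levy_densityD(3)[OF assms, of "\<lambda>_. 1"] assms s
    by (simp add: levy_density_def sets_eq_imp_space_eq[OF s])
qed

lemma sigma_finite_levy_measure_of:
  assumes "levy_density \<rho>" shows "sigma_finite_measure (levy_measure_of \<rho>)"
proof -
  have "(\<lambda>x. ennreal (indicator {0<..} x * \<rho> x)) \<in> borel_measurable lborel"
    using levy_densityD(1)[OF assms] by measurable
  thus ?thesis unfolding levy_measure_of_def
    by (subst sigma_finite_measure.sigma_finite_iff_density_finite[OF sigma_finite_lborel]) auto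
qed

lemma borel_measurable_tilted_moment:
  assumes "levy_density \<rho>" shows "tilted_moment (levy_measure_of \<rho>) i \<in> borel_measurable borel"
proof -
  interpret L: sigma_finite_measure "levy_measure_of \<rho>" by (rule sigma_finite_levy_measure_of[OF assms])
  have [measurable_cong]: "sets (levy_measure_of \<rho>) = sets borel" by (simp add: levy_measure_of_def)
  show ?thesis unfolding tilted_moment_def[abs_def] by measurable
qed

lemma borel_measurable_laplace_exponent:
  assumes "levy_density \<rho>" shows "laplace_exponent (levy_measure_of \<rho>) \<in> borel_measurable borel"
proof -
  interpret L: sigma_finite_measure "levy_measure_of \<rho>" by (rule sigma_finite_levy_measure_of[OF assms])
  have [measurable_cong]: "sets (levy_measure_of \<rho>) = sets borel" by (simp add: levy_measure_of_def)
  show ?thesis unfolding laplace_exponent_def[abs_def] by measurable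
qed

locale levy_intensity =
  fixes \<rho> :: "real \<Rightarrow> real"
  assumes levy: "levy_density \<rho>"
begin

abbreviation "L \<equiv> levy_measure_of \<rho>"
abbreviation "\<psi> \<equiv> laplace_exponent L"
abbreviation "\<kappa> \<equiv> tilted_moment L"

lemmas levy_measure = levy_measure_levy_measure_of(1)[OF levy]

lemmas measurable_exponent [measurable] =
  borel_measurable_laplace_exponent[OF levy] borel_measurable_tilted_moment[OF levy]

lemma \<kappa>_pos: "u > 0 \<Longrightarrow> n > 0 \<Longrightarrow> 0 < \<kappa> n u"
  using tilted_moment_pos[OF levy_measure _ _ levy_measure_levy_measure_of(2)[OF levy]]
    levy_measure_levy_measure_of(3)[OF levy] by simp

end

locale finite_homogeneous_crm = levy_intensity \<rho> + N: prob_space N + H: prob_space H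
  for N :: "'w measure" and \<mu> :: "'w \<Rightarrow> 's::topological_space measure" and H :: "'s measure" and \<rho> :: "real \<Rightarrow> real" +
  assumes sets_H: "sets H = sets borel" and crm: "homogeneous_crm N \<mu> H \<rho>"
    and finite_total: "AE w in N. emeasure (\<mu> w) UNIV < \<infinity>"
begin

lemma sets_\<mu>: "w \<in> space N \<Longrightarrow> sets (\<mu> w) = sets borel"
  and emeasure_\<mu>_meas [measurable]: "B \<in> sets borel \<Longrightarrow> (\<lambda>w. emeasure (\<mu> w) B) \<in> borel_measurable N"
  using crm by (auto simp: homogeneous_crm_def completely_random_measure_def random_measure_def)

lemma measure_\<mu>_meas [measurable]: "B \<in> sets borel \<Longrightarrow> (\<lambda>w. measure (\<mu> w) B) \<in> borel_measurable N"
  unfolding measure_def by simp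

lemma space_\<mu>: "w \<in> space N \<Longrightarrow> space (\<mu> w) = UNIV"
  using sets_eq_imp_space_eq[OF sets_\<mu>] by simp

lemma AE_finite: "AE w in N. finite_measure (\<mu> w)"
  using finite_total AE_space by eventually_elim (auto intro!: finite_measureI simp: space_\<mu>)

text \<open>
  The Laplace functional at \<open>u\<close> times the indicator of \<open>B\<close>.
\<close>

lemma laplace_measure:
  assumes B [measurable]: "B \<in> sets borel" and u: "u > 0"
  shows "(\<integral>w. exp (- (u * measure (\<mu> w) B)) \<partial>N) = exp (- (measure H B * \<psi> u))"
proof -
  let ?g = "\<lambda>s. u * indicator B s :: real"
  note [measurable] = levy_densityD(1)[OF levy]
  have "(\<integral>w. exp (- (u * measure (\<mu> w) B)) \<partial>N) = (\<integral>w. exp_neg (\<integral>\<^sup>+s. ennreal (?g s) \<partial>\<mu> w) \<partial>N)"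
  proof (rule integral_cong_AE)
    have int: "(\<integral>\<^sup>+s. ennreal (?g s) \<partial>\<mu> w) = ennreal u * emeasure (\<mu> w) B" if "w \<in> space N" for w
    proof -
      note [measurable_cong] = sets_\<mu>[OF that]
      have "(\<integral>\<^sup>+s. ennreal (?g s) \<partial>\<mu> w) = (\<integral>\<^sup>+s. ennreal u * indicator B s \<partial>\<mu> w)"
        by (intro nn_integral_cong) (auto simp: indicator_def)
      also have "\<dots> = ennreal u * emeasure (\<mu> w) B"
        by (rule nn_integral_cmult_indicator) measurable
      finally show ?thesis .
    qed
    have "exp_neg \<in> borel_measurable borel" unfolding exp_neg_def by measurable
    hence "(\<lambda>w. exp_neg (ennreal u * emeasure (\<mu> w) B)) \<in> borel_measurable N"
      by (rule measurable_compose[rotated]) measurable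
    thus "(\<lambda>w. exp_neg (\<integral>\<^sup>+s. ennreal (?g s) \<partial>\<mu> w)) \<in> borel_measurable N"
      by (subst measurable_cong[OF arg_cong[OF int]])
    show "AE w in N. exp (- (u * measure (\<mu> w) B)) = exp_neg (\<integral>\<^sup>+s. ennreal (?g s) \<partial>\<mu> w)"
      using AE_finite AE_space
    proof eventually_elim
      case (elim w)
      interpret finite_measure "\<mu> w" by (rule elim)
      show ?case unfolding int[OF elim(2)] exp_neg_def using u
        by (auto simp: emeasure_eq_measure ennreal_mult[symmetric])
    qed
  qed measurable
  also have "\<dots> = exp_neg (\<integral>\<^sup>+s. (\<integral>\<^sup>+x\<in>{0<..}. ennreal ((1 - exp (- (?g s * x))) * \<rho> x) \<partial>lborel) \<partial>H)"
    using crm u by (auto simp: homogeneous_crm_def)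
  also have "(\<lambda>s. \<integral>\<^sup>+x\<in>{0<..}. ennreal ((1 - exp (- (?g s * x))) * \<rho> x) \<partial>lborel) =
             (\<lambda>s. ennreal (\<psi> u) * indicator B s)"
  proof
    fix s
    have "(\<integral>\<^sup>+x\<in>{0<..}. ennreal ((1 - exp (- (u * x))) * \<rho> x) \<partial>lborel) =
          (\<integral>\<^sup>+x. ennreal (1 - exp (- (u * x))) \<partial>levy_measure_of \<rho>)"
      using levy u unfolding levy_densityD(3)[OF levy, of "\<lambda>x. ennreal (1 - exp (- (u * x)))", simplified]
      by (intro nn_integral_cong) (auto simp: indicator_def ennreal_mult levy_density_def)
    also have "\<dots> = ennreal (\<psi> u)"
      using ennreal_laplace_exponent[OF levy_measure u] by simp
    finally show "(\<integral>\<^sup>+x\<in>{0<..}. ennreal ((1 - exp (- (?g s * x))) * \<rho> x) \<partial>lborel) = ennreal (\<psi> u) * indicator B s"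
      by (auto simp: indicator_def)
  qed
  also have "(\<integral>\<^sup>+s. ennreal (\<psi> u) * indicator B s \<partial>H) = ennreal (measure H B * \<psi> u)"
    using laplace_exponent_nonneg[OF levy_measure u] sets_H
    by (subst nn_integral_cmult_indicator) (auto simp: H.emeasure_eq_measure ennreal_mult mult.commute)
  also have "exp_neg \<dots> = exp (- (measure H B * \<psi> u))"
    using laplace_exponent_nonneg[OF levy_measure u]
    by (simp add: exp_neg_def)
  finally show ?thesis .
qed

lemma nn_integral_power_measure:
  assumes B [measurable]: "B \<in> sets borel" and u: "u > 0"
  shows "(\<integral>\<^sup>+w. ennreal (measure (\<mu> w) B ^ n * exp (- (u * measure (\<mu> w) B))) \<partial>N) =
         ennreal (exp (- (measure H B * \<psi> u)) * moment_of_cumulants (\<lambda>i. measure H B * \<kappa> i u) n)"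
proof -
  define A where "A = distr N borel (\<lambda>w. measure (\<mu> w) B)"
  interpret A: prob_space A unfolding A_def by (rule N.prob_space_distr) measurable
  have sA [measurable_cong]: "sets A = sets borel" by (simp add: A_def)
  have posA: "AE x in A. 0 \<le> x" unfolding A_def by (subst AE_distr_iff) auto
  have "integrable A (\<lambda>x. min 1 x)"
    by (rule A.integrable_const_bound[where B = 1]) (use posA in \<open>auto elim: AE_mp\<close>)
  hence A: "levy_measure A" using sA posA by (simp add: levy_measure_def)
  have inte: "integrable A (\<lambda>x. exp (- (u * x)))" if "u > 0" for u
    by (rule A.integrable_const_bound[where B = 1]) (use posA that in \<open>auto elim: AE_mp\<close>)
  have E: "(\<integral>x. exp (- (u * x)) \<partial>A) = exp (- (measure H B * \<psi> u))" if "u > 0" for u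
    unfolding A_def using laplace_measure[OF B that] by (subst integral_distr) auto
  have lap: "laplace_exponent A u = 1 - exp (- (measure H B * \<psi> u))" if "u > 0" for u
  proof -
    have "laplace_exponent A u = (\<integral>x. 1 - exp (- (u * x)) \<partial>A)" by (simp add: laplace_exponent_def)
    also have "\<dots> = 1 - (\<integral>x. exp (- (u * x)) \<partial>A)" using inte[OF that] A.prob_space by simp
    finally show ?thesis using E[OF that] by simp
  qed
  have "(\<integral>\<^sup>+w. ennreal (measure (\<mu> w) B ^ n * exp (- (u * measure (\<mu> w) B))) \<partial>N) =
        (\<integral>\<^sup>+x. ennreal (x ^ n * exp (- (u * x))) \<partial>A)"
    unfolding A_def by (subst nn_integral_distr) auto
  also have "\<dots> = ennreal (exp (- (measure H B * \<psi> u)) * moment_of_cumulants (\<lambda>i. measure H B * \<kappa> i u) n)"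
  proof (cases "n = 0")
    case True
    have "(\<integral>\<^sup>+x. ennreal (exp (- (u * x))) \<partial>A) = ennreal (\<integral>x. exp (- (u * x)) \<partial>A)"
      by (rule nn_integral_eq_integral[OF inte[OF u]]) simp
    thus ?thesis using True E[OF u] by simp
  next
    case False
    thus ?thesis
      using ennreal_tilted_moment[OF A u, of n] tilted_moment_compound[OF A levy_measure lap, of n u] u
      by simp
  qed
  finally show ?thesis .
qed

end

section \<open>Sampling and patterns of ties\<close>

lemma partition_on_eqI: "partition_on A \<A> \<Longrightarrow> B \<in> \<A> \<Longrightarrow> C \<in> \<A> \<Longrightarrow> x \<in> B \<Longrightarrow> x \<in> C \<Longrightarrow> B = C"
  by (auto simp: partition_on_def disjoint_def)

lemma finite_blocks: "partition_on {..<n} \<A> \<Longrightarrow> finite \<A>" for n :: nat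
  using finite_elements[of "{..<n}" \<A>] by simp

lemma finite_block: "partition_on {..<n} \<A> \<Longrightarrow> A \<in> \<A> \<Longrightarrow> finite A" for n :: nat
  using finite_subset[of A "{..<n}"] partition_onD1[of "{..<n}" \<A>] by blast

lemma card_block_pos: "partition_on {..<n} \<A> \<Longrightarrow> A \<in> \<A> \<Longrightarrow> card A > 0" for n :: nat
  using finite_block[of n \<A> A] partition_onD3[of "{..<n}" \<A>] by (auto simp: card_gt_0_iff)

lemma sum_card_blocks: "partition_on {..<n} \<A> \<Longrightarrow> (\<Sum>A\<in>\<A>. card A) = n" for n :: nat
  using product_partition[of "{..<n}" \<A>] finite_block[of n \<A>] by simp

lemma restrict_tie_partition_eq_iff:
  assumes \<A>: "partition_on {..<n} \<A>"
  shows "restrict_partition n (tie_partition x) = \<A> \<longleftrightarrow>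
           (\<forall>i<n. \<forall>j<n. x i = x j \<longleftrightarrow> (\<exists>A\<in>\<A>. i \<in> A \<and> j \<in> A))"
proof -
  have r: "restrict_partition n (tie_partition x) = (\<lambda>i. {j. j < n \<and> x i = x j}) ` {..<n}"
  proof (intro set_eqI iffI)
    have t: "tie_partition x = range (\<lambda>i. {j. x i = x j})"
      by (auto simp: tie_partition_def quotient_def Image_def)
    fix C
    {
      assume "C \<in> restrict_partition n (tie_partition x)"
      then obtain i where i: "C = {j. x i = x j} \<inter> {..<n}" "C \<noteq> {}"
        unfolding restrict_partition_def t by blast
      then obtain i' where "i' < n" "x i = x i'" by blast
      thus "C \<in> (\<lambda>i. {j. j < n \<and> x i = x j}) ` {..<n}"
        unfolding i(1) by (intro image_eqI[of _ _ i']) auto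
    }
    {
      assume "C \<in> (\<lambda>i. {j. j < n \<and> x i = x j}) ` {..<n}"
      then obtain i where i: "i < n" "C = {j. x i = x j} \<inter> {..<n}" by auto
      hence "C \<noteq> {}" by auto
      thus "C \<in> restrict_partition n (tie_partition x)"
        unfolding restrict_partition_def t i(2) by blast
    }
  qed
  have sub: "A \<in> \<A> \<Longrightarrow> A \<subseteq> {..<n}" for A using partition_onD1[OF \<A>] by auto
  show ?thesis
  proof
    assume eq: "restrict_partition n (tie_partition x) = \<A>"
    show "\<forall>i<n. \<forall>j<n. x i = x j \<longleftrightarrow> (\<exists>A\<in>\<A>. i \<in> A \<and> j \<in> A)"
      unfolding eq[symmetric] r by auto
  next
    assume *: "\<forall>i<n. \<forall>j<n. x i = x j \<longleftrightarrow> (\<exists>A\<in>\<A>. i \<in> A \<and> j \<in> A)"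
    have cl: "{j. j < n \<and> x i = x j} = A" if A: "A \<in> \<A>" "i \<in> A" for A i
    proof -
      have i: "i < n" using sub A by auto
      have "j \<in> A" if "j < n" "x i = x j" for j
        using * i that A partition_on_eqI[OF \<A>] by blast
      moreover have "j < n \<and> x i = x j" if "j \<in> A" for j
        using * i that A sub by blast
      ultimately show ?thesis by blast
    qed
    show "restrict_partition n (tie_partition x) = \<A>"
    proof (intro set_eqI iffI)
      fix B assume "B \<in> restrict_partition n (tie_partition x)"
      then obtain i where i: "i < n" "B = {j. j < n \<and> x i = x j}" unfolding r by auto
      then obtain A where "A \<in> \<A>" "i \<in> A" using partition_onD1[OF \<A>] by auto
      thus "B \<in> \<A>" using cl i by simp
    next
      fix B assume B: "B \<in> \<A>"
      then obtain i where i: "i \<in> B" using partition_onD3[OF \<A>] by (metis ex_in_conv)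
      hence "i < n" using sub B by auto
      thus "B \<in> restrict_partition n (tie_partition x)" unfolding r using cl[OF B i] by auto
    qed
  qed
qed

text \<open>
  The pattern of common cells equals the given partition exactly when every block sits in one cell
  and different blocks sit in different cells.
\<close>

lemma tie_pattern_iff_injective_labelling:
  fixes n :: nat
  assumes \<A>: "partition_on {..<n} \<A>" and \<C>: "partition_on UNIV \<C>"
  shows "(\<forall>i<n. \<forall>j<n. (\<exists>B\<in>\<C>. x i \<in> B \<and> x j \<in> B) \<longleftrightarrow> (\<exists>A\<in>\<A>. i \<in> A \<and> j \<in> A)) \<longleftrightarrow>
         (\<exists>\<phi>\<in>inj_labellings \<A> \<C>. \<forall>A\<in>\<A>. \<forall>i\<in>A. x i \<in> \<phi> A)" (is "?L \<longleftrightarrow> ?R")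
proof
  have lt: "i < n" if "i \<in> A" "A \<in> \<A>" for i A using partition_onD1[OF \<A>] that by auto
  {
    assume L: ?L
    have "\<exists>B. B \<in> \<C> \<and> y \<in> B" for y using partition_onD1[OF \<C>] by auto
    then obtain cell where cell: "\<And>y. cell y \<in> \<C>" "\<And>y. y \<in> cell y" by metis
    define r where "r = (\<lambda>A::nat set. SOME i. i \<in> A)"
    have r: "r A \<in> A" if "A \<in> \<A>" for A
      unfolding r_def using partition_onD3[OF \<A>] that by (metis ex_in_conv someI_ex)
    define \<phi> where "\<phi> = restrict (\<lambda>A. cell (x (r A))) \<A>"
    have in_\<phi>: "x i \<in> \<phi> A" if "A \<in> \<A>" "i \<in> A" for A i
    proof -
      have "r A < n" "i < n" using lt r that by auto
      hence "\<exists>B\<in>\<C>. x (r A) \<in> B \<and> x i \<in> B"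
        using L r[OF that(1)] that by (intro iffD2[OF L[rule_format, of "r A" i]] bexI[of _ A]) auto
      then obtain B where B: "B \<in> \<C>" "x (r A) \<in> B" "x i \<in> B" by auto
      have "B = cell (x (r A))" by (rule partition_on_eqI[OF \<C> B(1) cell(1) B(2) cell(2)])
      thus ?thesis using B that by (simp add: \<phi>_def)
    qed
    have "inj_on \<phi> \<A>"
    proof (rule inj_onI)
      fix A A' assume A: "A \<in> \<A>" "A' \<in> \<A>" "\<phi> A = \<phi> A'"
      have "x (r A) \<in> \<phi> A" "x (r A') \<in> \<phi> A" using in_\<phi> r A by auto
      moreover have "\<phi> A \<in> \<C>" using A cell by (simp add: \<phi>_def)
      ultimately have "\<exists>D\<in>\<A>. r A \<in> D \<and> r A' \<in> D"
        using lt[OF r A(1)] lt[OF r A(2)] A(1,2)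
        by (intro iffD1[OF L[rule_format, of "r A" "r A'"]] bexI[of _ "\<phi> A"]) auto
      then obtain D where D: "D \<in> \<A>" "r A \<in> D" "r A' \<in> D" by auto
      have "A = D" by (rule partition_on_eqI[OF \<A> A(1) D(1) r[OF A(1)] D(2)])
      also have "D = A'" by (rule partition_on_eqI[OF \<A> D(1) A(2) D(3) r[OF A(2)]])
      finally show "A = A'" .
    qed
    moreover have "\<phi> \<in> \<A> \<rightarrow>\<^sub>E \<C>" using cell by (auto simp: \<phi>_def)
    ultimately show ?R using in_\<phi> by (intro bexI[of _ \<phi>]) auto
  }
  {
    assume ?R
    then obtain \<phi> where \<phi>: "\<phi> \<in> \<A> \<rightarrow>\<^sub>E \<C>" "inj_on \<phi> \<A>" "\<And>A i. A \<in> \<A> \<Longrightarrow> i \<in> A \<Longrightarrow> x i \<in> \<phi> A" by auto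
    show ?L
    proof (intro allI impI iffI)
      fix i j assume i: "i < n" and j: "j < n"
      obtain A A' where A: "A \<in> \<A>" "i \<in> A" "A' \<in> \<A>" "j \<in> A'"
      proof -
        have "i \<in> \<Union>\<A>" "j \<in> \<Union>\<A>"
          unfolding partition_onD1[OF \<A>, symmetric] using i j by auto
        thus ?thesis using that by blast
      qed
      {
        assume "\<exists>B\<in>\<C>. x i \<in> B \<and> x j \<in> B"
        then obtain B where B: "B \<in> \<C>" "x i \<in> B" "x j \<in> B" by auto
        have "\<phi> A \<in> \<C>" "\<phi> A' \<in> \<C>" using \<phi>(1) A by auto
        hence "B = \<phi> A" "B = \<phi> A'"
          using partition_on_eqI[OF \<C> B(1) _ B(2) \<phi>(3)[OF A(1,2)]]
            partition_on_eqI[OF \<C> B(1) _ B(3) \<phi>(3)[OF A(3,4)]] by auto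
        hence "A = A'" using \<phi>(2) A by (auto dest: inj_onD)
        thus "\<exists>A\<in>\<A>. i \<in> A \<and> j \<in> A" using A by auto
      }
      {
        assume "\<exists>A\<in>\<A>. i \<in> A \<and> j \<in> A"
        then obtain D where "D \<in> \<A>" "i \<in> D" "j \<in> D" by auto
        thus "\<exists>B\<in>\<C>. x i \<in> B \<and> x j \<in> B" using \<phi> by (intro bexI[of _ "\<phi> D"]) auto
      }
    qed
  }
qed

text \<open>
  Take the expectation of the conditional probability given \<open>P\<close>.
\<close>

lemma cond_iid_measure:
  assumes M: "prob_space M" and P: "P \<in> M \<rightarrow>\<^sub>M prob_algebra borel" and X: "cond_iid M P X"
    and A: "\<And>i. i < n \<Longrightarrow> A i \<in> sets borel"
  shows "measure M {w\<in>space M. \<forall>i<n. X i w \<in> A i} = (\<integral>w. (\<Prod>i<n. measure (P w) (A i)) \<partial>M)"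
proof -
  interpret prob_space M by fact
  let ?F = "vimage_algebra (space M) P (prob_algebra borel)"
  have "sets ?F \<subseteq> sets M" using P by (simp add: measurable_iff_sets)
  hence sub: "subalgebra M ?F" by (simp add: subalgebra_def)
  interpret S: finite_measure_subalgebra M ?F by unfold_locales fact
  have [measurable]: "X i \<in> M \<rightarrow>\<^sub>M borel" for i using X by (simp add: cond_iid_def)
  let ?E = "{w\<in>space M. \<forall>i<n. X i w \<in> A i}"
  have E: "?E \<in> sets M"
  proof -
    have "?E = {w\<in>space M. \<forall>i\<in>{..<n}. X i w \<in> A i}" by auto
    also have "\<dots> \<in> sets M"
      by (rule sets.sets_Collect_finite_All) (use A in \<open>auto intro: measurable_sets_Collect\<close>)
    finally show ?thesis .
  qed
  have int: "integrable M (indicat_real ?E)"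
    by (rule integrable_real_indicator[OF E]) (simp only: infinity_ennreal_def less_top[symmetric] emeasure_finite not_False_eq_True)
  have "measure M ?E = (\<integral>w. indicat_real ?E w \<partial>M)"
    unfolding Bochner_Integration.integral_indicator by (rule arg_cong[of _ _ "measure M"]) blast
  also have "\<dots> = (\<integral>w. real_cond_exp M ?F (indicator ?E) w \<partial>M)"
    by (rule S.real_cond_exp_int(2)[OF int, symmetric])
  also have "\<dots> = (\<integral>w. (\<Prod>i<n. measure (P w) (A i)) \<partial>M)"
  proof (rule integral_cong_AE)
    show "AE w in M. real_cond_exp M ?F (indicator ?E) w = (\<Prod>i<n. measure (P w) (A i))"
      using X A unfolding cond_iid_def by blast
    have "P \<in> M \<rightarrow>\<^sub>M subprob_algebra borel" using P by (rule measurable_prob_algebraD)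
    hence "(\<lambda>w. measure (P w) (A i)) \<in> borel_measurable M" if "i < n" for i
      using measurable_compose[OF _ measurable_measure_subprob_algebra[OF A[OF that]]] by blast
    thus "(\<lambda>w. \<Prod>i<n. measure (P w) (A i)) \<in> borel_measurable M"
      by (intro borel_measurable_prod) auto
  qed simp
  finally show ?thesis .
qed

lemma measure_tie_pattern:
  assumes M: "prob_space M" and P: "P \<in> M \<rightarrow>\<^sub>M prob_algebra borel" and X: "cond_iid M P X"
    and \<A>: "partition_on {..<n} \<A>"
    and \<C>: "partition_on UNIV \<C>" "finite \<C>" "\<C> \<subseteq> sets borel"
  defines "E \<equiv> {w\<in>space M. \<forall>i<n. \<forall>j<n. (\<exists>B\<in>\<C>. X i w \<in> B \<and> X j w \<in> B) \<longleftrightarrow> (\<exists>A\<in>\<A>. i \<in> A \<and> j \<in> A)}"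
  shows "E \<in> sets M"
    and "measure M E = (\<Sum>\<phi>\<in>inj_labellings \<A> \<C>. \<integral>w. (\<Prod>A\<in>\<A>. measure (P w) (\<phi> A) ^ card A) \<partial>M)"
proof -
  interpret prob_space M by fact
  have [measurable]: "X i \<in> M \<rightarrow>\<^sub>M borel" for i using X by (simp add: cond_iid_def)
  let ?\<Phi> = "inj_labellings \<A> \<C>"
  let ?G = "\<lambda>\<phi>. {w\<in>space M. \<forall>A\<in>\<A>. \<forall>i\<in>A. X i w \<in> \<phi> A}"
  have un: "{..<n} = \<Union>\<A>" by (rule partition_onD1[OF \<A>])
  note finA = finite_blocks[OF \<A>]
  have fin: "finite ?\<Phi>" using finite_inj_labellings finA \<C>(2) by blast
  obtain bl where bl: "\<And>i. i < n \<Longrightarrow> bl i \<in> \<A>" "\<And>i. i < n \<Longrightarrow> i \<in> bl i"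
  proof -
    have "\<forall>i\<in>{..<n}. \<exists>A\<in>\<A>. i \<in> A" unfolding un by auto
    hence "\<forall>i. \<exists>A. i < n \<longrightarrow> A \<in> \<A> \<and> i \<in> A" by auto
    then obtain bl where "\<forall>i. i < n \<longrightarrow> bl i \<in> \<A> \<and> i \<in> bl i" by (rule choice[THEN exE])
    thus ?thesis using that by blast
  qed
  have lt: "i < n" if "A \<in> \<A>" "i \<in> A" for A i
    using un that by auto
  have bl_eq: "bl i = A" if "A \<in> \<A>" "i \<in> A" for A i
    by (rule partition_on_eqI[OF \<A> bl(1) that(1) bl(2) that(2)]) (use lt that in auto)
  have Gbl: "?G \<phi> = {w\<in>space M. \<forall>i<n. X i w \<in> \<phi> (bl i)}" for \<phi>
  proof (intro Collect_cong conj_cong refl iffI allI ballI impI)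
    fix w i assume "\<forall>A\<in>\<A>. \<forall>i\<in>A. X i w \<in> \<phi> A" "i < n"
    thus "X i w \<in> \<phi> (bl i)" using bl by blast
  next
    fix w A i assume *: "\<forall>i<n. X i w \<in> \<phi> (bl i)" "A \<in> \<A>" "i \<in> A"
    show "X i w \<in> \<phi> A" using * lt[OF *(2,3)] bl_eq[OF *(2,3)] by auto
  qed
  have mG: "?G \<phi> \<in> sets M" if "\<phi> \<in> ?\<Phi>" for \<phi>
  proof -
    have "\<phi> A \<in> sets borel" if "A \<in> \<A>" for A using \<C>(3) that \<open>\<phi> \<in> ?\<Phi>\<close> by auto
    moreover have "?G \<phi> = {w\<in>space M. \<forall>i\<in>{..<n}. X i w \<in> \<phi> (bl i)}" unfolding Gbl by auto
    ultimately show ?thesis using bl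
      by (simp only:) (intro sets.sets_Collect_finite_All, auto intro: measurable_sets_Collect)
  qed
  have E: "E = (\<Union>\<phi>\<in>?\<Phi>. ?G \<phi>)"
    unfolding E_def using tie_pattern_iff_injective_labelling[OF \<A> \<C>(1)] by auto
  show "E \<in> sets M" unfolding E by (intro sets.finite_UN fin mG)
  have disj: "disjoint_family_on ?G ?\<Phi>"
    unfolding disjoint_family_on_def
  proof (intro ballI impI)
    fix \<phi> \<phi>' assume \<phi>: "\<phi> \<in> ?\<Phi>" "\<phi>' \<in> ?\<Phi>" "\<phi> \<noteq> \<phi>'"
    show "?G \<phi> \<inter> ?G \<phi>' = {}"
    proof (rule ccontr)
      assume "?G \<phi> \<inter> ?G \<phi>' \<noteq> {}"
      then obtain w where "w \<in> ?G \<phi>" "w \<in> ?G \<phi>'" by blast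
      hence w: "X i w \<in> \<phi> A \<and> X i w \<in> \<phi>' A" if "A \<in> \<A>" "i \<in> A" for A i using that by auto
      have "\<phi> A = \<phi>' A" if mem: "A \<in> \<A>" for A
      proof -
        obtain i where "i \<in> A" using mem partition_onD3[OF \<A>] by (metis ex_in_conv)
        hence "X i w \<in> \<phi> A" "X i w \<in> \<phi>' A" using w mem by auto
        moreover have "\<phi> A \<in> \<C>" "\<phi>' A \<in> \<C>" using \<phi> mem by auto
        ultimately show ?thesis using partition_on_eqI[OF \<C>(1)] by metis
      qed
      moreover have "\<phi> \<in> \<A> \<rightarrow>\<^sub>E \<C>" "\<phi>' \<in> \<A> \<rightarrow>\<^sub>E \<C>" using \<phi> by auto
      ultimately have "\<phi> = \<phi>'" by (intro PiE_ext)
      thus False using \<phi>(3) by simp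
    qed
  qed
  have "measure M E = (\<Sum>\<phi>\<in>?\<Phi>. measure M (?G \<phi>))"
    unfolding E by (rule finite_measure_finite_Union[OF fin _ disj]) (use mG in auto)
  also have "\<dots> = (\<Sum>\<phi>\<in>?\<Phi>. \<integral>w. (\<Prod>A\<in>\<A>. measure (P w) (\<phi> A) ^ card A) \<partial>M)"
  proof (rule sum.cong[OF refl])
    fix \<phi> assume \<phi>: "\<phi> \<in> ?\<Phi>"
    have "measure M (?G \<phi>) = (\<integral>w. (\<Prod>i<n. measure (P w) (\<phi> (bl i))) \<partial>M)"
      unfolding Gbl by (rule cond_iid_measure[OF M P X]) (use \<phi> \<C>(3) bl in auto)
    also have "(\<lambda>w. \<Prod>i<n. measure (P w) (\<phi> (bl i))) = (\<lambda>w. \<Prod>A\<in>\<A>. measure (P w) (\<phi> A) ^ card A)"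
    proof
      fix w
      have "(\<Prod>i<n. measure (P w) (\<phi> (bl i))) = (\<Prod>A\<in>\<A>. \<Prod>i\<in>A. measure (P w) (\<phi> (bl i)))"
        unfolding un using un partition_onD2[OF \<A>]
        by (subst prod.Union_disjoint) (auto simp: disjoint_def comp_def intro: finite_subset)
      also have "\<dots> = (\<Prod>A\<in>\<A>. \<Prod>i\<in>A. measure (P w) (\<phi> A))"
        by (intro prod.cong refl) (use bl_eq in auto)
      finally show "(\<Prod>i<n. measure (P w) (\<phi> (bl i))) = (\<Prod>A\<in>\<A>. measure (P w) (\<phi> A) ^ card A)" by simp
    qed
    finally show "measure M (?G \<phi>) = (\<integral>w. (\<Prod>A\<in>\<A>. measure (P w) (\<phi> A) ^ card A) \<partial>M)" .
  qed
  finally show "measure M E = (\<Sum>\<phi>\<in>?\<Phi>. \<integral>w. (\<Prod>A\<in>\<A>. measure (P w) (\<phi> A) ^ card A) \<partial>M)" .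
qed

section \<open>Moments of normalized masses\<close>

text \<open>
  The Gamma integral after the substitution \<open>x \<mapsto> v x\<close>.
\<close>

lemma nn_integral_gamma:
  fixes s v :: real
  assumes s: "s > 0" and v: "v > 0"
  shows "(\<integral>\<^sup>+x\<in>{0<..}. ennreal (x powr (s - 1) * exp (- (v * x))) \<partial>lborel) = ennreal (Gamma s * v powr (- s))"
proof -
  have "ennreal (Gamma s) = (\<integral>\<^sup>+x. ennreal (indicator {0..} x * x powr (s - 1) / exp x) \<partial>lborel)"
    by (rule Gamma_conv_nn_integral_real[OF s])
  also have "\<dots> = ennreal \<bar>v\<bar> * (\<integral>\<^sup>+x. ennreal (indicator {0..} (0 + v * x) * (0 + v * x) powr (s - 1) / exp (0 + v * x)) \<partial>lborel)"
    by (rule nn_integral_real_affine) (use v in auto)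
  also have "(\<integral>\<^sup>+x. ennreal (indicator {0..} (0 + v * x) * (0 + v * x) powr (s - 1) / exp (0 + v * x)) \<partial>lborel) =
        (\<integral>\<^sup>+x. ennreal (v powr (s - 1)) * (ennreal (x powr (s - 1) * exp (- (v * x))) * indicator {0<..} x) \<partial>lborel)"
  proof (rule nn_integral_cong_AE, use AE_lborel_singleton[of 0] in eventually_elim)
    fix x :: real assume "x \<noteq> 0"
    thus "ennreal (indicator {0..} (0 + v * x) * (0 + v * x) powr (s - 1) / exp (0 + v * x)) =
          ennreal (v powr (s - 1)) * (ennreal (x powr (s - 1) * exp (- (v * x))) * indicator {0<..} x)"
      using v by (auto simp: indicator_def ennreal_mult[symmetric] powr_mult zero_le_mult_iff exp_minus field_simps)
  qed
  also have "\<dots> = ennreal (v powr (s - 1)) * (\<integral>\<^sup>+x\<in>{0<..}. ennreal (x powr (s - 1) * exp (- (v * x))) \<partial>lborel)"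
    by (rule nn_integral_cmult) measurable
  finally have *: "ennreal (Gamma s) = ennreal (v powr s) * (\<integral>\<^sup>+x\<in>{0<..}. ennreal (x powr (s - 1) * exp (- (v * x))) \<partial>lborel)"
    using v by (simp add: mult.assoc[symmetric] ennreal_mult[symmetric] powr_diff)
  have "ennreal (Gamma s * v powr (- s)) = ennreal (v powr (- s)) * ennreal (Gamma s)"
    using ennreal_mult''[of "v powr (- s)" "Gamma s"] by (simp add: mult.commute)
  also have "\<dots> = (ennreal (v powr (- s)) * ennreal (v powr s)) * (\<integral>\<^sup>+x\<in>{0<..}. ennreal (x powr (s - 1) * exp (- (v * x))) \<partial>lborel)"
    unfolding * by (simp add: mult.assoc)
  also have "ennreal (v powr (- s)) * ennreal (v powr s) = 1"
    using v by (simp add: ennreal_mult[symmetric] powr_add[symmetric])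
  finally show ?thesis by simp
qed

lemma nn_integral_power_exp:
  assumes T: "T > (0::real)"
  shows "(\<integral>\<^sup>+u\<in>{0<..}. ennreal (u ^ k * exp (- (u * T))) \<partial>lborel) = ennreal (fact k / T ^ Suc k)"
proof -
  have "(\<integral>\<^sup>+u\<in>{0<..}. ennreal (u ^ k * exp (- (u * T))) \<partial>lborel) =
        (\<integral>\<^sup>+u\<in>{0<..}. ennreal (u powr ((real k + 1) - 1) * exp (- (T * u))) \<partial>lborel)"
    by (intro nn_integral_cong) (auto simp: indicator_def powr_realpow mult.commute)
  also have "\<dots> = ennreal (Gamma (real k + 1) * T powr (- (real k + 1)))"
    by (rule nn_integral_gamma) (use T in auto)
  also have "T powr (- (real k + 1)) = 1 / T ^ Suc k"
  proof -
    have "T powr (real k + 1) = T ^ Suc k" using powr_realpow[OF T, of "Suc k"] by (simp add: add.commute)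
    thus ?thesis by (simp only: powr_minus_divide)
  qed
  also have "Gamma (real k + 1) = fact k"
    using Gamma_fact[of k, where ?'a = real] by (simp add: add.commute)
  finally show ?thesis by simp
qed

context finite_homogeneous_crm
begin

lemma measure_UNIV_eq_sum:
  assumes "finite_measure (\<mu> w)" "w \<in> space N" "partition_on UNIV \<C>" "finite \<C>" "\<C> \<subseteq> sets borel"
  shows "measure (\<mu> w) UNIV = (\<Sum>B\<in>\<C>. measure (\<mu> w) B)"
proof -
  interpret finite_measure "\<mu> w" by fact
  have "measure (\<mu> w) (\<Union>B\<in>\<C>. B) = (\<Sum>B\<in>\<C>. measure (\<mu> w) B)"
    by (rule finite_measure_finite_Union)
       (use assms partition_onD2[OF assms(3)] in \<open>auto simp: sets_\<mu> disjoint_family_on_def disjoint_def\<close>)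
  thus ?thesis using partition_onD1[OF assms(3)] by simp
qed

text \<open>
  The total mass is the sum over the cells, so the integrand is a product over all cells of
  functions of the individual masses; cells that carry no block contribute the exponent \<open>0\<close>.
\<close>

lemma nn_integral_partition_moment:
  assumes \<C>: "partition_on UNIV \<C>" "finite \<C>" "\<C> \<subseteq> sets borel"
    and \<A>: "finite \<A>" and \<phi>: "\<phi> \<in> \<A> \<rightarrow>\<^sub>E \<C>" "inj_on \<phi> \<A>" and u: "u > 0"
  shows "(\<integral>\<^sup>+w. ennreal ((\<Prod>A\<in>\<A>. measure (\<mu> w) (\<phi> A) ^ n A) * exp (- (u * measure (\<mu> w) UNIV))) \<partial>N) =
         ennreal (exp (- \<psi> u) * (\<Prod>A\<in>\<A>. moment_of_cumulants (\<lambda>i. measure H (\<phi> A) * \<kappa> i u) (n A)))"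
proof -
  (* the exponent of the mass of a cell: the block size if the cell is assigned to a block *)
  define e where "e = (\<lambda>B. if B \<in> \<phi> ` \<A> then n (inv_into \<A> \<phi> B) else 0)"
  have e\<phi>: "e (\<phi> A) = n A" if "A \<in> \<A>" for A using that \<phi>(2) by (simp add: e_def)
  have sub: "\<phi> ` \<A> \<subseteq> \<C>" using \<phi>(1) by auto
  have prod_e: "(\<Prod>B\<in>\<C>. f B (e B)) = (\<Prod>A\<in>\<A>. f (\<phi> A) (n A))" if "\<And>B. f B 0 = 1" for f :: "'s set \<Rightarrow> nat \<Rightarrow> real"
  proof -
    have "(\<Prod>B\<in>\<C>. f B (e B)) = (\<Prod>B\<in>\<phi> ` \<A>. f B (e B))"
      using \<C>(2) sub that by (intro prod.mono_neutral_right) (auto simp: e_def)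
    also have "\<dots> = (\<Prod>A\<in>\<A>. f (\<phi> A) (e (\<phi> A)))" by (simp add: prod.reindex[OF \<phi>(2)])
    also have "\<dots> = (\<Prod>A\<in>\<A>. f (\<phi> A) (n A))" by (intro prod.cong) (auto simp: e\<phi>)
    finally show ?thesis .
  qed
  let ?g = "\<lambda>B y. y ^ e B * exp (- (u * y)) :: real"
  have "(\<integral>\<^sup>+w. ennreal ((\<Prod>A\<in>\<A>. measure (\<mu> w) (\<phi> A) ^ n A) * exp (- (u * measure (\<mu> w) UNIV))) \<partial>N) =
        (\<integral>\<^sup>+w. (\<Prod>B\<in>\<C>. ennreal (?g B (enn2real (emeasure (\<mu> w) B)))) \<partial>N)"
  proof (rule nn_integral_cong_AE, use AE_finite AE_space in eventually_elim)
    fix w assume w: "finite_measure (\<mu> w)" "w \<in> space N"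
    have "(\<Prod>A\<in>\<A>. measure (\<mu> w) (\<phi> A) ^ n A) * exp (- (u * measure (\<mu> w) UNIV)) =
          (\<Prod>B\<in>\<C>. measure (\<mu> w) B ^ e B) * (\<Prod>B\<in>\<C>. exp (- (u * measure (\<mu> w) B)))"
      using prod_e[of "\<lambda>B m. measure (\<mu> w) B ^ m"] \<C>(2)
      by (simp add: measure_UNIV_eq_sum[OF w \<C>] exp_sum[symmetric] sum_negf sum_distrib_left)
    also have "\<dots> = (\<Prod>B\<in>\<C>. ?g B (measure (\<mu> w) B))" by (simp add: prod.distrib)
    finally show "ennreal ((\<Prod>A\<in>\<A>. measure (\<mu> w) (\<phi> A) ^ n A) * exp (- (u * measure (\<mu> w) UNIV))) =
        (\<Prod>B\<in>\<C>. ennreal (?g B (enn2real (emeasure (\<mu> w) B))))"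
      by (simp add: prod_ennreal measure_def)
  qed
  also have "\<dots> = (\<Prod>B\<in>\<C>. \<integral>\<^sup>+w. ennreal (?g B (enn2real (emeasure (\<mu> w) B))) \<partial>N)"
  proof (rule N.indep_vars_nn_integral[OF \<C>(2)])
    have "N.indep_vars (\<lambda>_. borel) (\<lambda>B w. emeasure (\<mu> w) B) \<C>"
      using crm \<C> partition_onD2[OF \<C>(1)]
      by (simp add: homogeneous_crm_def completely_random_measure_def)
    thus "N.indep_vars (\<lambda>_. borel) (\<lambda>B w. ennreal (?g B (enn2real (emeasure (\<mu> w) B)))) \<C>"
      by (rule N.indep_vars_compose2) measurable
  qed auto
  also have "\<dots> = (\<Prod>B\<in>\<C>. ennreal (exp (- (measure H B * \<psi> u)) * moment_of_cumulants (\<lambda>i. measure H B * \<kappa> i u) (e B)))"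
    using nn_integral_power_measure[OF _ u] \<C>(3)
    by (intro prod.cong refl) (auto simp: measure_def)
  also have "\<dots> = ennreal ((\<Prod>B\<in>\<C>. exp (- (measure H B * \<psi> u))) * (\<Prod>B\<in>\<C>. moment_of_cumulants (\<lambda>i. measure H B * \<kappa> i u) (e B)))"
    by (subst prod_ennreal)
       (auto simp: prod.distrib intro!: mult_nonneg_nonneg moment_of_cumulants_nonneg tilted_moment_nonneg levy_measure)
  also have "(\<Prod>B\<in>\<C>. moment_of_cumulants (\<lambda>i. measure H B * \<kappa> i u) (e B)) =
             (\<Prod>A\<in>\<A>. moment_of_cumulants (\<lambda>i. measure H (\<phi> A) * \<kappa> i u) (n A))"
    by (rule prod_e) simp
  also have "(\<Prod>B\<in>\<C>. exp (- (measure H B * \<psi> u))) = exp (- \<psi> u)"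
  proof -
    have "measure H (\<Union>B\<in>\<C>. B) = (\<Sum>B\<in>\<C>. measure H B)"
      by (rule H.finite_measure_finite_Union)
         (use \<C> partition_onD2[OF \<C>(1)] sets_H in \<open>auto simp: disjoint_family_on_def disjoint_def\<close>)
    moreover have "(\<Union>B\<in>\<C>. B) = space H"
      using partition_onD1[OF \<C>(1)] sets_eq_imp_space_eq[OF sets_H] by simp
    ultimately have "(\<Sum>B\<in>\<C>. measure H B) = 1" by (simp add: H.prob_space)
    hence "(\<Sum>B\<in>\<C>. - (measure H B * \<psi> u)) = - \<psi> u"
      by (simp add: sum_negf sum_distrib_right[symmetric])
    thus ?thesis using \<C>(2) by (simp add: exp_sum[symmetric])
  qed
  finally show ?thesis .
qed

lemma sets_H_UNIV: "measure H UNIV = 1"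
  using H.prob_space sets_eq_imp_space_eq[OF sets_H] by simp

lemma nn_integral_power_total:
  assumes "u > 0"
  shows "(\<integral>\<^sup>+w. ennreal (measure (\<mu> w) UNIV ^ n * exp (- (u * measure (\<mu> w) UNIV))) \<partial>N) =
         ennreal (exp (- \<psi> u) * moment_of_cumulants (\<lambda>i. \<kappa> i u) n)"
  using nn_integral_power_measure[of UNIV u n] assms by (simp add: sets_H_UNIV)

end

locale normalizable_crm = finite_homogeneous_crm N \<mu> H \<rho>
  for N :: "'w measure" and \<mu> :: "'w \<Rightarrow> 's::topological_space measure" and H :: "'s measure" and \<rho> :: "real \<Rightarrow> real" +
  assumes total_pos: "AE w in N. 0 < emeasure (\<mu> w) UNIV"
begin

lemma AE_pos: "AE w in N. finite_measure (\<mu> w) \<and> 0 < measure (\<mu> w) UNIV \<and> w \<in> space N"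
  using total_pos AE_finite AE_space
proof eventually_elim
  case (elim w)
  then interpret finite_measure "\<mu> w" by simp
  show ?case using elim by (auto simp: emeasure_eq_measure)
qed

text \<open>
  Replace \<open>1/T\<^sup>n\<close> by a Gamma integral over \<open>u\<close> and exchange the two integrations.
\<close>

lemma nn_integral_normalized:
  fixes Z :: "'w \<Rightarrow> real"
  assumes [measurable]: "Z \<in> borel_measurable N" and Z: "\<And>w. 0 \<le> Z w" and n: "n \<ge> 1"
  shows "(\<integral>\<^sup>+w. ennreal (Z w / measure (\<mu> w) UNIV ^ n) \<partial>N) =
     (\<integral>\<^sup>+u\<in>{0<..}. ennreal (u ^ (n - 1) / fact (n - 1)) *
         (\<integral>\<^sup>+w. ennreal (Z w * exp (- (u * measure (\<mu> w) UNIV))) \<partial>N) \<partial>lborel)"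
proof -
  obtain k where k: "n = Suc k" using n by (cases n) auto
  interpret pair_sigma_finite lborel N by unfold_locales
  let ?T = "\<lambda>w. measure (\<mu> w) UNIV"
  have "(\<integral>\<^sup>+w. ennreal (Z w / ?T w ^ n) \<partial>N) =
        (\<integral>\<^sup>+w. (\<integral>\<^sup>+u. ennreal (u ^ k / fact k * (Z w * exp (- (u * ?T w)))) * indicator {0<..} u \<partial>lborel) \<partial>N)"
  proof (rule nn_integral_cong_AE, use AE_pos in eventually_elim)
    fix w assume w: "finite_measure (\<mu> w) \<and> 0 < ?T w \<and> w \<in> space N"
    have "(\<integral>\<^sup>+u. ennreal (u ^ k / fact k * (Z w * exp (- (u * ?T w)))) * indicator {0<..} u \<partial>lborel) =
          (\<integral>\<^sup>+u. ennreal (Z w / fact k) * (ennreal (u ^ k * exp (- (u * ?T w))) * indicator {0<..} u) \<partial>lborel)"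
      using Z by (intro nn_integral_cong) (auto simp: indicator_def ennreal_mult[symmetric] mult_ac)
    also have "\<dots> = ennreal (Z w / fact k) * ennreal (fact k / ?T w ^ Suc k)"
      using w by (subst nn_integral_cmult) (auto simp: nn_integral_power_exp)
    also have "\<dots> = ennreal (Z w / ?T w ^ n)"
      using Z w by (simp add: ennreal_mult[symmetric] k)
    finally show "ennreal (Z w / ?T w ^ n) =
       (\<integral>\<^sup>+u. ennreal (u ^ k / fact k * (Z w * exp (- (u * ?T w)))) * indicator {0<..} u \<partial>lborel)" ..
  qed
  also have "\<dots> = (\<integral>\<^sup>+u. (\<integral>\<^sup>+w. ennreal (u ^ k / fact k * (Z w * exp (- (u * ?T w)))) * indicator {0<..} u \<partial>N) \<partial>lborel)"
    by (rule Fubini') measurable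
  also have "\<dots> = (\<integral>\<^sup>+u\<in>{0<..}. ennreal (u ^ k / fact k) * (\<integral>\<^sup>+w. ennreal (Z w * exp (- (u * ?T w))) \<partial>N) \<partial>lborel)"
  proof (rule nn_integral_cong)
    fix u :: real
    show "(\<integral>\<^sup>+w. ennreal (u ^ k / fact k * (Z w * exp (- (u * ?T w)))) * indicator {0<..} u \<partial>N) =
          ennreal (u ^ k / fact k) * (\<integral>\<^sup>+w. ennreal (Z w * exp (- (u * ?T w))) \<partial>N) * indicator {0<..} u"
    proof (cases "u > 0")
      case True
      hence "(\<integral>\<^sup>+w. ennreal (u ^ k / fact k * (Z w * exp (- (u * ?T w)))) \<partial>N) =
            (\<integral>\<^sup>+w. ennreal (u ^ k / fact k) * ennreal (Z w * exp (- (u * ?T w))) \<partial>N)"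
        using Z by (intro nn_integral_cong) (auto simp: ennreal_mult[symmetric])
      also have "\<dots> = ennreal (u ^ k / fact k) * (\<integral>\<^sup>+w. ennreal (Z w * exp (- (u * ?T w))) \<partial>N)"
        by (rule nn_integral_cmult) measurable
      finally show ?thesis using True by simp
    qed simp
  qed
  finally show ?thesis by (simp add: k)
qed

definition inj_moment_sum :: "nat set set \<Rightarrow> 's set set \<Rightarrow> real \<Rightarrow> real" where
  "inj_moment_sum \<A> \<C> u =
     (\<Sum>\<phi>\<in>inj_labellings \<A> \<C>. \<Prod>A\<in>\<A>. moment_of_cumulants (\<lambda>i. measure H (\<phi> A) * \<kappa> i u) (card A))"

end

context normalizable_crm
begin

lemma moment_nonneg: "0 \<le> h \<Longrightarrow> 0 \<le> moment_of_cumulants (\<lambda>i. h * \<kappa> i u) n"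
  by (intro moment_of_cumulants_nonneg mult_nonneg_nonneg tilted_moment_nonneg levy_measure)

lemma ennreal_inj_moment_sum:
  assumes \<C>: "partition_on UNIV \<C>" "finite \<C>" "\<C> \<subseteq> sets borel" and \<A>: "finite \<A>" and u: "u > 0"
  shows "ennreal (exp (- \<psi> u) * inj_moment_sum \<A> \<C> u) =
    (\<Sum>\<phi>\<in>inj_labellings \<A> \<C>.
       \<integral>\<^sup>+w. ennreal ((\<Prod>A\<in>\<A>. measure (\<mu> w) (\<phi> A) ^ card A) * exp (- (u * measure (\<mu> w) UNIV))) \<partial>N)"
proof -
  have "(\<Sum>\<phi>\<in>inj_labellings \<A> \<C>.
       \<integral>\<^sup>+w. ennreal ((\<Prod>A\<in>\<A>. measure (\<mu> w) (\<phi> A) ^ card A) * exp (- (u * measure (\<mu> w) UNIV))) \<partial>N) =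
     (\<Sum>\<phi>\<in>inj_labellings \<A> \<C>.
       ennreal (exp (- \<psi> u) * (\<Prod>A\<in>\<A>. moment_of_cumulants (\<lambda>i. measure H (\<phi> A) * \<kappa> i u) (card A))))"
    by (intro sum.cong refl nn_integral_partition_moment[OF \<C> \<A> _ _ u]) auto
  also have "\<dots> = ennreal (\<Sum>\<phi>\<in>inj_labellings \<A> \<C>.
       exp (- \<psi> u) * (\<Prod>A\<in>\<A>. moment_of_cumulants (\<lambda>i. measure H (\<phi> A) * \<kappa> i u) (card A)))"
    by (intro sum_ennreal mult_nonneg_nonneg prod_nonneg moment_nonneg) auto
  finally show ?thesis by (simp add: inj_moment_sum_def sum_distrib_left)
qed

text \<open>
  A bound uniform in the cells: on the level of the random masses, the sum over injective labellings
  is at most the product over blocks of \<open>\<Sum>\<^sub>B \<mu>(B)\<^sup>m \<le> T\<^sup>m\<close>.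
\<close>

lemma inj_moment_sum_le:
  assumes \<C>: "partition_on UNIV \<C>" "finite \<C>" "\<C> \<subseteq> sets borel"
    and \<A>: "partition_on {..<n} \<A>" and u: "u > 0"
  shows "exp (- \<psi> u) * inj_moment_sum \<A> \<C> u \<le> exp (- \<psi> u) * moment_of_cumulants (\<lambda>i. \<kappa> i u) n"
proof -
  note finA = finite_blocks[OF \<A>]
  note card0 = card_block_pos[OF \<A>]
  let ?\<Phi> = "inj_labellings \<A> \<C>"
  have fin: "finite ?\<Phi>" using finite_inj_labellings finA \<C>(2) by blast
  have "ennreal (exp (- \<psi> u) * inj_moment_sum \<A> \<C> u) =
     (\<integral>\<^sup>+w. (\<Sum>\<phi>\<in>?\<Phi>. ennreal ((\<Prod>A\<in>\<A>. measure (\<mu> w) (\<phi> A) ^ card A) * exp (- (u * measure (\<mu> w) UNIV)))) \<partial>N)"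
    unfolding ennreal_inj_moment_sum[OF \<C> finA u]
  proof (rule nn_integral_sum[symmetric])
    fix \<phi> assume "\<phi> \<in> ?\<Phi>"
    hence [measurable]: "\<phi> A \<in> sets borel" if "A \<in> \<A>" for A using \<C>(3) that by auto
    show "(\<lambda>w. ennreal ((\<Prod>A\<in>\<A>. measure (\<mu> w) (\<phi> A) ^ card A) * exp (- (u * measure (\<mu> w) UNIV)))) \<in> borel_measurable N"
      by measurable
  qed
  also have "\<dots> \<le> (\<integral>\<^sup>+w. ennreal (measure (\<mu> w) UNIV ^ n * exp (- (u * measure (\<mu> w) UNIV))) \<partial>N)"
  proof (rule nn_integral_mono_AE, use AE_pos in eventually_elim)
    fix w assume w: "finite_measure (\<mu> w) \<and> 0 < measure (\<mu> w) UNIV \<and> w \<in> space N"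
    let ?y = "measure (\<mu> w)"
    have sumy: "?y UNIV = (\<Sum>B\<in>\<C>. ?y B)" using w measure_UNIV_eq_sum[OF _ _ \<C>] by auto
    have y_le: "?y B \<le> ?y UNIV" if "B \<in> \<C>" for B
      unfolding sumy using that \<C>(2) by (intro member_le_sum) auto
    have "(\<Sum>\<phi>\<in>?\<Phi>. \<Prod>A\<in>\<A>. ?y (\<phi> A) ^ card A) \<le> (\<Sum>\<phi>\<in>\<A> \<rightarrow>\<^sub>E \<C>. \<Prod>A\<in>\<A>. ?y (\<phi> A) ^ card A)"
      using finA \<C>(2) by (intro sum_mono2 finite_PiE prod_nonneg) auto
    also have "\<dots> = (\<Prod>A\<in>\<A>. \<Sum>B\<in>\<C>. ?y B ^ card A)"
      by (rule prod_sum_PiE[symmetric]) (use finA \<C>(2) in auto)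
    also have "\<dots> \<le> (\<Prod>A\<in>\<A>. ?y UNIV ^ card A)"
    proof (intro prod_mono conjI sum_nonneg)
      fix A assume A: "A \<in> \<A>"
      have "(\<Sum>B\<in>\<C>. ?y B ^ card A) \<le> (\<Sum>B\<in>\<C>. ?y UNIV ^ (card A - 1) * ?y B)"
      proof (rule sum_mono)
        fix B assume B: "B \<in> \<C>"
        have "?y B ^ card A = ?y B ^ (card A - 1) * ?y B"
          using card0[OF A] by (metis Suc_diff_1 power_Suc2)
        also have "\<dots> \<le> ?y UNIV ^ (card A - 1) * ?y B"
          using y_le[OF B] by (intro mult_right_mono power_mono) auto
        finally show "?y B ^ card A \<le> ?y UNIV ^ (card A - 1) * ?y B" .
      qed
      also have "\<dots> = ?y UNIV ^ (card A - 1) * ?y UNIV"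
        by (simp add: sum_distrib_left[symmetric] sumy)
      also have "\<dots> = ?y UNIV ^ card A" using card0[OF A] by (metis Suc_diff_1 power_Suc2)
      finally show "(\<Sum>B\<in>\<C>. ?y B ^ card A) \<le> ?y UNIV ^ card A" .
    qed auto
    also have "\<dots> = ?y UNIV ^ n" by (simp add: power_sum[symmetric] sum_card_blocks[OF \<A>])
    finally have le: "(\<Sum>\<phi>\<in>?\<Phi>. \<Prod>A\<in>\<A>. ?y (\<phi> A) ^ card A) \<le> ?y UNIV ^ n" .
    have "(\<Sum>\<phi>\<in>?\<Phi>. ennreal ((\<Prod>A\<in>\<A>. ?y (\<phi> A) ^ card A) * exp (- (u * ?y UNIV)))) =
          ennreal ((\<Sum>\<phi>\<in>?\<Phi>. \<Prod>A\<in>\<A>. ?y (\<phi> A) ^ card A) * exp (- (u * ?y UNIV)))"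
      by (subst sum_ennreal) (auto simp: sum_distrib_right intro!: mult_nonneg_nonneg prod_nonneg)
    also have "\<dots> \<le> ennreal (?y UNIV ^ n * exp (- (u * ?y UNIV)))"
      using le by (intro ennreal_leI mult_right_mono) auto
    finally show "(\<Sum>\<phi>\<in>?\<Phi>. ennreal ((\<Prod>A\<in>\<A>. ?y (\<phi> A) ^ card A) * exp (- (u * ?y UNIV)))) \<le>
        ennreal (?y UNIV ^ n * exp (- (u * ?y UNIV)))" .
  qed
  also have "\<dots> = ennreal (exp (- \<psi> u) * moment_of_cumulants (\<lambda>i. \<kappa> i u) n)"
    by (rule nn_integral_power_total[OF u])
  finally show ?thesis
    using moment_nonneg[of 1 u n] by (subst (asm) ennreal_le_iff) auto
qed

lemma sum_inj_normalized_moments: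
  assumes \<C>: "partition_on UNIV \<C>" "finite \<C>" "\<C> \<subseteq> sets borel"
    and \<A>: "partition_on {..<n} \<A>" and n: "n \<ge> 1"
  shows "ennreal (\<Sum>\<phi>\<in>inj_labellings \<A> \<C>.
            \<integral>w. (\<Prod>A\<in>\<A>. (measure (\<mu> w) (\<phi> A) / measure (\<mu> w) UNIV) ^ card A) \<partial>N) =
         (\<integral>\<^sup>+u\<in>{0<..}. ennreal (u ^ (n - 1) / fact (n - 1) * (exp (- \<psi> u) * inj_moment_sum \<A> \<C> u)) \<partial>lborel)"
proof -
  note finA = finite_blocks[OF \<A>]
  let ?\<Phi> = "inj_labellings \<A> \<C>"
  have fin: "finite ?\<Phi>" using finite_inj_labellings finA \<C>(2) by blast
  let ?T = "\<lambda>w. measure (\<mu> w) UNIV"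
  let ?Z = "\<lambda>\<phi> w. \<Prod>A\<in>\<A>. measure (\<mu> w) (\<phi> A) ^ card A"
  have Zm: "?Z \<phi> \<in> borel_measurable N" if "\<phi> \<in> ?\<Phi>" for \<phi>
  proof -
    have [measurable]: "\<phi> A \<in> sets borel" if "A \<in> \<A>" for A using \<C>(3) that \<open>\<phi> \<in> ?\<Phi>\<close> by auto
    show ?thesis by measurable
  qed
  have Z0: "0 \<le> ?Z \<phi> w" for \<phi> w by (intro prod_nonneg) auto
  have frac: "(\<Prod>A\<in>\<A>. (measure (\<mu> w) (\<phi> A) / ?T w) ^ card A) = ?Z \<phi> w / ?T w ^ n" for \<phi> w
    by (simp add: power_divide prod_dividef power_sum[symmetric] sum_card_blocks[OF \<A>])
  have each: "ennreal (\<integral>w. (\<Prod>A\<in>\<A>. (measure (\<mu> w) (\<phi> A) / ?T w) ^ card A) \<partial>N) =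
     (\<integral>\<^sup>+u\<in>{0<..}. ennreal (u ^ (n - 1) / fact (n - 1)) *
         (\<integral>\<^sup>+w. ennreal (?Z \<phi> w * exp (- (u * ?T w))) \<partial>N) \<partial>lborel)" if \<phi>: "\<phi> \<in> ?\<Phi>" for \<phi>
  proof -
    note [measurable] = Zm[OF \<phi>]
    have "integrable N (\<lambda>w. ?Z \<phi> w / ?T w ^ n)"
    proof (rule N.integrable_const_bound[where B = 1])
      show "AE w in N. norm (?Z \<phi> w / ?T w ^ n) \<le> 1"
        using AE_pos
      proof eventually_elim
        case (elim w)
        then interpret finite_measure "\<mu> w" by simp
        have "(\<Prod>A\<in>\<A>. (measure (\<mu> w) (\<phi> A) / ?T w) ^ card A) \<le> 1"
        proof (intro prod_le_1 conjI power_le_one)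
          fix A assume "A \<in> \<A>"
          have "measure (\<mu> w) (\<phi> A) \<le> ?T w"
            using bounded_measure[of "\<phi> A"] elim by (simp add: space_\<mu>)
          thus "measure (\<mu> w) (\<phi> A) / ?T w \<le> 1" using elim by simp
        qed auto
        thus ?case unfolding frac[symmetric] by (auto simp: abs_prod)
      qed
    qed measurable
    hence "ennreal (\<integral>w. ?Z \<phi> w / ?T w ^ n \<partial>N) = (\<integral>\<^sup>+w. ennreal (?Z \<phi> w / ?T w ^ n) \<partial>N)"
      using Z0 by (intro nn_integral_eq_integral[symmetric]) auto
    thus ?thesis unfolding frac using nn_integral_normalized[OF Zm[OF \<phi>] Z0 n] by simp
  qed
  have "ennreal (\<Sum>\<phi>\<in>?\<Phi>. \<integral>w. (\<Prod>A\<in>\<A>. (measure (\<mu> w) (\<phi> A) / ?T w) ^ card A) \<partial>N) =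
        (\<Sum>\<phi>\<in>?\<Phi>. ennreal (\<integral>w. (\<Prod>A\<in>\<A>. (measure (\<mu> w) (\<phi> A) / ?T w) ^ card A) \<partial>N))"
    by (intro sum_ennreal[symmetric] integral_nonneg_AE AE_I2 prod_nonneg) auto
  also have "\<dots> = (\<Sum>\<phi>\<in>?\<Phi>. \<integral>\<^sup>+u\<in>{0<..}. ennreal (u ^ (n - 1) / fact (n - 1)) *
         (\<integral>\<^sup>+w. ennreal (?Z \<phi> w * exp (- (u * ?T w))) \<partial>N) \<partial>lborel)"
    by (rule sum.cong[OF refl each])
  also have "\<dots> = (\<integral>\<^sup>+u. (\<Sum>\<phi>\<in>?\<Phi>. ennreal (u ^ (n - 1) / fact (n - 1)) *
         (\<integral>\<^sup>+w. ennreal (?Z \<phi> w * exp (- (u * ?T w))) \<partial>N) * indicator {0<..} u) \<partial>lborel)"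
  proof (rule nn_integral_sum[symmetric])
    fix \<phi> assume \<phi>: "\<phi> \<in> ?\<Phi>"
    note [measurable] = Zm[OF \<phi>]
    show "(\<lambda>u. ennreal (u ^ (n - 1) / fact (n - 1)) *
         (\<integral>\<^sup>+w. ennreal (?Z \<phi> w * exp (- (u * ?T w))) \<partial>N) * indicator {0<..} u) \<in> borel_measurable lborel"
      by measurable
  qed
  also have "\<dots> = (\<integral>\<^sup>+u\<in>{0<..}. ennreal (u ^ (n - 1) / fact (n - 1) * (exp (- \<psi> u) * inj_moment_sum \<A> \<C> u)) \<partial>lborel)"
  proof (rule nn_integral_cong)
    fix u :: real
    show "(\<Sum>\<phi>\<in>?\<Phi>. ennreal (u ^ (n - 1) / fact (n - 1)) *
         (\<integral>\<^sup>+w. ennreal (?Z \<phi> w * exp (- (u * ?T w))) \<partial>N) * indicator {0<..} u) =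
         ennreal (u ^ (n - 1) / fact (n - 1) * (exp (- \<psi> u) * inj_moment_sum \<A> \<C> u)) * indicator {0<..} u"
    proof (cases "u > 0")
      case True
      have "ennreal (u ^ (n - 1) / fact (n - 1) * (exp (- \<psi> u) * inj_moment_sum \<A> \<C> u)) =
          ennreal (u ^ (n - 1) / fact (n - 1)) * ennreal (exp (- \<psi> u) * inj_moment_sum \<A> \<C> u)"
        using True by (intro ennreal_mult') simp
      thus ?thesis
        using True unfolding ennreal_inj_moment_sum[OF \<C> finA True] by (simp add: sum_distrib_left)
    qed simp
  qed
  finally show ?thesis .
qed

lemma measurable_moment [measurable]:
  "(\<lambda>u. moment_of_cumulants (\<lambda>i. h * \<kappa> i u) n) \<in> borel_measurable borel"
proof (induction n rule: less_induct)
  case (less n)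
  show ?case
  proof (cases n)
    case (Suc m)
    have "(\<lambda>u. moment_of_cumulants (\<lambda>i. h * \<kappa> i u) (m - i)) \<in> borel_measurable borel" for i
      using less Suc by auto
    thus ?thesis using Suc by simp
  qed simp
qed

text \<open>
  The dominating function has integral at most \<open>1\<close>, being the Gamma mixture of \<open>E[T\<^sup>n e\<^sup>-\<^sup>u\<^sup>T]\<close>.
\<close>

lemma tendsto_nn_integral_inj_moment_sum:
  assumes \<C>: "\<And>m. partition_on UNIV (\<C> m)" "\<And>m. finite (\<C> m)" "\<And>m. \<C> m \<subseteq> sets borel"
    and small: "\<And>m B. B \<in> \<C> m \<Longrightarrow> measure H B \<le> \<eta> m" and \<eta>: "\<eta> \<longlonglongrightarrow> 0"
    and \<A>: "partition_on {..<n} \<A>" and n: "n \<ge> 1"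
  shows "(\<lambda>m. \<integral>\<^sup>+u\<in>{0<..}. ennreal (u ^ (n - 1) / fact (n - 1) * (exp (- \<psi> u) * inj_moment_sum \<A> (\<C> m) u)) \<partial>lborel)
     \<longlonglongrightarrow> (\<integral>\<^sup>+u\<in>{0<..}. ennreal (u ^ (n - 1) / fact (n - 1) * (exp (- \<psi> u) * (\<Prod>A\<in>\<A>. \<kappa> (card A) u))) \<partial>lborel)"
proof -
  let ?d = "\<lambda>f u. ennreal (u ^ (n - 1) / fact (n - 1) * (exp (- \<psi> u) * f u)) * indicator {0<..} u :: ennreal"
  show ?thesis
  proof (rule nn_integral_dominated_convergence
      [where w = "?d (\<lambda>u. moment_of_cumulants (\<lambda>i. 1 * \<kappa> i u) n)"])
    note finA = finite_blocks[OF \<A>]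
    note card0 = card_block_pos[OF \<A>]
    show "(?d (inj_moment_sum \<A> (\<C> m))) \<in> borel_measurable lborel" for m
      unfolding inj_moment_sum_def by measurable
    show "(?d (\<lambda>u. \<Prod>A\<in>\<A>. \<kappa> (card A) u)) \<in> borel_measurable lborel"
      by measurable
    show "(?d (\<lambda>u. moment_of_cumulants (\<lambda>i. 1 * \<kappa> i u) n)) \<in> borel_measurable lborel"
      by measurable
    show "AE u in lborel. ?d (inj_moment_sum \<A> (\<C> m)) u
        \<le> ?d (\<lambda>u. moment_of_cumulants (\<lambda>i. 1 * \<kappa> i u) n) u" for m
    proof (rule AE_I2)
      fix u :: real
      show "?d (inj_moment_sum \<A> (\<C> m)) u
        \<le> ?d (\<lambda>u. moment_of_cumulants (\<lambda>i. 1 * \<kappa> i u) n) u"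
      proof (cases "u > 0")
        case True
        have "u ^ (n - 1) / fact (n - 1) * (exp (- \<psi> u) * inj_moment_sum \<A> (\<C> m) u) \<le>
            u ^ (n - 1) / fact (n - 1) * (exp (- \<psi> u) * moment_of_cumulants (\<lambda>i. \<kappa> i u) n)"
          by (rule mult_left_mono[OF inj_moment_sum_le[OF \<C> \<A> True]]) (use True in simp)
        thus ?thesis by (simp only: mult_1) (intro mult_right_mono ennreal_leI, auto)
      qed simp
    qed
    have "(\<integral>\<^sup>+u\<in>{0<..}. ennreal (u ^ (n - 1) / fact (n - 1) * (exp (- \<psi> u) * moment_of_cumulants (\<lambda>i. 1 * \<kappa> i u) n)) \<partial>lborel) =
          (\<integral>\<^sup>+u\<in>{0<..}. ennreal (u ^ (n - 1) / fact (n - 1)) *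
            (\<integral>\<^sup>+w. ennreal (measure (\<mu> w) UNIV ^ n * exp (- (u * measure (\<mu> w) UNIV))) \<partial>N) \<partial>lborel)"
    proof (rule nn_integral_cong)
      fix u :: real
      show "?d (\<lambda>u. moment_of_cumulants (\<lambda>i. 1 * \<kappa> i u) n) u =
            ennreal (u ^ (n - 1) / fact (n - 1)) *
            (\<integral>\<^sup>+w. ennreal (measure (\<mu> w) UNIV ^ n * exp (- (u * measure (\<mu> w) UNIV))) \<partial>N) * indicator {0<..} u"
      proof (cases "u > 0")
        case True
        have "ennreal (u ^ (n - 1) / fact (n - 1) * (exp (- \<psi> u) * moment_of_cumulants (\<lambda>i. 1 * \<kappa> i u) n)) =
            ennreal (u ^ (n - 1) / fact (n - 1)) * ennreal (exp (- \<psi> u) * moment_of_cumulants (\<lambda>i. 1 * \<kappa> i u) n)"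
          using True by (intro ennreal_mult') simp
        thus ?thesis using nn_integral_power_total[OF True, of n] by simp
      qed simp
    qed
    also have "\<dots> = (\<integral>\<^sup>+w. ennreal (measure (\<mu> w) UNIV ^ n / measure (\<mu> w) UNIV ^ n) \<partial>N)"
      by (rule nn_integral_normalized[symmetric]) (use n in auto)
    also have "\<dots> \<le> (\<integral>\<^sup>+w. 1 \<partial>N)"
      by (intro nn_integral_mono) (auto simp flip: ennreal_1 simp del: ennreal_1 simp: divide_self_if)
    also have "\<dots> < \<infinity>" by (simp add: N.emeasure_space_1)
    finally show "(\<integral>\<^sup>+u\<in>{0<..}. ennreal (u ^ (n - 1) / fact (n - 1) * (exp (- \<psi> u) * moment_of_cumulants (\<lambda>i. 1 * \<kappa> i u) n)) \<partial>lborel) < \<infinity>" .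
    have sum1: "(\<Sum>B\<in>\<C> m. measure H B) = 1" for m
    proof -
      have "measure H (\<Union>B\<in>\<C> m. B) = (\<Sum>B\<in>\<C> m. measure H B)"
        by (rule H.finite_measure_finite_Union)
           (use \<C> partition_onD2[OF \<C>(1)] sets_H in \<open>auto simp: disjoint_family_on_def disjoint_def\<close>)
      thus ?thesis using partition_onD1[OF \<C>(1)] sets_H_UNIV by simp
    qed
    show "AE u in lborel. (\<lambda>m. ?d (inj_moment_sum \<A> (\<C> m)) u)
        \<longlonglongrightarrow> ?d (\<lambda>u. \<Prod>A\<in>\<A>. \<kappa> (card A) u) u"
    proof (rule AE_I2)
      fix u :: real
      have "(\<lambda>m. inj_moment_sum \<A> (\<C> m) u) \<longlonglongrightarrow> (\<Prod>A\<in>\<A>. \<kappa> (card A) u)"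
        unfolding inj_moment_sum_def
        by (rule tendsto_sum_inj_moments[where k = "\<lambda>i. \<kappa> i u" and h = "\<lambda>m. measure H" and n = card])
           (use finA card0 \<C> sum1 small \<eta> tilted_moment_nonneg[OF levy_measure] in auto)
      hence "(\<lambda>m. ennreal (u ^ (n - 1) / fact (n - 1) * (exp (- \<psi> u) * inj_moment_sum \<A> (\<C> m) u)))
         \<longlonglongrightarrow> ennreal (u ^ (n - 1) / fact (n - 1) * (exp (- \<psi> u) * (\<Prod>A\<in>\<A>. \<kappa> (card A) u)))"
        by (intro tendsto_intros)
      thus "(\<lambda>m. ?d (inj_moment_sum \<A> (\<C> m)) u)
        \<longlonglongrightarrow> ?d (\<lambda>u. \<Prod>A\<in>\<A>. \<kappa> (card A) u) u"
        by (cases "u > 0") auto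
    qed
  qed
qed

end

section \<open>Refining partitions and the partition probabilities\<close>

text \<open>
  The cell of \<open>x\<close> in the finite algebra generated by the first \<open>m\<close> sets of the sequence.
\<close>

definition atom :: "(nat \<Rightarrow> 's set) \<Rightarrow> nat \<Rightarrow> 's \<Rightarrow> 's set" where
  "atom U m x = {y. \<forall>i<m. y \<in> U i \<longleftrightarrow> x \<in> U i}"

lemma atom_self: "x \<in> atom U m x" by (simp add: atom_def)

lemma atom_eq: "y \<in> atom U m x \<Longrightarrow> atom U m y = atom U m x"
  by (auto simp: atom_def)

lemma partition_on_atoms: "partition_on UNIV (range (atom U m))"
proof (rule partition_onI)
  show "\<Union> (range (atom U m)) = UNIV" by (rule UNIV_eq_I[symmetric], rule UN_I, rule UNIV_I, rule atom_self)
  show "disjnt p q" if "p \<in> range (atom U m)" "q \<in> range (atom U m)" "p \<noteq> q" for p q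
    using that atom_eq unfolding disjnt_def by (metis (no_types, lifting) disjoint_iff rangeE)
  show "{} \<notin> range (atom U m)" by (metis atom_self empty_iff rangeE)
qed

lemma finite_atoms: "finite (range (atom U m))"
proof -
  have "range (atom U m) \<subseteq> (\<lambda>J. {y. \<forall>i<m. y \<in> U i \<longleftrightarrow> i \<in> J}) ` Pow {..<m}"
  proof clarify
    fix x
    show "atom U m x \<in> (\<lambda>J. {y. \<forall>i<m. y \<in> U i \<longleftrightarrow> i \<in> J}) ` Pow {..<m}"
      by (rule image_eqI[of _ _ "{i. i < m \<and> x \<in> U i}"]) (auto simp: atom_def)
  qed
  thus ?thesis by (rule finite_subset) auto
qed

lemma atoms_borel:
  assumes "\<And>i. U i \<in> sets borel" shows "range (atom U m) \<subseteq> sets borel"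
proof clarify
  fix x
  have "atom U m x = (\<Inter>i\<in>{..<m}. if x \<in> U i then U i else - U i)"
    by (auto simp: atom_def)
  also have "\<dots> \<in> sets borel"
  proof (cases "m = 0")
    case False
    show ?thesis
    proof (rule sets.finite_INT)
      fix i show "(if x \<in> U i then U i else - U i) \<in> sets borel"
        using assms[of i] by (cases "x \<in> U i") (auto intro: borel_comp)
    qed (use False in auto)
  qed simp
  finally show "atom U m x \<in> sets borel" .
qed

lemma same_atom_iff: "(\<exists>B\<in>range (atom U m). x \<in> B \<and> y \<in> B) \<longleftrightarrow> y \<in> atom U m x"
  using atom_self atom_eq by (metis UNIV_I image_eqI rangeE)

lemma separating_sequence:
  obtains U :: "nat \<Rightarrow> 's::{second_countable_topology, t1_space} set"
  where "\<And>i. open (U i)" "\<And>x y. x \<noteq> y \<Longrightarrow> \<exists>i. x \<in> U i \<and> y \<notin> U i"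
proof -
  obtain B :: "'s set set" where B: "countable B" "topological_basis B"
    using ex_countable_basis by blast
  define U where "U = from_nat_into (insert {} B)"
  have r: "range U = insert {} B"
    unfolding U_def using B(1) by (intro range_from_nat_into) auto
  show ?thesis
  proof (rule that)
    show "open (U i)" for i using r topological_basis_open[OF B(2)] by (metis insert_iff open_empty rangeI)
    fix x y :: 's assume "x \<noteq> y"
    then obtain V where V: "open V" "x \<in> V" "y \<notin> V" using t1_space by metis
    then obtain W where "W \<in> B" "x \<in> W" "W \<subseteq> V" using topological_basisE[OF B(2)] by metis
    moreover obtain i where "U i = W" using r \<open>W \<in> B\<close> by (metis insertI2 rangeE)
    ultimately show "\<exists>i. x \<in> U i \<and> y \<notin> U i" using V by auto
  qed
qed

text \<open>
  The sum is the mean, under the measure, of the mass of the cell of a random point; the cells of a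
  point shrink to that point. Its square root bounds the largest cell.
\<close>

lemma sum_atoms_tendsto_0:
  fixes U :: "nat \<Rightarrow> 's::{second_countable_topology, t1_space} set"
  assumes M: "prob_space M" and sets: "sets M = sets borel" and U: "\<And>i. open (U i)" "\<And>x y. x \<noteq> y \<Longrightarrow> \<exists>i. x \<in> U i \<and> y \<notin> U i"
    and diffuse: "\<And>x. measure M {x} = 0"
  shows "(\<lambda>m. \<Sum>B\<in>range (atom U m). (measure M B)\<^sup>2) \<longlonglongrightarrow> 0"
proof -
  interpret prob_space M by fact
  have borel: "atom U m x \<in> sets M" for m x
    using atoms_borel[of U m] U(1) sets by (auto intro: borel_open)
  define g where "g = (\<lambda>m x. \<Sum>B\<in>range (atom U m). measure M B * indicator B x)"
  have g: "g m x = measure M (atom U m x)" for m x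
  proof -
    have "g m x = (\<Sum>B\<in>{atom U m x}. measure M B * indicator B x)"
      unfolding g_def
    proof (rule sum.mono_neutral_right[OF finite_atoms])
      show "\<forall>B\<in>range (atom U m) - {atom U m x}. measure M B * indicator B x = 0"
      proof
        fix B assume "B \<in> range (atom U m) - {atom U m x}"
        hence "x \<notin> B" using atom_eq[of x U m] by blast
        thus "measure M B * indicator B x = 0" by simp
      qed
    qed auto
    also have "\<dots> = measure M (atom U m x)"
      using atom_self[of x U m] by (simp del: sum_mult_indicator)
    finally show ?thesis .
  qed
  have "(\<lambda>m. \<integral>x. g m x \<partial>M) \<longlonglongrightarrow> (\<integral>x. 0 \<partial>M)"
  proof (rule integral_dominated_convergence[where w = "\<lambda>_. 1"])
    show "g m \<in> borel_measurable M" for m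
      unfolding g_def using borel by (intro borel_measurable_sum) auto
    show "AE x in M. (\<lambda>m. g m x) \<longlonglongrightarrow> 0"
    proof (rule AE_I2)
      fix x
      have "(\<lambda>m. measure M (atom U m x)) \<longlonglongrightarrow> measure M (\<Inter>m. atom U m x)"
        by (rule finite_Lim_measure_decseq)
           (use borel in \<open>auto simp: decseq_def atom_def\<close>)
      also have "(\<Inter>m. atom U m x) = {x}"
      proof (intro equalityI subsetI)
        fix y assume y: "y \<in> (\<Inter>m. atom U m x)"
        have "y \<in> U i \<longleftrightarrow> x \<in> U i" for i
        proof -
          have "y \<in> atom U (Suc i) x" using y by blast
          thus ?thesis by (simp add: atom_def)
        qed
        thus "y \<in> {x}" using U(2)[of x y] by auto
      qed (use atom_self in auto)
      finally show "(\<lambda>m. g m x) \<longlonglongrightarrow> 0" by (simp add: g diffuse)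
    qed
    show "AE x in M. norm (g m x) \<le> 1" for m by (simp add: g)
  qed auto
  moreover have "(\<integral>x. g m x \<partial>M) = (\<Sum>B\<in>range (atom U m). (measure M B)\<^sup>2)" for m
  proof -
    have "(\<integral>x. g m x \<partial>M) = (\<Sum>B\<in>range (atom U m). \<integral>x. measure M B * indicator B x \<partial>M)"
      unfolding g_def using borel
      by (intro Bochner_Integration.integral_sum integrable_mult_right integrable_real_indicator)
         (auto simp: emeasure_eq_measure)
    also have "\<dots> = (\<Sum>B\<in>range (atom U m). (measure M B)\<^sup>2)"
      using sets_eq_imp_space_eq[OF sets] by (intro sum.cong refl) (auto simp: power2_eq_square)
    finally show ?thesis .
  qed
  ultimately show ?thesis by simp
qed

lemma nonatomic_measure_singleton:
  fixes H :: "'s::t1_space measure"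
  assumes "prob_space H" "sets H = sets borel" "nonatomic H"
  shows "measure H {x} = 0"
proof (rule ccontr)
  interpret prob_space H by fact
  assume "measure H {x} \<noteq> 0"
  hence "0 < emeasure H {x}" by (simp add: emeasure_eq_measure zero_less_measure_iff)
  moreover have "{x} \<in> sets H" using assms(2) by simp
  moreover have "emeasure H B = 0" if "B \<subseteq> {x}" "emeasure H B < emeasure H {x}" for B
    using that by (metis emeasure_empty less_irrefl subset_singletonD)
  ultimately show False using assms(3) unfolding nonatomic_def by blast
qed

text \<open>
  The formula for the partition probabilities. The pattern of common cells converges to the pattern
  of ties because distinct points are eventually separated, so both sides of the cell identity
  pass to the limit by dominated convergence.
\<close>

lemma probability_of_partition:
  fixes P :: "'w \<Rightarrow> 's::polish_space measure" and H :: "'s measure"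
  assumes H: "prob_space H" "sets H = sets borel" "nonatomic H" and \<rho>: "levy_density \<rho>"
    and M: "prob_space M" and P: "P \<in> M \<rightarrow>\<^sub>M prob_algebra borel"
    and nrm: "has_nrm_law M P H \<rho>" and X: "cond_iid M P X"
    and \<A>: "partition_on {..<n} \<A>" and n: "n \<ge> 1"
  shows "ennreal (measure M {w\<in>space M. restrict_partition n (tie_partition (\<lambda>i. X i w)) = \<A>}) =
    (\<integral>\<^sup>+u\<in>{0<..}. ennreal (u ^ (n - 1) / fact (n - 1) * (exp (- laplace_exponent (levy_measure_of \<rho>) u) *
        (\<Prod>A\<in>\<A>. tilted_moment (levy_measure_of \<rho>) (card A) u))) \<partial>lborel)"
proof -
  interpret M: prob_space M by fact
  obtain N :: "'s measure measure" and Q where Q: "homogeneous_nrm N Q H \<rho>"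
    and law: "distr M (prob_algebra borel) P = distr N (prob_algebra borel) Q"
    using nrm by (auto simp: has_nrm_law_def)
  obtain \<mu> where crm: "homogeneous_crm N \<mu> H \<rho>"
    and ratio: "AE w in N. \<forall>A\<in>sets borel. emeasure (Q w) A = emeasure (\<mu> w) A / emeasure (\<mu> w) UNIV"
    and N: "prob_space N" and Qm: "Q \<in> N \<rightarrow>\<^sub>M prob_algebra borel"
    using Q by (auto simp: homogeneous_nrm_def)
  interpret N: prob_space N by fact
  interpret H: prob_space H by fact
  have tot: "AE w in N. 0 < emeasure (\<mu> w) UNIV \<and> emeasure (\<mu> w) UNIV < \<infinity>"
    using ratio AE_space
  proof eventually_elim
    case (elim w)
    have "Q w \<in> space (prob_algebra borel)" using measurable_space[OF Qm elim(2)] .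
    hence "emeasure (Q w) UNIV = 1" using in_space_prob_algebra by fastforce
    hence "emeasure (\<mu> w) UNIV / emeasure (\<mu> w) UNIV = 1" using elim(1) by auto
    thus ?case by (cases "emeasure (\<mu> w) UNIV = 0"; cases "emeasure (\<mu> w) UNIV = \<infinity>")
        (auto simp: less_top[symmetric] zero_less_iff_neq_zero)
  qed
  interpret normalizable_crm N \<mu> H \<rho>
  proof unfold_locales
    show "AE w in N. emeasure (\<mu> w) UNIV < \<infinity>" "AE w in N. 0 < emeasure (\<mu> w) UNIV"
      using tot by auto
  qed fact+
  have ratio': "AE w in N. \<forall>A\<in>sets borel. measure (Q w) A = measure (\<mu> w) A / measure (\<mu> w) UNIV"
    using ratio AE_pos
  proof eventually_elim
    case (elim w)
    then interpret finite_measure "\<mu> w" by simp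
    show ?case
    proof
      fix A :: "'s set" assume "A \<in> sets borel"
      hence "emeasure (Q w) A = ennreal (measure (\<mu> w) A / measure (\<mu> w) UNIV)"
        using elim by (simp add: emeasure_eq_measure divide_ennreal)
      thus "measure (Q w) A = measure (\<mu> w) A / measure (\<mu> w) UNIV" by (simp add: measure_def)
    qed
  qed
  obtain U :: "nat \<Rightarrow> 's set" where U: "\<And>i. open (U i)" "\<And>x y. x \<noteq> y \<Longrightarrow> \<exists>i. x \<in> U i \<and> y \<notin> U i"
    using separating_sequence by blast
  define \<C> where "\<C> = (\<lambda>m. range (atom U m))"
  have \<C>: "partition_on UNIV (\<C> m)" "finite (\<C> m)" "\<C> m \<subseteq> sets borel" for m
    unfolding \<C>_def using partition_on_atoms finite_atoms atoms_borel[of U] U(1) by (auto intro: borel_open)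
  (* no cell mass exceeds the Euclidean norm of all cell masses *)
  define \<eta> where "\<eta> = (\<lambda>m. sqrt (\<Sum>B\<in>\<C> m. (measure H B)\<^sup>2))"
  have small: "measure H B \<le> \<eta> m" if "B \<in> \<C> m" for m B
    unfolding \<eta>_def using that \<C>(2)
    by (intro real_le_rsqrt member_le_sum) auto
  have "(\<lambda>m. \<Sum>B\<in>\<C> m. (measure H B)\<^sup>2) \<longlonglongrightarrow> 0"
    unfolding \<C>_def
    by (rule sum_atoms_tendsto_0[OF H(1,2) U nonatomic_measure_singleton[OF H]])
  hence \<eta>: "\<eta> \<longlonglongrightarrow> 0" unfolding \<eta>_def using tendsto_real_sqrt by fastforce
  define E where "E = (\<lambda>m. {w\<in>space M. \<forall>i<n. \<forall>j<n. (\<exists>B\<in>\<C> m. X i w \<in> B \<and> X j w \<in> B) \<longleftrightarrow> (\<exists>A\<in>\<A>. i \<in> A \<and> j \<in> A)})"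
  define E' where "E' = {w\<in>space M. restrict_partition n (tie_partition (\<lambda>i. X i w)) = \<A>}"
  have E'_iff: "E' = {w\<in>space M. \<forall>i<n. \<forall>j<n. X i w = X j w \<longleftrightarrow> (\<exists>A\<in>\<A>. i \<in> A \<and> j \<in> A)}"
    unfolding E'_def by (intro Collect_cong conj_cong refl restrict_tie_partition_eq_iff[OF \<A>])
  have E: "E m \<in> sets M"
    and mE: "measure M (E m) = (\<Sum>\<phi>\<in>inj_labellings \<A> (\<C> m). \<integral>w. (\<Prod>A\<in>\<A>. measure (P w) (\<phi> A) ^ card A) \<partial>M)" for m
    unfolding E_def by (rule measure_tie_pattern[OF M P X \<A> \<C>])+
  have lim: "(\<lambda>m. indicat_real (E m) w) \<longlonglongrightarrow> indicat_real E' w" for w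
  proof -
    have ev: "\<forall>\<^sub>F m in sequentially. (\<exists>B\<in>\<C> m. X i w \<in> B \<and> X j w \<in> B) \<longleftrightarrow> X i w = X j w" for i j
    proof (cases "X i w = X j w")
      case True
      have "\<exists>B\<in>\<C> m. X j w \<in> B" for m using partition_onD1[OF \<C>(1)[of m]] by blast
      thus ?thesis using True by simp
    next
      case False
      then obtain k where k: "X i w \<in> U k" "X j w \<notin> U k" using U(2) by blast
      have "\<not> (\<exists>B\<in>\<C> m. X i w \<in> B \<and> X j w \<in> B)" if "m > k" for m
        unfolding \<C>_def same_atom_iff using k that by (auto simp: atom_def)
      thus ?thesis using False by (auto intro: eventually_mono[OF eventually_gt_at_top[of k]])
    qed
    have "\<forall>\<^sub>F m in sequentially. \<forall>i\<in>{..<n}. \<forall>j\<in>{..<n}. (\<exists>B\<in>\<C> m. X i w \<in> B \<and> X j w \<in> B) \<longleftrightarrow> X i w = X j w"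
      by (intro eventually_ball_finite ballI ev) auto
    hence "\<forall>\<^sub>F m in sequentially. indicat_real (E m) w = indicat_real E' w"
    proof eventually_elim
      case (elim m)
      have "w \<in> E m \<longleftrightarrow> w \<in> E'" unfolding E_def E'_iff using elim by (simp cong: imp_cong)
      thus ?case by (simp add: indicator_def)
    qed
    thus ?thesis by (rule tendsto_eventually)
  qed
  have mE': "indicat_real E' \<in> borel_measurable M"
    by (rule borel_measurable_LIMSEQ_real[OF lim]) (use E in auto)
  have "(\<lambda>m. \<integral>w. indicat_real (E m) w \<partial>M) \<longlonglongrightarrow> (\<integral>w. indicat_real E' w \<partial>M)"
  proof (rule integral_dominated_convergence[where w = "\<lambda>_. 1"])
    show "AE w in M. norm (indicat_real (E m) w) \<le> 1" for m by (simp add: indicator_def)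
    show "AE w in M. (\<lambda>m. indicat_real (E m) w) \<longlonglongrightarrow> indicat_real E' w" using lim by (intro AE_I2)
  qed (use mE' E in simp_all)
  moreover have "E m \<inter> space M = E m" "E' \<inter> space M = E'" for m
    unfolding E_def E'_def by (rule Int_absorb2[OF Collect_restrict])+
  ultimately have limM: "(\<lambda>m. ennreal (measure M (E m))) \<longlonglongrightarrow> ennreal (measure M E')"
    by simp
  have "ennreal (measure M (E m)) =
     (\<integral>\<^sup>+u\<in>{0<..}. ennreal (u ^ (n - 1) / fact (n - 1) * (exp (- \<psi> u) * inj_moment_sum \<A> (\<C> m) u)) \<partial>lborel)" for m
  proof -
    have "measure M (E m) = (\<Sum>\<phi>\<in>inj_labellings \<A> (\<C> m).
            \<integral>w. (\<Prod>A\<in>\<A>. (measure (\<mu> w) (\<phi> A) / measure (\<mu> w) UNIV) ^ card A) \<partial>N)"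
      unfolding mE
    proof (rule sum.cong[OF refl])
      fix \<phi> assume \<phi>: "\<phi> \<in> inj_labellings \<A> (\<C> m)"
      hence bor [measurable]: "\<phi> A \<in> sets borel" if "A \<in> \<A>" for A using \<C>(3)[of m] that by auto
      let ?G = "\<lambda>\<nu>::'s measure. \<Prod>A\<in>\<A>. measure \<nu> (\<phi> A) ^ card A"
      have "?G \<in> borel_measurable (subprob_algebra borel)" by measurable
      hence G: "?G \<in> borel_measurable (prob_algebra borel)"
        unfolding prob_algebra_def by (rule measurable_restrict_space1)
      have "(\<integral>w. ?G (P w) \<partial>M) = (\<integral>\<nu>. ?G \<nu> \<partial>distr M (prob_algebra borel) P)"
        by (rule integral_distr[OF P G, symmetric])
      also have "\<dots> = (\<integral>w. ?G (Q w) \<partial>N)" unfolding law by (rule integral_distr[OF Qm G])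
      also have "\<dots> = (\<integral>w. (\<Prod>A\<in>\<A>. (measure (\<mu> w) (\<phi> A) / measure (\<mu> w) UNIV) ^ card A) \<partial>N)"
      proof (rule integral_cong_AE)
        show "(\<lambda>w. ?G (Q w)) \<in> borel_measurable N" by (rule measurable_compose[OF Qm G])
        show "(\<lambda>w. \<Prod>A\<in>\<A>. (measure (\<mu> w) (\<phi> A) / measure (\<mu> w) UNIV) ^ card A) \<in> borel_measurable N"
          by measurable
        show "AE w in N. ?G (Q w) = (\<Prod>A\<in>\<A>. (measure (\<mu> w) (\<phi> A) / measure (\<mu> w) UNIV) ^ card A)"
          using ratio' by eventually_elim (use bor in \<open>auto intro!: prod.cong\<close>)
      qed
      finally show "(\<integral>w. ?G (P w) \<partial>M) = (\<integral>w. (\<Prod>A\<in>\<A>. (measure (\<mu> w) (\<phi> A) / measure (\<mu> w) UNIV) ^ card A) \<partial>N)" .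
    qed
    thus ?thesis using sum_inj_normalized_moments[OF \<C> \<A> n] by simp
  qed
  hence "(\<lambda>m. ennreal (measure M (E m))) \<longlonglongrightarrow>
     (\<integral>\<^sup>+u\<in>{0<..}. ennreal (u ^ (n - 1) / fact (n - 1) * (exp (- \<psi> u) * (\<Prod>A\<in>\<A>. \<kappa> (card A) u))) \<partial>lborel)"
    using tendsto_nn_integral_inj_moment_sum[OF \<C> small \<eta> \<A> n] by simp
  from LIMSEQ_unique[OF limM this] show ?thesis by (simp add: E'_def)
qed

section \<open>Exponentially tilted stable densities\<close>

text \<open>
  Compare with \<open>c/x\<close> on \<open>[1, e\<^sup>n]\<close> or on \<open>[e\<^sup>-\<^sup>n, 1]\<close>.
\<close>

lemma nn_integral_inverse_eq_top:
  assumes f: "f \<in> borel_measurable borel" and c: "c > 0"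
    and le: "(\<forall>x\<ge>1. c / x \<le> f x) \<or> (\<forall>x\<in>{0<..1}. c / x \<le> f x)"
  shows "(\<integral>\<^sup>+x\<in>{0<..}. ennreal (f x) \<partial>lborel) = \<infinity>"
proof -
  have bound: "ennreal (c * real n) \<le> (\<integral>\<^sup>+x\<in>{0<..}. ennreal (f x) \<partial>lborel)" for n
  proof -
    define a where "a = (if (\<forall>x\<ge>1. c / x \<le> f x) then 1 else exp (- real n))"
    define b where "b = (if (\<forall>x\<ge>1. c / x \<le> f x) then exp (real n) else 1)"
    have ab: "0 < a" "a \<le> b" "ln b - ln a = real n" by (auto simp: a_def b_def)
    have fle: "c / x \<le> f x" if "x \<in> {a..b}" for x
    proof -
      have "0 < x" using that ab(1) by auto
      thus ?thesis using le that by (cases "\<forall>x\<ge>1. c / x \<le> f x") (simp_all add: a_def b_def)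
    qed
    have "ennreal (c * real n) = ennreal (c * ln b - c * ln a)"
      using ab(3) by (simp add: right_diff_distrib[symmetric])
    also have "\<dots> = (\<integral>\<^sup>+x. ennreal (c / x) * indicator {a..b} x \<partial>lborel)"
      by (rule nn_integral_FTC_Icc[symmetric])
         (use ab c in \<open>auto intro!: derivative_eq_intros divide_nonneg_nonneg\<close>)
    also have "\<dots> \<le> (\<integral>\<^sup>+x\<in>{0<..}. ennreal (f x) \<partial>lborel)"
      using ab fle by (intro nn_integral_mono) (auto simp: indicator_def intro!: ennreal_leI)
    finally show ?thesis .
  qed
  show ?thesis
  proof (rule ccontr)
    assume "(\<integral>\<^sup>+x\<in>{0<..}. ennreal (f x) \<partial>lborel) \<noteq> \<infinity>"
    then obtain r where r: "(\<integral>\<^sup>+x\<in>{0<..}. ennreal (f x) \<partial>lborel) = ennreal r" "r \<ge> 0"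
      by (metis ennreal_cases infinity_ennreal_def)
    obtain n :: nat where "r / c < n" using reals_Archimedean2 by blast
    hence "r < c * n" using c by (simp add: field_simps)
    thus False using bound[of n] r by (simp add: ennreal_le_iff)
  qed
qed

text \<open>
  One family for all the densities of the characterization: for \<open>\<alpha> > 0\<close> it contains the generalized
  Gamma densities, with \<open>\<beta>\<close> in place of \<open>\<zeta>\<^sup>1\<^sup>/\<^sup>\<alpha>/2\<close>, and for \<open>\<alpha> = 0\<close> the Gamma densities with an
  arbitrary rate.
\<close>

definition tilted_stable_density :: "real \<Rightarrow> real \<Rightarrow> real \<Rightarrow> real \<Rightarrow> real" where
  "tilted_stable_density K \<alpha> \<beta> x = K * x powr (- 1 - \<alpha>) * exp (- (\<beta> * x))"

lemma measurable_tilted_stable_density [measurable]: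
  "tilted_stable_density K \<alpha> \<beta> \<in> borel_measurable borel"
  unfolding tilted_stable_density_def[abs_def] by measurable

lemma tilted_stable_density_moment:
  assumes K: "K \<ge> 0" and n: "real n > \<alpha>" and u: "u + \<beta> > 0"
  shows "(\<integral>\<^sup>+x\<in>{0<..}. ennreal (x ^ n * exp (- (u * x))) * ennreal (tilted_stable_density K \<alpha> \<beta> x) \<partial>lborel) =
         ennreal (K * Gamma (real n - \<alpha>) * (u + \<beta>) powr (\<alpha> - real n))"
proof -
  have "(\<integral>\<^sup>+x\<in>{0<..}. ennreal (x ^ n * exp (- (u * x))) * ennreal (tilted_stable_density K \<alpha> \<beta> x) \<partial>lborel) =
        (\<integral>\<^sup>+x. ennreal K * (ennreal (x powr (real n - \<alpha> - 1) * exp (- ((u + \<beta>) * x))) * indicator {0<..} x) \<partial>lborel)"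
  proof (rule nn_integral_cong)
    fix x :: real
    show "ennreal (x ^ n * exp (- (u * x))) * ennreal (tilted_stable_density K \<alpha> \<beta> x) * indicator {0<..} x =
          ennreal K * (ennreal (x powr (real n - \<alpha> - 1) * exp (- ((u + \<beta>) * x))) * indicator {0<..} x)"
    proof (cases "x > 0")
      case True
      have "x ^ n * exp (- (u * x)) * tilted_stable_density K \<alpha> \<beta> x =
            K * ((x powr real n * x powr (- 1 - \<alpha>)) * (exp (- (u * x)) * exp (- (\<beta> * x))))"
        using True by (simp add: tilted_stable_density_def powr_realpow mult_ac)
      also have "x powr real n * x powr (- 1 - \<alpha>) = x powr (real n - \<alpha> - 1)"
        by (simp add: powr_add[symmetric] algebra_simps)
      also have "exp (- (u * x)) * exp (- (\<beta> * x)) = exp (- ((u + \<beta>) * x))"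
        by (simp add: exp_add[symmetric] algebra_simps)
      finally show ?thesis using True K
        by (simp add: ennreal_mult[symmetric] tilted_stable_density_def)
    qed simp
  qed
  also have "\<dots> = ennreal K * (\<integral>\<^sup>+x\<in>{0<..}. ennreal (x powr (real n - \<alpha> - 1) * exp (- ((u + \<beta>) * x))) \<partial>lborel)"
    by (rule nn_integral_cmult) measurable
  also have "(\<integral>\<^sup>+x\<in>{0<..}. ennreal (x powr (real n - \<alpha> - 1) * exp (- ((u + \<beta>) * x))) \<partial>lborel) =
        ennreal (Gamma (real n - \<alpha>) * (u + \<beta>) powr (- (real n - \<alpha>)))"
    using nn_integral_gamma[of "real n - \<alpha>" "u + \<beta>"] n u by simp
  also have "ennreal K * \<dots> = ennreal (K * Gamma (real n - \<alpha>) * (u + \<beta>) powr (\<alpha> - real n))"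
    using K n by (simp add: ennreal_mult'[symmetric] mult.assoc)
  finally show ?thesis .
qed

lemma levy_density_tilted_stable:
  assumes K: "K > 0" and \<alpha>: "0 \<le> \<alpha>" "\<alpha> < 1" and \<beta>: "\<beta> \<ge> 0" and nz: "\<alpha> > 0 \<or> \<beta> > 0"
  shows "levy_density (tilted_stable_density K \<alpha> \<beta>)"
  unfolding levy_density_def
proof (intro conjI allI impI)
  show "set_borel_measurable borel {0<..} (tilted_stable_density K \<alpha> \<beta>)"
    unfolding set_borel_measurable_def by measurable
  show "0 \<le> tilted_stable_density K \<alpha> \<beta> x" for x using K by (simp add: tilted_stable_density_def)
  show "(\<integral>\<^sup>+x\<in>{0<..}. ennreal (tilted_stable_density K \<alpha> \<beta> x) \<partial>lborel) = \<infinity>"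
  proof (rule nn_integral_inverse_eq_top[where c = "K * exp (- \<beta>)"])
    show "(\<forall>x\<ge>1. K * exp (- \<beta>) / x \<le> tilted_stable_density K \<alpha> \<beta> x) \<or>
          (\<forall>x\<in>{0<..1}. K * exp (- \<beta>) / x \<le> tilted_stable_density K \<alpha> \<beta> x)"
    proof (intro disjI2 ballI)
      fix x :: real assume "x \<in> {0<..1}"
      hence x: "0 < x" "x \<le> 1" by auto
      have "x powr (- 1) \<le> x powr (- 1 - \<alpha>)" using x \<alpha> by (intro powr_mono') auto
      moreover have "exp (- \<beta>) \<le> exp (- (\<beta> * x))" using x \<beta> by (simp add: mult_left_le)
      ultimately have "(K * x powr (- 1)) * exp (- \<beta>) \<le> (K * x powr (- 1 - \<alpha>)) * exp (- (\<beta> * x))"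
        using K by (intro mult_mono) auto
      thus "K * exp (- \<beta>) / x \<le> tilted_stable_density K \<alpha> \<beta> x"
        using x by (simp add: tilted_stable_density_def powr_minus divide_inverse mult_ac)
    qed
  qed (use K in auto)
  show "(\<integral>\<^sup>+x\<in>{0<..}. ennreal (min 1 x * tilted_stable_density K \<alpha> \<beta> x) \<partial>lborel) < \<infinity>"
  proof (cases "\<beta> > 0")
    case True
    have "(\<integral>\<^sup>+x\<in>{0<..}. ennreal (min 1 x * tilted_stable_density K \<alpha> \<beta> x) \<partial>lborel) \<le>
          (\<integral>\<^sup>+x\<in>{0<..}. ennreal (x ^ 1 * exp (- (0 * x))) * ennreal (tilted_stable_density K \<alpha> \<beta> x) \<partial>lborel)"
      using K by (intro nn_integral_mono)
        (auto simp: indicator_def ennreal_mult[symmetric] tilted_stable_density_def intro!: ennreal_leI mult_right_mono)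
    also have "\<dots> < \<infinity>"
      by (subst tilted_stable_density_moment) (use K \<alpha> True in auto)
    finally show ?thesis .
  next
    case False
    hence b0: "\<beta> = 0" and a0: "\<alpha> > 0" using \<beta> nz by auto
    have 1: "(\<integral>\<^sup>+x. ennreal (exp 1 * (x ^ 1 * exp (- (1 * x)) * tilted_stable_density K \<alpha> 0 x)) * indicator {0<..} x \<partial>lborel) < \<infinity>"
    proof -
      have "(\<integral>\<^sup>+x. ennreal (exp 1 * (x ^ 1 * exp (- (1 * x)) * tilted_stable_density K \<alpha> 0 x)) * indicator {0<..} x \<partial>lborel) =
        (\<integral>\<^sup>+x. ennreal (exp 1) * (ennreal (x ^ 1 * exp (- (1 * x))) * ennreal (tilted_stable_density K \<alpha> 0 x) * indicator {0<..} x) \<partial>lborel)"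
        using K by (intro nn_integral_cong)
          (auto simp: indicator_def ennreal_mult[symmetric] tilted_stable_density_def)
      also have "\<dots> = ennreal (exp 1) * (\<integral>\<^sup>+x\<in>{0<..}. ennreal (x ^ 1 * exp (- (1 * x))) * ennreal (tilted_stable_density K \<alpha> 0 x) \<partial>lborel)"
        by (rule nn_integral_cmult) measurable
      also have "\<dots> < \<infinity>"
        by (subst tilted_stable_density_moment) (use K \<alpha> in \<open>auto simp: ennreal_mult_less_top\<close>)
      finally show ?thesis .
    qed
    have 2: "(\<integral>\<^sup>+x. ennreal (K * x powr (- 1 - \<alpha>)) * indicator {1..} x \<partial>lborel) < \<infinity>"
    proof -
      have "(\<integral>\<^sup>+x. ennreal (K * x powr (- 1 - \<alpha>)) * indicator {1..} x \<partial>lborel) =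
            ennreal (0 - (- (K / \<alpha>) * 1 powr (- \<alpha>)))"
      proof (rule nn_integral_FTC_atLeast)
        fix x :: real assume x: "1 \<le> x"
        have "((\<lambda>x. - (K / \<alpha>) * x powr (- \<alpha>)) has_real_derivative (- (K / \<alpha>) * (- \<alpha> * x powr (- \<alpha> - 1)))) (at x)"
          using x by (auto intro!: derivative_eq_intros)
        also have "- (K / \<alpha>) * (- \<alpha> * x powr (- \<alpha> - 1)) = K * x powr (- 1 - \<alpha>)"
        proof -
          have eq: "x powr (- \<alpha> - 1) = x powr (- 1 - \<alpha>)"
            by (rule arg_cong[of _ _ "\<lambda>t. x powr t"]) simp
          show ?thesis unfolding eq using a0 by simp
        qed
        finally show "((\<lambda>x. - (K / \<alpha>) * x powr (- \<alpha>)) has_real_derivative K * x powr (- 1 - \<alpha>)) (at x)" .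
        show "0 \<le> K * x powr (- 1 - \<alpha>)" using K by simp
      next
        have "((\<lambda>x::real. x powr (- \<alpha>)) \<longlongrightarrow> 0) at_top"
          by (rule tendsto_neg_powr) (use a0 filterlim_ident in auto)
        from tendsto_mult_right_zero[OF this]
        show "((\<lambda>x. - (K / \<alpha>) * x powr (- \<alpha>)) \<longlongrightarrow> 0) at_top" .
      qed measurable
      thus ?thesis by simp
    qed
    have "(\<integral>\<^sup>+x\<in>{0<..}. ennreal (min 1 x * tilted_stable_density K \<alpha> \<beta> x) \<partial>lborel) \<le>
          (\<integral>\<^sup>+x. ennreal (exp 1 * (x ^ 1 * exp (- (1 * x)) * tilted_stable_density K \<alpha> 0 x)) * indicator {0<..} x +
                 ennreal (K * x powr (- 1 - \<alpha>)) * indicator {1..} x \<partial>lborel)"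
    proof (rule nn_integral_mono)
      fix x :: real
      show "ennreal (min 1 x * tilted_stable_density K \<alpha> \<beta> x) * indicator {0<..} x \<le>
         ennreal (exp 1 * (x ^ 1 * exp (- (1 * x)) * tilted_stable_density K \<alpha> 0 x)) * indicator {0<..} x +
         ennreal (K * x powr (- 1 - \<alpha>)) * indicator {1..} x"
      proof (cases "x > 0")
        case x: True
        show ?thesis
        proof (cases "x \<ge> 1")
          case True
          hence "ennreal (min 1 x * tilted_stable_density K \<alpha> \<beta> x) * indicator {0<..} x =
              ennreal (K * x powr (- 1 - \<alpha>)) * indicator {1..} x"
            by (simp add: b0 tilted_stable_density_def)
          thus ?thesis by simp
        next
          case False
          have "x * 1 \<le> x * (exp 1 * exp (- x))"
            using x False by (intro mult_left_mono) (auto simp: exp_add[symmetric])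
          hence "x * tilted_stable_density K \<alpha> 0 x \<le> (x * (exp 1 * exp (- x))) * tilted_stable_density K \<alpha> 0 x"
            using K by (intro mult_right_mono) (auto simp: tilted_stable_density_def)
          hence "ennreal (min 1 x * tilted_stable_density K \<alpha> \<beta> x) \<le> ennreal (exp 1 * (x ^ 1 * exp (- (1 * x)) * tilted_stable_density K \<alpha> 0 x))"
            using x False by (intro ennreal_leI) (simp add: b0 mult_ac)
          thus ?thesis using x False by simp
        qed
      qed simp
    qed
    also have "\<dots> = (\<integral>\<^sup>+x. ennreal (exp 1 * (x ^ 1 * exp (- (1 * x)) * tilted_stable_density K \<alpha> 0 x)) * indicator {0<..} x \<partial>lborel) +
         (\<integral>\<^sup>+x. ennreal (K * x powr (- 1 - \<alpha>)) * indicator {1..} x \<partial>lborel)"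
      by (rule nn_integral_add) measurable
    also have "\<dots> < \<infinity>" using 1 2 by simp
    finally show ?thesis .
  qed
qed

lemma levy_density_cong_AE:
  assumes "levy_density \<rho>" and "AE x in lborel. x > 0 \<longrightarrow> \<rho> x = \<rho>' x"
    and "\<rho>' \<in> borel_measurable borel" "\<And>x. x > 0 \<Longrightarrow> 0 \<le> \<rho>' x"
  shows "levy_density \<rho>'"
proof -
  have "(\<integral>\<^sup>+x\<in>{0<..}. ennreal (g x * \<rho> x) \<partial>lborel) = (\<integral>\<^sup>+x\<in>{0<..}. ennreal (g x * \<rho>' x) \<partial>lborel)" for g
    by (rule nn_integral_cong_AE, use assms(2) in eventually_elim) (auto simp: indicator_def)
  from this[of "\<lambda>x. min 1 x"] this[of "\<lambda>_. 1"] show ?thesis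
    using assms unfolding levy_density_def set_borel_measurable_def by auto
qed

text \<open>
  For \<open>\<alpha> < 0 < \<beta>\<close> the total intensity is a finite Gamma integral, and for \<open>\<alpha> \<le> 0 = \<beta>\<close> the tail at
  infinity is at least that of \<open>1/x\<close>.
\<close>

lemma levy_density_tilted_stableD:
  assumes levy: "levy_density (tilted_stable_density K \<alpha> \<beta>)" and K: "K > 0" and \<beta>: "\<beta> \<ge> 0"
  shows "0 \<le> \<alpha> \<and> (\<alpha> > 0 \<or> \<beta> > 0)"
proof (rule ccontr)
  assume neg: "\<not> ?thesis"
  hence \<alpha>: "\<alpha> \<le> 0" by auto
  show False
  proof (cases "\<beta> > 0")
    case True
    hence "\<alpha> < 0" using neg by auto
    hence "(\<integral>\<^sup>+x\<in>{0<..}. ennreal (x ^ 0 * exp (- (0 * x))) * ennreal (tilted_stable_density K \<alpha> \<beta> x) \<partial>lborel) < \<infinity>"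
      by (subst tilted_stable_density_moment) (use K True in auto)
    thus False using levy by (simp add: levy_density_def)
  next
    case False
    hence b0: "\<beta> = 0" using \<beta> by simp
    have "(\<integral>\<^sup>+x\<in>{0<..}. ennreal (min 1 x * tilted_stable_density K \<alpha> \<beta> x) \<partial>lborel) = \<infinity>"
    proof (rule nn_integral_inverse_eq_top[OF _ K])
      show "(\<forall>x\<ge>1. K / x \<le> min 1 x * tilted_stable_density K \<alpha> \<beta> x) \<or>
            (\<forall>x\<in>{0<..1}. K / x \<le> min 1 x * tilted_stable_density K \<alpha> \<beta> x)"
      proof (intro disjI1 allI impI)
        fix x :: real assume x: "1 \<le> x"
        have "x powr (- 1) \<le> x powr (- 1 - \<alpha>)" using x \<alpha> by (intro powr_mono) auto
        hence "K * x powr (- 1) \<le> K * x powr (- 1 - \<alpha>)" using K by (intro mult_left_mono) auto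
        moreover have "K * x powr (- 1) = K / x" using x by (simp add: powr_minus_divide)
        ultimately show "K / x \<le> min 1 x * tilted_stable_density K \<alpha> \<beta> x"
          using x by (simp add: tilted_stable_density_def b0)
      qed
    qed measurable
    thus False using levy by (simp add: levy_density_def)
  qed
qed

section \<open>From the Gibbs form to the Levy density\<close>

lemma partition_with_block_sizes:
  assumes "\<forall>m\<in>set ns. 1 \<le> m"
  obtains As :: "nat set list" where "distinct As" "partition_on {..<sum_list ns} (set As)" "map card As = ns"
  using assms
proof (induction ns arbitrary: thesis rule: rev_induct)
  case Nil
  show ?case by (rule Nil(1)[of "[]"]) (auto simp: partition_on_def)
next
  case (snoc k ns)
  obtain As where As: "distinct As" "partition_on {..<sum_list ns} (set As)" "map card As = ns"
    using snoc.IH snoc.prems(2) by auto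
  define n where "n = sum_list ns"
  have un: "{..<n} = \<Union>(set As)" unfolding n_def by (rule partition_onD1[OF As(2)])
  have k: "k \<ge> 1" using snoc.prems by auto
  hence nin: "{n..<n + k} \<notin> set As" using un by fastforce
  show ?case
  proof (rule snoc.prems(1)[of "As @ [{n..<n + k}]"])
    have "partition_on ({n..<n + k} \<union> {..<n}) (insert {n..<n + k} (set As))"
    proof (subst partition_on_insert)
      show "disjnt {n..<n + k} (\<Union>(set As))" unfolding un[symmetric] by (auto simp: disjnt_def)
      have "{n..<n + k} \<union> {..<n} - {n..<n + k} = {..<n}" by auto
      thus "partition_on ({n..<n + k} \<union> {..<n} - {n..<n + k}) (set As) \<and>
          {n..<n + k} \<subseteq> {n..<n + k} \<union> {..<n} \<and> {n..<n + k} \<noteq> {}"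
        using As(2) k by (simp add: n_def)
    qed
    also have "{n..<n + k} \<union> {..<n} = {..<sum_list (ns @ [k])}" by (auto simp: n_def)
    finally show "partition_on {..<sum_list (ns @ [k])} (set (As @ [{n..<n + k}]))" by simp
  qed (use As nin in auto)
qed

lemma prod_blocks:
  assumes "distinct As" shows "(\<Prod>A\<in>set As. f (card A)) = prod_list (map f (map card As))"
  using prod.distinct_set_conv_list[OF assms, of "\<lambda>A. f (card A)"] by (simp add: comp_def)

context levy_intensity
begin

text \<open>
  The power of \<open>u\<close> is distributed over the blocks, so that the partition probabilities become integrals
  of products against one fixed measure \<open>e\<^sup>-\<^sup>\<psi> du/u\<close>, whatever the number of points.
\<close>

definition scaled_moment :: "nat \<Rightarrow> real \<Rightarrow> real" where
  "scaled_moment j u = u ^ j * \<kappa> j u"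

definition eppf_integral :: "nat list \<Rightarrow> nat \<Rightarrow> ennreal" where
  "eppf_integral ns m = (\<integral>\<^sup>+u\<in>{0<..}. ennreal (exp (- \<psi> u) / u * (prod_list (map (\<lambda>j. scaled_moment j u) ns) * \<psi> u ^ m)) \<partial>lborel)"

lemma scaled_moment_nonneg: "u > 0 \<Longrightarrow> 0 \<le> scaled_moment j u"
  by (simp add: scaled_moment_def tilted_moment_nonneg[OF levy_measure])

lemma prod_scaled_moment_nonneg: "u > 0 \<Longrightarrow> 0 \<le> prod_list (map (\<lambda>j. scaled_moment j u) ns)"
  by (induction ns) (auto intro!: mult_nonneg_nonneg scaled_moment_nonneg)

lemma measurable_scaled_moment [measurable]: "scaled_moment j \<in> borel_measurable borel"
  unfolding scaled_moment_def[abs_def] by measurable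

lemma measurable_prod_scaled_moment [measurable]: "(\<lambda>u. prod_list (map (\<lambda>j. scaled_moment j u) ns)) \<in> borel_measurable borel"
  by (induction ns) auto

lemma prod_scaled_moment:
  "prod_list (map (\<lambda>j. scaled_moment j u) ns) = u ^ sum_list ns * prod_list (map (\<lambda>j. \<kappa> j u) ns)"
  by (induction ns) (auto simp: scaled_moment_def power_add)

text \<open>
  Write one factor \<open>\<psi>\<close> as the series of the scaled moments: it acts as an additional block summed over
  its size.
\<close>

lemma eppf_integral_Suc:
  "eppf_integral ns (Suc m) = (\<Sum>j. ennreal (1 / fact (Suc j)) * eppf_integral (ns @ [Suc j]) m)"
proof -
  have "eppf_integral ns (Suc m) = (\<integral>\<^sup>+u. (\<Sum>j. ennreal (1 / fact (Suc j)) *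
      (ennreal (exp (- \<psi> u) / u * (prod_list (map (\<lambda>j. scaled_moment j u) (ns @ [Suc j])) * \<psi> u ^ m)) * indicator {0<..} u)) \<partial>lborel)"
    unfolding eppf_integral_def
  proof (rule nn_integral_cong)
    fix u :: real
    show "ennreal (exp (- \<psi> u) / u * (prod_list (map (\<lambda>j. scaled_moment j u) ns) * \<psi> u ^ Suc m)) * indicator {0<..} u =
      (\<Sum>j. ennreal (1 / fact (Suc j)) *
      (ennreal (exp (- \<psi> u) / u * (prod_list (map (\<lambda>j. scaled_moment j u) (ns @ [Suc j])) * \<psi> u ^ m)) * indicator {0<..} u))"
    proof (cases "u > 0")
      case u: True
      define c where "c = exp (- \<psi> u) / u * (prod_list (map (\<lambda>j. scaled_moment j u) ns) * \<psi> u ^ m)"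
      have c: "c \<ge> 0" unfolding c_def using u prod_scaled_moment_nonneg[OF u] laplace_exponent_nonneg[OF levy_measure u]
        by (intro mult_nonneg_nonneg) auto
      have "ennreal (exp (- \<psi> u) / u * (prod_list (map (\<lambda>j. scaled_moment j u) ns) * \<psi> u ^ Suc m)) =
            ennreal (c * \<psi> u)" by (simp add: c_def mult_ac)
      also have "\<dots> = ennreal c * ennreal (\<psi> u)" using c by (rule ennreal_mult')
      also have "\<dots> = (\<Sum>j. ennreal c * (ennreal (1 / fact (Suc j)) * ennreal (scaled_moment (Suc j) u)))"
        unfolding laplace_exponent_series[OF levy_measure u] scaled_moment_def by (rule ennreal_suminf_cmult[symmetric])
      also have "\<dots> = (\<Sum>j. ennreal (1 / fact (Suc j)) * ennreal (c * scaled_moment (Suc j) u))"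
        using c by (intro suminf_cong) (simp add: ennreal_mult' mult_ac)
      finally show ?thesis using u by (simp add: c_def mult_ac)
    qed simp
  qed
  also have "\<dots> = (\<Sum>j. \<integral>\<^sup>+u. ennreal (1 / fact (Suc j)) *
      (ennreal (exp (- \<psi> u) / u * (prod_list (map (\<lambda>j. scaled_moment j u) (ns @ [Suc j])) * \<psi> u ^ m)) * indicator {0<..} u) \<partial>lborel)"
    by (rule nn_integral_suminf) measurable
  also have "\<dots> = (\<Sum>j. ennreal (1 / fact (Suc j)) * eppf_integral (ns @ [Suc j]) m)"
    unfolding eppf_integral_def by (intro suminf_cong nn_integral_cmult) measurable
  finally show ?thesis .
qed

lemma eppf_integral_proportional:
  assumes base: "\<And>rest. \<forall>m\<in>set rest. 1 \<le> m \<Longrightarrow>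
      ennreal c * eppf_integral (xs @ rest) 0 = ennreal d * eppf_integral (ys @ rest) 0"
  shows "\<forall>m\<in>set rest. 1 \<le> m \<Longrightarrow>
      ennreal c * eppf_integral (xs @ rest) m = ennreal d * eppf_integral (ys @ rest) m"
proof (induction m arbitrary: rest)
  case 0
  show ?case by (rule base[OF 0])
next
  case (Suc m)
  have "ennreal c * eppf_integral (xs @ rest) (Suc m) =
        (\<Sum>j. ennreal (1 / fact (Suc j)) * (ennreal c * eppf_integral (xs @ (rest @ [Suc j])) m))"
    unfolding eppf_integral_Suc ennreal_suminf_cmult[symmetric] by (simp add: mult_ac)
  also have "\<dots> = (\<Sum>j. ennreal (1 / fact (Suc j)) * (ennreal d * eppf_integral (ys @ (rest @ [Suc j])) m))"
    using Suc by (intro suminf_cong arg_cong2[where f = "(*)"] refl Suc.IH) auto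
  also have "\<dots> = ennreal d * eppf_integral (ys @ rest) (Suc m)"
    unfolding eppf_integral_Suc ennreal_suminf_cmult[symmetric] by (simp add: mult_ac)
  finally show ?case .
qed

text \<open>
  Bound \<open>u\<^sup>3 \<kappa>\<^sub>3 \<le> 6 \<psi>\<close> and absorb \<open>\<psi>\<close> into the exponential; what is left is a multiple of
  \<open>\<psi>' e\<^sup>-\<^sup>\<psi>\<^sup>/\<^sup>4\<close>, which is integrable.
\<close>

lemma laplace_exponent_moments_finite:
  assumes c: "c > 0"
  shows "(\<integral>\<^sup>+u\<in>{0<..}. ennreal (exp (\<psi> u / 2) * (c * (exp (- \<psi> u) / u * (scaled_moment 3 u * scaled_moment 1 u)))) \<partial>lborel) < \<infinity>"
proof -
  have "(\<integral>\<^sup>+u\<in>{0<..}. ennreal (exp (\<psi> u / 2) * (c * (exp (- \<psi> u) / u * (scaled_moment 3 u * scaled_moment 1 u)))) \<partial>lborel) \<le>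
        (\<integral>\<^sup>+u. ennreal (c * 24) * (ennreal (\<kappa> 1 u * exp (- (1 / 4 * \<psi> u))) * indicator {0<..} u) \<partial>lborel)"
  proof (rule nn_integral_mono)
    fix u :: real
    show "ennreal (exp (\<psi> u / 2) * (c * (exp (- \<psi> u) / u * (scaled_moment 3 u * scaled_moment 1 u)))) * indicator {0<..} u \<le>
          ennreal (c * 24) * (ennreal (\<kappa> 1 u * exp (- (1 / 4 * \<psi> u))) * indicator {0<..} u)"
    proof (cases "u > 0")
      case u: True
      have f3: "scaled_moment 3 u \<le> 6 * \<psi> u"
        using power_tilted_moment_le_laplace_exponent[OF levy_measure u, of 2]
        by (simp add: scaled_moment_def numeral_3_eq_3 fact_numeral del: power_Suc)
      (* trades the factor \<psi> for half of the remaining exponential decay *)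
      have \<psi>4: "\<psi> u \<le> 4 * exp (\<psi> u / 4)"
        using exp_ge_add_one_self[of "\<psi> u / 4"] by linarith
      have e: "exp (\<psi> u / 2) * exp (- \<psi> u) = exp (- (\<psi> u / 4)) * exp (- (\<psi> u / 4))"
        by (simp add: exp_add[symmetric])
      have e': "exp (\<psi> u / 4) * exp (- (\<psi> u / 4)) = 1" by (simp add: exp_add[symmetric])
      have "exp (\<psi> u / 2) * (c * (exp (- \<psi> u) / u * (scaled_moment 3 u * scaled_moment 1 u))) =
            c * ((exp (\<psi> u / 2) * exp (- \<psi> u)) * (\<kappa> 1 u * scaled_moment 3 u))"
        using u by (simp add: scaled_moment_def[of "Suc 0"] field_simps)
      also have "\<dots> \<le> c * ((exp (\<psi> u / 2) * exp (- \<psi> u)) * (\<kappa> 1 u * (24 * exp (\<psi> u / 4))))"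
        using f3 \<psi>4 c tilted_moment_nonneg[OF levy_measure] by (intro mult_left_mono) auto
      also have "\<dots> = c * 24 * (\<kappa> 1 u * exp (- (\<psi> u / 4))) * (exp (\<psi> u / 4) * exp (- (\<psi> u / 4)))"
        unfolding e by (simp add: mult_ac)
      also have "\<dots> = c * 24 * (\<kappa> 1 u * exp (- (1 / 4 * \<psi> u)))" unfolding e' by simp
      finally show ?thesis
        using u c tilted_moment_nonneg[OF levy_measure] by (simp add: ennreal_mult[symmetric] ennreal_leI)
    qed simp
  qed
  also have "\<dots> = ennreal (c * 24) * (\<integral>\<^sup>+u\<in>{0<..}. ennreal (\<kappa> 1 u * exp (- (1 / 4 * \<psi> u))) \<partial>lborel)"
    by (rule nn_integral_cmult) measurable
  also have "\<dots> \<le> ennreal (c * 24) * ennreal (1 / (1 / 4))"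
    by (intro mult_left_mono nn_integral_derivative_mult_exp_le has_derivative_laplace_exponent[OF levy_measure]
        continuous_on_tilted_moment[OF levy_measure] tilted_moment_nonneg[OF levy_measure] laplace_exponent_nonneg[OF levy_measure]) auto
  also have "\<dots> < \<infinity>" by (simp add: ennreal_mult_less_top)
  finally show ?thesis .
qed

lemma eq_zero_of_AE_zero:
  fixes g :: "real \<Rightarrow> real"
  assumes cont: "continuous_on {0<..} g" and AE: "AE u in lborel. u > 0 \<longrightarrow> g u = 0" and u: "u > 0"
  shows "g u = 0"
proof (rule ccontr)
  assume nz: "g u \<noteq> 0"
  have "open ({0<..} \<inter> g -` (- {0}))"
    by (rule continuous_open_preimage[OF cont]) auto
  moreover have "u \<in> {0<..} \<inter> g -` (- {0})" using u nz by auto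
  ultimately obtain e where e: "e > 0" "ball u e \<subseteq> {0<..} \<inter> g -` (- {0})"
    using open_contains_ball by blast
  have "AE x in lborel. x \<notin> ball u e"
    using AE by eventually_elim (use e(2) in auto)
  hence "emeasure lborel (ball u e) = 0"
    by (subst (asm) AE_iff_measurable[OF _ refl]) (auto simp: ball_def)
  moreover have "ball u e = {u - e<..<u + e}" by (auto simp: dist_real_def)
  ultimately show False using e(1) by simp
qed

text \<open>
  Both sides, weighted by the same positive function, are densities of measures with equal images
  under \<open>\<psi>\<close> by determinacy of moments. As \<open>\<psi>\<close> is strictly increasing, the densities agree almost
  everywhere, and then everywhere by continuity.
\<close>

lemma moment_ode:
  assumes c: "c > 0" and d: "d > 0"
    and eq: "\<And>m. ennreal c * eppf_integral [3, 1] m = ennreal d * eppf_integral [2, 2] m"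
    and u: "u > 0"
  shows "c * (\<kappa> 3 u * \<kappa> 1 u) = d * (\<kappa> 2 u)\<^sup>2"
proof -
  define a where "a = (\<lambda>u. indicator {0<..} u * (c * (exp (- \<psi> u) / u * (scaled_moment 3 u * scaled_moment 1 u))))"
  define b where "b = (\<lambda>u. indicator {0<..} u * (d * (exp (- \<psi> u) / u * (scaled_moment 2 u * scaled_moment 2 u))))"
  have ab0: "0 \<le> a u" "0 \<le> b u" for u
    using c d scaled_moment_nonneg[of u] by (auto simp: a_def b_def indicator_def intro!: mult_nonneg_nonneg)
  have [measurable]: "a \<in> borel_measurable borel" "b \<in> borel_measurable borel"
    unfolding a_def b_def by measurable
  define A where "A = density lborel (\<lambda>u. ennreal (a u))"
  define B where "B = density lborel (\<lambda>u. ennreal (b u))"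
  have sets [measurable_cong]: "sets A = sets borel" "sets B = sets borel" by (auto simp: A_def B_def)
  have pos: "AE x in A. 0 < x" "AE x in B. 0 < x"
    unfolding A_def B_def by (subst AE_density; auto simp: a_def b_def indicator_def)+
  have int: "(\<integral>\<^sup>+u. ennreal (\<psi> u ^ m) \<partial>density lborel (\<lambda>u. ennreal (indicator {0<..} u * (k * (exp (- \<psi> u) / u *
        (scaled_moment i u * scaled_moment j u)))))) = ennreal k * eppf_integral [i, j] m" if k: "k > 0" for k i j m
  proof -
    have "(\<integral>\<^sup>+u. ennreal (\<psi> u ^ m) \<partial>density lborel (\<lambda>u. ennreal (indicator {0<..} u * (k * (exp (- \<psi> u) / u *
        (scaled_moment i u * scaled_moment j u)))))) =
      (\<integral>\<^sup>+u. ennreal k * (ennreal (exp (- \<psi> u) / u * (scaled_moment i u * scaled_moment j u * \<psi> u ^ m)) * indicator {0<..} u) \<partial>lborel)"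
      using k laplace_exponent_nonneg[OF levy_measure] scaled_moment_nonneg
      by (subst nn_integral_density)
         (auto intro!: nn_integral_cong simp: indicator_def ennreal_mult'[symmetric] ennreal_mult''[symmetric] mult_ac)
    also have "\<dots> = ennreal k * eppf_integral [i, j] m"
      unfolding eppf_integral_def by (subst nn_integral_cmult) (auto simp: mult.assoc)
    finally show ?thesis .
  qed
  have mom: "(\<integral>\<^sup>+u. ennreal (\<psi> u ^ m) \<partial>A) = (\<integral>\<^sup>+u. ennreal (\<psi> u ^ m) \<partial>B)" for m
    using eq[of m] unfolding A_def B_def a_def b_def int[OF c] int[OF d] by simp
  have expA: "(\<integral>\<^sup>+u. ennreal (exp (1 / 2 * \<psi> u)) \<partial>A) < \<infinity>"
  proof -
    have "(\<integral>\<^sup>+u. ennreal (exp (1 / 2 * \<psi> u)) \<partial>A) = (\<integral>\<^sup>+u. ennreal (a u) * ennreal (exp (1 / 2 * \<psi> u)) \<partial>lborel)"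
      unfolding A_def by (subst nn_integral_density) auto
    also have "\<dots> = (\<integral>\<^sup>+u\<in>{0<..}. ennreal (exp (\<psi> u / 2) * (c * (exp (- \<psi> u) / u * (scaled_moment 3 u * scaled_moment 1 u)))) \<partial>lborel)"
    proof (rule nn_integral_cong)
      fix u :: real
      have "ennreal (a u) * ennreal (exp (1 / 2 * \<psi> u)) = ennreal (exp (1 / 2 * \<psi> u) * a u)"
        by (subst ennreal_mult') (simp_all add: mult.commute)
      thus "ennreal (a u) * ennreal (exp (1 / 2 * \<psi> u)) =
          ennreal (exp (\<psi> u / 2) * (c * (exp (- \<psi> u) / u * (scaled_moment 3 u * scaled_moment 1 u)))) * indicator {0<..} u"
        by (cases "u > 0") (simp_all add: a_def)
    qed
    also have "\<dots> < \<infinity>" by (rule laplace_exponent_moments_finite[OF c])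
    finally show ?thesis .
  qed
  have "distr A borel \<psi> = distr B borel \<psi>"
  proof (rule finite_measure_eq_of_nn_moments[where c = "1 / 2"])
    have "AE x in A. 0 \<le> \<psi> x"
      using pos(1) by eventually_elim (simp add: laplace_exponent_nonneg[OF levy_measure])
    moreover have "AE x in B. 0 \<le> \<psi> x"
      using pos(2) by eventually_elim (simp add: laplace_exponent_nonneg[OF levy_measure])
    ultimately show "AE x in distr A borel \<psi>. 0 \<le> x" "AE x in distr B borel \<psi>. 0 \<le> x"
      by (simp_all add: AE_distr_iff)
    show "(\<integral>\<^sup>+x. ennreal (exp (1 / 2 * x)) \<partial>distr A borel \<psi>) < \<infinity>"
      using expA by (subst nn_integral_distr) auto
    show "(\<integral>\<^sup>+x. ennreal (x ^ m) \<partial>distr A borel \<psi>) = (\<integral>\<^sup>+x. ennreal (x ^ m) \<partial>distr B borel \<psi>)" for m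
      using mom[of m] by (subst (1 2) nn_integral_distr) auto
  qed auto
  have em: "emeasure A (space A) \<noteq> \<infinity>" "emeasure B (space B) \<noteq> \<infinity>"
  proof -
    have "emeasure A (space A) = (\<integral>\<^sup>+u. ennreal (\<psi> u ^ 0) \<partial>A)" by simp
    also have "\<dots> \<le> (\<integral>\<^sup>+u. ennreal (exp (1 / 2 * \<psi> u)) \<partial>A)"
    proof (rule nn_integral_mono_AE, use pos(1) in eventually_elim)
      fix u :: real assume "0 < u"
      thus "ennreal (\<psi> u ^ 0) \<le> ennreal (exp (1 / 2 * \<psi> u))"
        using laplace_exponent_nonneg[OF levy_measure] by (intro ennreal_leI) simp
    qed
    finally show "emeasure A (space A) \<noteq> \<infinity>" using expA by auto
    thus "emeasure B (space B) \<noteq> \<infinity>" using mom[of 0] by simp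
  qed
  hence fin: "finite_measure A" "finite_measure B" by (auto intro: finite_measureI)
  have "A = B"
    by (rule measure_eq_of_distr_strict_mono[OF sets fin pos _ _ \<open>distr A borel \<psi> = distr B borel \<psi>\<close>])
       (use laplace_exponent_strict_mono[OF levy_measure] \<kappa>_pos in auto)
  hence AE_ab: "AE u in lborel. ennreal (a u) = ennreal (b u)"
    using em unfolding A_def B_def
    by (subst (asm) finite_density_unique) (auto simp: emeasure_density)
  have "c * (\<kappa> 3 u * \<kappa> 1 u) - d * (\<kappa> 2 u)\<^sup>2 = 0"
  proof (rule eq_zero_of_AE_zero[OF _ _ u])
    show "continuous_on {0<..} (\<lambda>u. c * (\<kappa> 3 u * \<kappa> 1 u) - d * (\<kappa> 2 u)\<^sup>2)"
      by (intro continuous_intros continuous_on_tilted_moment[OF levy_measure]) auto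
    show "AE u in lborel. u > 0 \<longrightarrow> c * (\<kappa> 3 u * \<kappa> 1 u) - d * (\<kappa> 2 u)\<^sup>2 = 0"
      using AE_ab
    proof (eventually_elim, intro impI)
      fix u :: real assume eq: "ennreal (a u) = ennreal (b u)" and u: "u > 0"
      have "a u = b u" using eq ab0 by simp
      hence "exp (- \<psi> u) / u * u ^ 4 * (c * (\<kappa> 3 u * \<kappa> 1 u)) = exp (- \<psi> u) / u * u ^ 4 * (d * (\<kappa> 2 u)\<^sup>2)"
        using u by (simp add: a_def b_def scaled_moment_def power2_eq_square eval_nat_numeral mult_ac)
      thus "c * (\<kappa> 3 u * \<kappa> 1 u) - d * (\<kappa> 2 u)\<^sup>2 = 0" using u by simp
    qed
  qed
  thus ?thesis by simp
qed

text \<open>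
  The function \<open>\<kappa>\<^sub>1\<close> is the Laplace transform of \<open>x \<rho>(x) dx\<close>, and \<open>C (u + \<beta>)\<^sup>\<alpha>\<^sup>-\<^sup>1\<close> that of a tilted
  power of \<open>x\<close>.
\<close>

lemma density_of_power_moment:
  assumes \<alpha>: "\<alpha> < 1" and C: "C > 0" and \<beta>: "\<beta> \<ge> 0"
    and \<kappa>: "\<And>u. u > 0 \<Longrightarrow> \<kappa> 1 u = C * (u + \<beta>) powr (\<alpha> - 1)"
  shows "AE x in lborel. x > 0 \<longrightarrow> \<rho> x = tilted_stable_density (C / Gamma (1 - \<alpha>)) \<alpha> \<beta> x"
proof -
  define K where "K = C / Gamma (1 - \<alpha>)"
  have G: "Gamma (1 - \<alpha>) > 0" using \<alpha> by (intro Gamma_real_pos) auto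
  have K: "K > 0" using C G by (simp add: K_def)
  let ?g = "tilted_stable_density K \<alpha> \<beta>"
  let ?a = "\<lambda>x. x * (indicator {0<..} x * \<rho> x)" and ?b = "\<lambda>x. x * (indicator {0<..} x * ?g x)"
  note [measurable] = levy_densityD(1)[OF levy]
  have am: "(\<lambda>x. ennreal (?a x)) \<in> borel_measurable lborel"
    using levy_densityD(1)[OF levy] by measurable
  have bm: "(\<lambda>x. ennreal (?b x)) \<in> borel_measurable lborel"
    by measurable
  have a0: "0 \<le> \<rho> x" if "x > 0" for x using levy that by (simp add: levy_density_def)
  have b0: "0 \<le> ?g x" for x using K by (simp add: tilted_stable_density_def)
  define A where "A = density lborel (\<lambda>x. ennreal (?a x))"
  define B where "B = density lborel (\<lambda>x. ennreal (?b x))"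
  have intA: "(\<integral>\<^sup>+x. ennreal (exp (- (u * x))) \<partial>A) = ennreal (\<kappa> 1 u)" if "u > 0" for u
  proof -
    have "(\<integral>\<^sup>+x. ennreal (exp (- (u * x))) \<partial>A) = (\<integral>\<^sup>+x. ennreal (?a x) * ennreal (exp (- (u * x))) \<partial>lborel)"
      unfolding A_def by (subst nn_integral_density[OF am]) auto
    also have "\<dots> = (\<integral>\<^sup>+x\<in>{0<..}. ennreal (x ^ 1 * exp (- (u * x))) * ennreal (\<rho> x) \<partial>lborel)"
      using a0 by (intro nn_integral_cong) (auto simp: indicator_def ennreal_mult[symmetric] mult_ac)
    also have "\<dots> = (\<integral>\<^sup>+x. ennreal (x ^ 1 * exp (- (u * x))) \<partial>L)"
      by (rule levy_densityD(3)[OF levy, symmetric]) measurable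
    also have "\<dots> = ennreal (\<kappa> 1 u)" by (rule ennreal_tilted_moment[OF levy_measure that, symmetric]) simp
    finally show ?thesis .
  qed
  have intB: "(\<integral>\<^sup>+x. ennreal (exp (- (u * x))) \<partial>B) = ennreal (\<kappa> 1 u)" if u: "u > 0" for u
  proof -
    have "(\<integral>\<^sup>+x. ennreal (exp (- (u * x))) \<partial>B) = (\<integral>\<^sup>+x. ennreal (?b x) * ennreal (exp (- (u * x))) \<partial>lborel)"
      unfolding B_def by (subst nn_integral_density[OF bm]) auto
    also have "\<dots> = (\<integral>\<^sup>+x\<in>{0<..}. ennreal (x ^ 1 * exp (- (u * x))) * ennreal (?g x) \<partial>lborel)"
      using b0 by (intro nn_integral_cong) (auto simp: indicator_def ennreal_mult[symmetric] mult_ac)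
    also have "\<dots> = ennreal (K * Gamma (real 1 - \<alpha>) * (u + \<beta>) powr (\<alpha> - real 1))"
      by (rule tilted_stable_density_moment) (use K \<alpha> u \<beta> in auto)
    also have "\<dots> = ennreal (\<kappa> 1 u)" using \<kappa>[OF u] G by (simp add: K_def)
    finally show ?thesis .
  qed
  have "A = B"
  proof (rule measure_eq_of_laplace)
    show "AE x in A. 0 < x" unfolding A_def
      by (subst AE_density[OF am]) (auto simp: indicator_def)
    show "AE x in B. 0 < x" unfolding B_def
      by (subst AE_density[OF bm]) (auto simp: indicator_def)
  qed (auto simp: intA intB A_def[THEN arg_cong, of sets] B_def[THEN arg_cong, of sets])
  hence "density lborel (\<lambda>x. ennreal (?a x)) = density lborel (\<lambda>x. ennreal (?b x))"
    by (simp add: A_def B_def)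
  hence "AE x in lborel. ennreal (?a x) = ennreal (?b x)"
    by (subst (asm) sigma_finite_density_unique[OF am bm])
       (simp_all only: sigma_finite_measure.sigma_finite_iff_density_finite[OF sigma_finite_lborel am], simp)
  thus ?thesis
    unfolding K_def[symmetric]
  proof (eventually_elim, intro impI)
    fix x :: real assume "ennreal (?a x) = ennreal (?b x)" and x: "x > 0"
    hence "x * \<rho> x = x * ?g x" using a0[OF x] b0[of x] by simp
    thus "\<rho> x = ?g x" using x by simp
  qed
qed

end

section \<open>Invariance of the normalized law\<close>

lemma has_nrm_law_cong_AE:
  assumes law: "has_nrm_law M P H \<rho>" and AE: "AE x in lborel. x > 0 \<longrightarrow> \<rho> x = \<rho>' x"
  shows "has_nrm_law M P H \<rho>'"
proof -
  have "(\<integral>\<^sup>+x\<in>{0<..}. ennreal ((1 - exp (- (c * x))) * \<rho> x) \<partial>lborel) =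
        (\<integral>\<^sup>+x\<in>{0<..}. ennreal ((1 - exp (- (c * x))) * \<rho>' x) \<partial>lborel)" for c
    by (rule nn_integral_cong_AE, use AE in eventually_elim) (auto simp: indicator_def)
  thus ?thesis using law by (simp add: has_nrm_law_def homogeneous_nrm_def homogeneous_crm_def)
qed

text \<open>
  Dilating the jumps by \<open>\<beta>\<close> transforms the intensity by \<open>x \<mapsto> \<beta> x\<close>; for \<open>\<alpha> = 0\<close> this changes
  the rate of the exponential and nothing else.
\<close>

lemma homogeneous_crm_scale:
  assumes crm: "homogeneous_crm N \<mu> H (tilted_stable_density K 0 \<beta>)" and N: "prob_space N" and \<beta>: "\<beta> > 0" and K: "K > 0"
  shows "homogeneous_crm N (\<lambda>w. scale_measure (ennreal \<beta>) (\<mu> w)) H (tilted_stable_density K 0 1)"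
proof -
  interpret N: prob_space N by fact
  have sets: "sets (\<mu> w) = sets borel" if "w \<in> space N" for w
    using crm that by (auto simp: homogeneous_crm_def completely_random_measure_def random_measure_def)
  have meas: "(\<lambda>w. emeasure (\<mu> w) A) \<in> borel_measurable N" if "A \<in> sets borel" for A
    using crm that by (auto simp: homogeneous_crm_def completely_random_measure_def random_measure_def)
  have subst: "(\<integral>\<^sup>+x\<in>{0<..}. ennreal ((1 - exp (- (c * x))) * tilted_stable_density K 0 1 x) \<partial>lborel) =
      (\<integral>\<^sup>+x\<in>{0<..}. ennreal ((1 - exp (- (\<beta> * c * x))) * tilted_stable_density K 0 \<beta> x) \<partial>lborel)" if "c \<ge> 0" for c
  proof -
    let ?f = "\<lambda>x. ennreal ((1 - exp (- (c * x))) * tilted_stable_density K 0 1 x) * indicator {0<..} x"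
    have "(\<integral>\<^sup>+x. ?f x \<partial>lborel) = ennreal \<bar>\<beta>\<bar> * (\<integral>\<^sup>+x. ?f (0 + \<beta> * x) \<partial>lborel)"
      by (rule nn_integral_real_affine) (use \<beta> in auto)
    also have "\<dots> = (\<integral>\<^sup>+x. ennreal \<beta> * ?f (\<beta> * x) \<partial>lborel)"
      using \<beta> by (subst nn_integral_cmult) auto
    also have "\<dots> = (\<integral>\<^sup>+x\<in>{0<..}. ennreal ((1 - exp (- (\<beta> * c * x))) * tilted_stable_density K 0 \<beta> x) \<partial>lborel)"
    proof (rule nn_integral_cong)
      fix x :: real
      show "ennreal \<beta> * ?f (\<beta> * x) =
        ennreal ((1 - exp (- (\<beta> * c * x))) * tilted_stable_density K 0 \<beta> x) * indicator {0<..} x"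
      proof (cases "x > 0")
        case x: True
        have "\<beta> * ((1 - exp (- (c * (\<beta> * x)))) * tilted_stable_density K 0 1 (\<beta> * x)) =
              (1 - exp (- (\<beta> * c * x))) * tilted_stable_density K 0 \<beta> x"
          using \<beta> x by (simp add: tilted_stable_density_def powr_minus_divide mult_ac)
        thus ?thesis using \<beta> x by (simp add: ennreal_mult'[symmetric])
      next
        case False
        thus ?thesis using \<beta> by (simp add: zero_less_mult_iff)
      qed
    qed
    finally show ?thesis .
  qed
  have "N.indep_vars (\<lambda>_. borel) (\<lambda>A w. emeasure (scale_measure (ennreal \<beta>) (\<mu> w)) A) \<A>"
    if "finite \<A>" "\<A> \<subseteq> sets borel" "disjoint \<A>" for \<A>
  proof -
    have "N.indep_vars (\<lambda>_. borel) (\<lambda>A w. emeasure (\<mu> w) A) \<A>"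
      using crm that by (auto simp: homogeneous_crm_def completely_random_measure_def)
    hence "N.indep_vars (\<lambda>_. borel) (\<lambda>A w. ennreal \<beta> * emeasure (\<mu> w) A) \<A>"
      by (rule N.indep_vars_compose2) measurable
    thus ?thesis by simp
  qed
  moreover have "random_measure N (\<lambda>w. scale_measure (ennreal \<beta>) (\<mu> w))"
    unfolding random_measure_def using sets meas by auto
  moreover have "(\<integral>w. exp_neg (\<integral>\<^sup>+s. ennreal (g s) \<partial>scale_measure (ennreal \<beta>) (\<mu> w)) \<partial>N) =
      exp_neg (\<integral>\<^sup>+s. (\<integral>\<^sup>+x\<in>{0<..}. ennreal ((1 - exp (- (g s * x))) * tilted_stable_density K 0 1 x) \<partial>lborel) \<partial>H)"
    if g [measurable]: "g \<in> borel_measurable borel" and g0: "\<forall>s. 0 \<le> g s" for g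
  proof -
    have "(\<integral>w. exp_neg (\<integral>\<^sup>+s. ennreal (g s) \<partial>scale_measure (ennreal \<beta>) (\<mu> w)) \<partial>N) =
          (\<integral>w. exp_neg (\<integral>\<^sup>+s. ennreal (\<beta> * g s) \<partial>\<mu> w) \<partial>N)"
    proof (rule Bochner_Integration.integral_cong[OF refl], rule arg_cong[where f = exp_neg])
      fix w assume "w \<in> space N"
      note [measurable_cong] = sets[OF this]
      have "(\<integral>\<^sup>+s. ennreal (\<beta> * g s) \<partial>\<mu> w) = ennreal \<beta> * (\<integral>\<^sup>+s. ennreal (g s) \<partial>\<mu> w)"
        using \<beta> by (subst nn_integral_cmult[symmetric]) (auto simp: ennreal_mult')
      thus "(\<integral>\<^sup>+s. ennreal (g s) \<partial>scale_measure (ennreal \<beta>) (\<mu> w)) = (\<integral>\<^sup>+s. ennreal (\<beta> * g s) \<partial>\<mu> w)"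
        by (subst nn_integral_scale_measure) auto
    qed
    also have "\<dots> = exp_neg (\<integral>\<^sup>+s. (\<integral>\<^sup>+x\<in>{0<..}. ennreal ((1 - exp (- (\<beta> * g s * x))) * tilted_stable_density K 0 \<beta> x) \<partial>lborel) \<partial>H)"
    proof -
      have "(\<lambda>s. \<beta> * g s) \<in> borel_measurable borel" by measurable
      moreover have "\<forall>s. 0 \<le> \<beta> * g s" using g0 \<beta> by simp
      ultimately show ?thesis using crm by (auto simp: homogeneous_crm_def)
    qed
    finally show ?thesis using g0 by (simp add: subst)
  qed
  ultimately show ?thesis
    unfolding homogeneous_crm_def completely_random_measure_def by blast
qed

lemma ennreal_mult_divide_mult_cancel:
  fixes r :: real and a b :: ennreal
  assumes "r > 0" shows "(ennreal r * a) / (ennreal r * b) = a / b"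
proof (cases "b = top")
  case True
  thus ?thesis using assms by (simp add: ennreal_mult_top)
next
  case False
  have "inverse (ennreal r * b) = inverse (ennreal r) * inverse b"
    using False by (intro ennreal_inverse_mult) (auto simp: less_top[symmetric])
  hence "(ennreal r * a) / (ennreal r * b) = (ennreal r * inverse (ennreal r)) * (a * inverse b)"
    by (simp add: divide_ennreal_def mult_ac)
  also have "ennreal r * inverse (ennreal r) = 1"
    using assms by (simp add: inverse_ennreal ennreal_mult'[symmetric])
  finally show ?thesis by (simp add: divide_ennreal_def)
qed

lemma has_nrm_law_scale:
  fixes H :: "'s::topological_space measure"
  assumes law: "has_nrm_law M P H (tilted_stable_density K 0 \<beta>)" and \<beta>: "\<beta> > 0" and K: "K > 0"
  shows "has_nrm_law M P H (tilted_stable_density K 0 1)"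
proof -
  obtain N :: "'s measure measure" and Q where Q: "homogeneous_nrm N Q H (tilted_stable_density K 0 \<beta>)"
    and eq: "distr M (prob_algebra borel) P = distr N (prob_algebra borel) Q"
    using law unfolding has_nrm_law_def by blast
  obtain \<mu> where crm: "homogeneous_crm N \<mu> H (tilted_stable_density K 0 \<beta>)"
    and ratio: "AE w in N. \<forall>A\<in>sets borel. emeasure (Q w) A = emeasure (\<mu> w) A / emeasure (\<mu> w) UNIV"
    and N: "prob_space N" "Q \<in> N \<rightarrow>\<^sub>M prob_algebra borel"
    using Q unfolding homogeneous_nrm_def by blast
  have "homogeneous_nrm N Q H (tilted_stable_density K 0 1)"
    unfolding homogeneous_nrm_def
    using N homogeneous_crm_scale[OF crm N(1) \<beta> K] ratio
    by (intro conjI exI[of _ "\<lambda>w. scale_measure (ennreal \<beta>) (\<mu> w)"])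
       (simp_all add: ennreal_mult_divide_mult_cancel[OF \<beta>])
  thus ?thesis using eq unfolding has_nrm_law_def by blast
qed

section \<open>The characterization\<close>

text \<open>
  Any composition is realized by consecutive blocks of integers, to which the partition formula
  applies.
\<close>

lemma eppf_integral_eq:
  fixes P :: "'w \<Rightarrow> 's::polish_space measure" and H :: "'s measure"
  assumes H: "prob_space H" "sets H = sets borel" "nonatomic H" and \<rho>: "levy_density \<rho>"
    and M: "prob_space M" and P: "P \<in> M \<rightarrow>\<^sub>M prob_algebra borel"
    and nrm: "has_nrm_law M P H \<rho>" and X: "cond_iid M P X"
    and p: "is_eppf M (\<lambda>w. tie_partition (\<lambda>i. X i w)) p"
    and ns: "\<forall>m\<in>set ns. 1 \<le> m" "ns \<noteq> []"
  shows "levy_intensity.eppf_integral \<rho> ns 0 = ennreal (fact (sum_list ns - 1)) * ennreal (p ns)"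
proof -
  interpret levy_intensity \<rho> by unfold_locales fact
  obtain As where As: "distinct As" "partition_on {..<sum_list ns} (set As)" "map card As = ns"
    using partition_with_block_sizes[OF ns(1)] by blast
  define n where "n = sum_list ns"
  have n: "n \<ge> 1" using ns by (cases ns) (auto simp: n_def)
  have "measure M {w\<in>space M. restrict_partition n (tie_partition (\<lambda>i. X i w)) = set As} = p (map card As)"
    by (rule p[unfolded is_eppf_def, THEN conjunct2, rule_format, OF n]) (use As in \<open>simp add: n_def\<close>)
  hence "ennreal (p ns) = ennreal (measure M {w\<in>space M. restrict_partition n (tie_partition (\<lambda>i. X i w)) = set As})"
    by (simp add: As(3))
  also have "\<dots> = (\<integral>\<^sup>+u\<in>{0<..}. ennreal (u ^ (n - 1) / fact (n - 1) * (exp (- \<psi> u) *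
        (\<Prod>A\<in>set As. \<kappa> (card A) u))) \<partial>lborel)"
    by (rule probability_of_partition[OF H \<rho> M P nrm X As(2)[folded n_def] n])
  finally have pn: "ennreal (p ns) = \<dots>" .
  have "ennreal (fact (n - 1)) * ennreal (p ns) = (\<integral>\<^sup>+u. ennreal (fact (n - 1)) *
      (ennreal (u ^ (n - 1) / fact (n - 1) * (exp (- \<psi> u) *
        (\<Prod>A\<in>set As. \<kappa> (card A) u))) * indicator {0<..} u) \<partial>lborel)"
    unfolding pn by (rule nn_integral_cmult[symmetric]) measurable
  also have "\<dots> = eppf_integral ns 0"
    unfolding eppf_integral_def
  proof (rule nn_integral_cong)
    fix u :: real
    show "ennreal (fact (n - 1)) *
      (ennreal (u ^ (n - 1) / fact (n - 1) * (exp (- \<psi> u) *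
        (\<Prod>A\<in>set As. \<kappa> (card A) u))) * indicator {0<..} u) =
      ennreal (exp (- \<psi> u) / u * (prod_list (map (\<lambda>j. scaled_moment j u) ns) *
        \<psi> u ^ 0)) * indicator {0<..} u"
    proof (cases "u > 0")
      case u: True
      have "u ^ n = u * u ^ (n - 1)" using n by (cases n) auto
      hence "fact (n - 1) * (u ^ (n - 1) / fact (n - 1) * (exp (- \<psi> u) *
          (\<Prod>A\<in>set As. \<kappa> (card A) u))) =
        exp (- \<psi> u) / u * (prod_list (map (\<lambda>j. scaled_moment j u) ns) * \<psi> u ^ 0)"
        using u unfolding prod_scaled_moment prod_blocks[OF As(1), of "\<lambda>j. \<kappa> j u"] As(3) n_def[symmetric]
        by simp
      thus ?thesis using u by (simp add: ennreal_mult'[symmetric] mult.assoc[symmetric] del: power_0)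
    qed simp
  qed
  finally show ?thesis by (simp add: n_def)
qed

lemma gibbs_product_form_prod_list:
  assumes "gibbs_product_form \<alpha> p"
  obtains V where "\<And>n k. 1 \<le> k \<Longrightarrow> k \<le> n \<Longrightarrow> (0::real) \<le> V n k"
    "\<And>ns. ns \<noteq> [] \<Longrightarrow> \<forall>m\<in>set ns. 1 \<le> m \<Longrightarrow>
       p ns = V (sum_list ns) (length ns) * prod_list (map (\<lambda>m. pochhammer (1 - \<alpha>) (m - 1)) ns)"
proof -
  obtain V :: "nat \<Rightarrow> nat \<Rightarrow> real" where V: "\<And>n k. 1 \<le> k \<Longrightarrow> k \<le> n \<Longrightarrow> 0 \<le> V n k"
    "\<And>n k ns. 1 \<le> k \<and> k \<le> n \<and> length ns = k \<and> (\<forall>m\<in>set ns. 1 \<le> m) \<and> sum_list ns = n \<Longrightarrow>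
           p ns = V n k * (\<Prod>j<k. pochhammer (1 - \<alpha>) (ns ! j - 1))"
    using assms unfolding gibbs_product_form_def by blast
  show ?thesis
  proof (rule that[OF V(1)])
    fix ns :: "nat list" assume ns: "ns \<noteq> []" "\<forall>m\<in>set ns. 1 \<le> m"
    have "length ns \<le> sum_list ns" using ns(2) by (induction ns) auto
    hence "p ns = V (sum_list ns) (length ns) * (\<Prod>j<length ns. pochhammer (1 - \<alpha>) (ns ! j - 1))"
      using ns by (intro V(2)) (auto simp: Suc_le_eq)
    also have "(\<Prod>j<length ns. pochhammer (1 - \<alpha>) (ns ! j - 1)) = prod_list (map (\<lambda>m. pochhammer (1 - \<alpha>) (m - 1)) ns)"
      by (simp add: prod.list_conv_set_nth lessThan_atLeast0)
    finally show "p ns = V (sum_list ns) (length ns) * prod_list (map (\<lambda>m. pochhammer (1 - \<alpha>) (m - 1)) ns)" .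
  qed
qed

text \<open>
  Sizes \<open>(3, 1)\<close> and \<open>(2, 2)\<close> are the smallest two that differ but agree in the sum and in the
  number of blocks, so that the weights \<open>V\<close> and the Gamma factors are the same for both.
\<close>

lemma density_of_gibbs_form:
  fixes P :: "'w \<Rightarrow> 's::polish_space measure" and H :: "'s measure"
  assumes H: "prob_space H" "sets H = sets borel" "nonatomic H" and \<rho>: "levy_density \<rho>"
    and M: "prob_space M" and P: "P \<in> M \<rightarrow>\<^sub>M prob_algebra borel"
    and nrm: "has_nrm_law M P H \<rho>" and X: "cond_iid M P X"
    and p: "is_eppf M (\<lambda>w. tie_partition (\<lambda>i. X i w)) p" and gibbs: "gibbs_product_form \<alpha> p"
    and \<alpha>: "\<alpha> < 1"
  obtains K \<beta> where "K > 0" "\<beta> \<ge> 0" "AE x in lborel. x > 0 \<longrightarrow> \<rho> x = tilted_stable_density K \<alpha> \<beta> x"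
proof -
  obtain V where V: "\<And>ns. ns \<noteq> [] \<Longrightarrow> \<forall>m\<in>set ns. 1 \<le> m \<Longrightarrow>
       p ns = V (sum_list ns) (length ns) * prod_list (map (\<lambda>m. pochhammer (1 - \<alpha>) (m - 1)) ns)"
    using gibbs_product_form_prod_list[OF gibbs] by metis
  interpret levy_intensity \<rho> by unfold_locales fact
  have base: "ennreal (1 - \<alpha>) * eppf_integral ([3, 1] @ rest) 0 = ennreal (2 - \<alpha>) * eppf_integral ([2, 2] @ rest) 0"
    if rest: "\<forall>m\<in>set rest. 1 \<le> m" for rest
  proof -
    define c where "c = V (sum_list rest + 4) (length rest + 2) * prod_list (map (\<lambda>m. pochhammer (1 - \<alpha>) (m - 1)) rest)"
    have q: "pochhammer (1 - \<alpha>) 2 = (1 - \<alpha>) * (2 - \<alpha>)"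
      by (simp add: numeral_2_eq_2 pochhammer_Suc)
    have "p ([3, 1] @ rest) = c * ((1 - \<alpha>) * (2 - \<alpha>))"
      using V[of "[3, 1] @ rest"] rest q by (simp add: c_def mult_ac add.commute[of _ 4])
    moreover have "p ([2, 2] @ rest) = c * ((1 - \<alpha>) * (1 - \<alpha>))"
      using V[of "[2, 2] @ rest"] rest by (simp add: c_def mult_ac eval_nat_numeral)
    ultimately have "(1 - \<alpha>) * p ([3, 1] @ rest) = (2 - \<alpha>) * p ([2, 2] @ rest)"
      by (simp only: mult_ac)
    hence "ennreal (1 - \<alpha>) * ennreal (p ([3, 1] @ rest)) = ennreal (2 - \<alpha>) * ennreal (p ([2, 2] @ rest))"
      using \<alpha> by (simp add: ennreal_mult'[symmetric])
    moreover have "eppf_integral ([3, 1] @ rest) 0 = ennreal (fact (sum_list rest + 3)) * ennreal (p ([3, 1] @ rest))"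
      using eppf_integral_eq[OF H \<rho> M P nrm X p, of "[3, 1] @ rest"] rest by (simp add: eval_nat_numeral del: fact_Suc)
    moreover have "eppf_integral ([2, 2] @ rest) 0 = ennreal (fact (sum_list rest + 3)) * ennreal (p ([2, 2] @ rest))"
      using eppf_integral_eq[OF H \<rho> M P nrm X p, of "[2, 2] @ rest"] rest by (simp add: eval_nat_numeral del: fact_Suc)
    ultimately show ?thesis by (metis mult.left_commute)
  qed
  have "ennreal (1 - \<alpha>) * eppf_integral [3, 1] m = ennreal (2 - \<alpha>) * eppf_integral [2, 2] m" for m
    using eppf_integral_proportional[OF base, of "[]" m] by simp
  hence ode: "(1 - \<alpha>) * (\<kappa> 3 u * \<kappa> 1 u) = (2 - \<alpha>) * (\<kappa> 2 u)\<^sup>2" if "u > 0" for u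
    using moment_ode[ of "1 - \<alpha>" "2 - \<alpha>"] \<alpha> that by simp
  obtain C \<beta> where C: "C > 0" "\<beta> \<ge> 0" "\<And>u. u > 0 \<Longrightarrow> \<kappa> 1 u = C * (u + \<beta>) powr (\<alpha> - 1)"
  proof (rule power_solution_of_ode[OF \<alpha>, where ?k1.0 = "\<kappa> 1" and ?k2.0 = "\<kappa> 2" and ?k3.0 = "\<kappa> 3"])
    fix u :: real assume u: "u > 0"
    show "(\<kappa> 1 has_real_derivative - \<kappa> 2 u) (at u)"
      using has_derivative_tilted_moment[OF levy_measure u, of 1] by (simp add: numeral_2_eq_2)
    show "(\<kappa> 2 has_real_derivative - \<kappa> 3 u) (at u)"
      using has_derivative_tilted_moment[OF levy_measure u, of 2] by (simp add: numeral_3_eq_3 numeral_2_eq_2)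
    show "0 < \<kappa> 1 u" "0 < \<kappa> 2 u" using \<kappa>_pos[OF u] by auto
    show "(1 - \<alpha>) * (\<kappa> 3 u * \<kappa> 1 u) = (2 - \<alpha>) * (\<kappa> 2 u)\<^sup>2"
      by (rule ode[OF u])
  qed blast
  show ?thesis
  proof (rule that)
    show "C / Gamma (1 - \<alpha>) > 0" using C(1) \<alpha> Gamma_real_pos[of "1 - \<alpha>"] by simp
    show "\<beta> \<ge> 0" by fact
    show "AE x in lborel. x > 0 \<longrightarrow> \<rho> x = tilted_stable_density (C / Gamma (1 - \<alpha>)) \<alpha> \<beta> x"
      by (rule density_of_power_moment[OF \<alpha> C])
  qed
qed

lemma has_ngg_law_of_tilted_stable:
  assumes law: "has_nrm_law M P H (tilted_stable_density K \<alpha> \<beta>)"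
    and K: "K > 0" and \<beta>: "\<beta> \<ge> 0" and \<alpha>: "0 \<le> \<alpha>" "\<alpha> < 1" and nz: "\<alpha> > 0 \<or> \<beta> > 0"
  shows "has_ngg_law M P H \<alpha>"
proof (cases "\<alpha> = 0")
  case True
  hence "has_nrm_law M P H (tilted_stable_density K 0 1)"
    using has_nrm_law_scale[OF _ _ K, of M P H \<beta>] law nz by simp
  also have "tilted_stable_density K 0 1 = gamma_levy_density K"
    by (auto simp: tilted_stable_density_def gamma_levy_density_def)
  finally show ?thesis using K True by (auto simp: has_ngg_law_def)
next
  case False
  hence a0: "\<alpha> > 0" using \<alpha> by simp
  have G: "Gamma (1 - \<alpha>) > 0" using \<alpha> by (intro Gamma_real_pos) auto
  (* solve for the parameters that give the constant K and the rate \<beta> *)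
  define \<delta> where "\<delta> = K * Gamma (1 - \<alpha>) / (2 powr \<alpha> * \<alpha>)"
  define \<zeta> where "\<zeta> = (2 * \<beta>) powr \<alpha>"
  have "\<delta> * 2 powr \<alpha> * \<alpha> / Gamma (1 - \<alpha>) = K"
    using a0 G by (simp add: \<delta>_def field_simps)
  moreover have "1/2 * \<zeta> powr (1/\<alpha>) = \<beta>"
    using a0 \<beta> by (simp add: \<zeta>_def powr_powr)
  ultimately have "tilted_stable_density K \<alpha> \<beta> = generalized_gamma_density \<alpha> \<delta> \<zeta>"
    by (auto simp: tilted_stable_density_def generalized_gamma_density_def)
  moreover have "\<delta> > 0" "\<zeta> \<ge> 0" using K G a0 by (auto simp: \<delta>_def \<zeta>_def)
  ultimately show ?thesis using law a0 \<alpha> unfolding has_ngg_law_def by metis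
qed

lemma tilted_stable_of_has_ngg_law:
  assumes "has_ngg_law M P H \<alpha>"
  obtains K \<beta> where "K > 0" "\<beta> \<ge> 0" "0 \<le> \<alpha>" "\<alpha> < 1" "\<alpha> > 0 \<or> \<beta> > 0" "has_nrm_law M P H (tilted_stable_density K \<alpha> \<beta>)"
proof (cases "\<alpha> = 0")
  case True
  then obtain \<theta> where \<theta>: "\<theta> > 0" "has_nrm_law M P H (gamma_levy_density \<theta>)"
    using assms by (auto simp: has_ngg_law_def)
  have "gamma_levy_density \<theta> = tilted_stable_density \<theta> 0 1"
    by (auto simp: tilted_stable_density_def gamma_levy_density_def)
  thus ?thesis using that[of \<theta> 1] \<theta> True by simp
next
  case False
  then obtain \<delta> \<zeta> where *: "0 < \<alpha>" "\<alpha> < 1" "\<delta> > 0" "\<zeta> \<ge> 0" "has_nrm_law M P H (generalized_gamma_density \<alpha> \<delta> \<zeta>)"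
    using assms by (auto simp: has_ngg_law_def)
  have "generalized_gamma_density \<alpha> \<delta> \<zeta> =
      tilted_stable_density (\<delta> * 2 powr \<alpha> * \<alpha> / Gamma (1 - \<alpha>)) \<alpha> (1/2 * \<zeta> powr (1/\<alpha>))"
    by (auto simp: tilted_stable_density_def generalized_gamma_density_def)
  moreover have "Gamma (1 - \<alpha>) > 0" using * by (intro Gamma_real_pos) auto
  ultimately show ?thesis using * by (intro that) auto
qed

lemma tilted_moment_tilted_stable:
  assumes \<rho>: "levy_density (tilted_stable_density K \<alpha> \<beta>)" and K: "K > 0" and \<beta>: "\<beta> \<ge> 0" and \<alpha>: "\<alpha> < 1"
    and u: "u > 0" and n: "n \<ge> 1"
  shows "tilted_moment (levy_measure_of (tilted_stable_density K \<alpha> \<beta>)) n u =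
     K * Gamma (1 - \<alpha>) * (u + \<beta>) powr (\<alpha> - real n) * pochhammer (1 - \<alpha>) (n - 1)"
proof -
  let ?\<rho> = "tilted_stable_density K \<alpha> \<beta>"
  have "ennreal (tilted_moment (levy_measure_of ?\<rho>) n u) =
        (\<integral>\<^sup>+x. ennreal (x ^ n * exp (- (u * x))) \<partial>levy_measure_of ?\<rho>)"
    by (rule ennreal_tilted_moment[OF levy_measure_levy_measure_of(1)[OF \<rho>] u]) (use n in auto)
  also have "\<dots> = (\<integral>\<^sup>+x\<in>{0<..}. ennreal (x ^ n * exp (- (u * x))) * ennreal (?\<rho> x) \<partial>lborel)"
    by (rule levy_densityD(3)[OF \<rho>]) measurable
  also have "\<dots> = ennreal (K * Gamma (real n - \<alpha>) * (u + \<beta>) powr (\<alpha> - real n))"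
    by (rule tilted_stable_density_moment) (use K u \<beta> \<alpha> n in auto)
  finally have "tilted_moment (levy_measure_of ?\<rho>) n u = K * Gamma (real n - \<alpha>) * (u + \<beta>) powr (\<alpha> - real n)"
    using K n \<alpha> tilted_moment_nonneg[OF levy_measure_levy_measure_of(1)[OF \<rho>], of n u] Gamma_real_pos[of "real n - \<alpha>"]
    by (subst (asm) ennreal_inj) auto
  also have "Gamma (real n - \<alpha>) = Gamma (1 - \<alpha>) * pochhammer (1 - \<alpha>) (n - 1)"
  proof -
    have "(1 - \<alpha>) + of_nat (n - 1) = real n - \<alpha>" using n by (simp add: of_nat_diff)
    moreover have "1 - \<alpha> \<notin> \<int>\<^sub>\<le>\<^sub>0" using \<alpha> by (auto elim!: nonpos_Ints_cases)
    moreover have "Gamma (1 - \<alpha>) > 0" using \<alpha> by (intro Gamma_real_pos) auto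
    ultimately show ?thesis
      using pochhammer_Gamma[of "1 - \<alpha>" "n - 1"] by simp
  qed
  finally show ?thesis by (simp add: mult_ac)
qed

text \<open>
  The weights are \<open>V n k = 1/\<Gamma>(n) \<integral> u\<^sup>n\<^sup>-\<^sup>1 e\<^sup>-\<^sup>\<psi>\<^sup>(\<^sup>u\<^sup>) (K \<Gamma>(1 - \<alpha>))\<^sup>k (u + \<beta>)\<^sup>k\<^sup>\<alpha>\<^sup>-\<^sup>n du\<close>.
\<close>

lemma gibbs_form_of_tilted_stable:
  fixes P :: "'w \<Rightarrow> 's::polish_space measure" and H :: "'s measure"
  assumes H: "prob_space H" "sets H = sets borel" "nonatomic H"
    and M: "prob_space M" and P: "P \<in> M \<rightarrow>\<^sub>M prob_algebra borel"
    and nrm: "has_nrm_law M P H (tilted_stable_density K \<alpha> \<beta>)" and X: "cond_iid M P X"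
    and K: "K > 0" and \<beta>: "\<beta> \<ge> 0" and \<alpha>: "0 \<le> \<alpha>" "\<alpha> < 1" and nz: "\<alpha> > 0 \<or> \<beta> > 0"
  shows "\<exists>p. is_eppf M (\<lambda>w. tie_partition (\<lambda>i. X i w)) p \<and> gibbs_product_form \<alpha> p"
proof -
  let ?\<rho> = "tilted_stable_density K \<alpha> \<beta>"
  let ?L = "levy_measure_of ?\<rho>"
  let ?q = "\<lambda>m. pochhammer (1 - \<alpha>) (m - 1)"
  have \<rho>: "levy_density ?\<rho>" by (rule levy_density_tilted_stable[OF K \<alpha> \<beta> nz])
  note [measurable] = borel_measurable_laplace_exponent[OF \<rho>]
  define W where "W = (\<lambda>n k. \<integral>\<^sup>+u\<in>{0<..}. ennreal (u ^ (n - 1) / fact (n - 1) * (exp (- laplace_exponent ?L u) *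
       ((K * Gamma (1 - \<alpha>)) ^ k * (u + \<beta>) powr (real k * \<alpha> - real n)))) \<partial>lborel)"
  define V where "V = (\<lambda>n k. enn2real (W n k))"
  define p where "p = (\<lambda>ns. V (sum_list ns) (length ns) * prod_list (map ?q ns))"
  have q: "?q m > 0" for m using \<alpha> by (intro pochhammer_pos) auto
  have sym: "p ns = p ms" if "mset ns = mset ms" for ns ms
  proof -
    have "sum_list ns = sum_list ms" using that by (metis sum_mset_sum_list)
    moreover have "length ns = length ms" using that by (rule mset_eq_length)
    moreover have "prod_list (map ?q ns) = prod_list (map ?q ms)"
      using that by (metis mset_map prod_mset_prod_list)
    ultimately show ?thesis by (simp add: p_def)
  qed
  have prob: "measure M {w\<in>space M. restrict_partition n (tie_partition (\<lambda>i. X i w)) = set As} = p (map card As)"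
    if n: "n \<ge> 1" and As: "distinct As" "partition_on {..<n} (set As)" for n As
  proof -
    define Q where "Q = prod_list (map ?q (map card As))"
    have Q: "Q > 0" unfolding Q_def using q by (induction As) auto
    have card1: "card A \<ge> 1" if "A \<in> set As" for A
      using card_block_pos[OF As(2) that] by simp
    note sumc = sum_card_blocks[OF As(2)]
    have "ennreal (measure M {w\<in>space M. restrict_partition n (tie_partition (\<lambda>i. X i w)) = set As}) =
      (\<integral>\<^sup>+u\<in>{0<..}. ennreal (u ^ (n - 1) / fact (n - 1) * (exp (- laplace_exponent ?L u) *
        (\<Prod>A\<in>set As. tilted_moment ?L (card A) u))) \<partial>lborel)"
      by (rule probability_of_partition[OF H \<rho> M P nrm X As(2) n])
    also have "\<dots> = (\<integral>\<^sup>+u. ennreal Q * (ennreal (u ^ (n - 1) / fact (n - 1) * (exp (- laplace_exponent ?L u) *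
       ((K * Gamma (1 - \<alpha>)) ^ length As * (u + \<beta>) powr (real (length As) * \<alpha> - real n)))) * indicator {0<..} u) \<partial>lborel)"
    proof (rule nn_integral_cong)
      fix u :: real
      show "ennreal (u ^ (n - 1) / fact (n - 1) * (exp (- laplace_exponent ?L u) *
        (\<Prod>A\<in>set As. tilted_moment ?L (card A) u))) * indicator {0<..} u =
        ennreal Q * (ennreal (u ^ (n - 1) / fact (n - 1) * (exp (- laplace_exponent ?L u) *
       ((K * Gamma (1 - \<alpha>)) ^ length As * (u + \<beta>) powr (real (length As) * \<alpha> - real n)))) * indicator {0<..} u)"
      proof (cases "u > 0")
        case u: True
        have "(\<Prod>A\<in>set As. tilted_moment ?L (card A) u) =
            (\<Prod>A\<in>set As. (K * Gamma (1 - \<alpha>)) * (u + \<beta>) powr (\<alpha> - real (card A)) * ?q (card A))"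
          by (intro prod.cong refl tilted_moment_tilted_stable[OF \<rho> K \<beta> \<alpha>(2) u card1])
        also have "\<dots> = (K * Gamma (1 - \<alpha>)) ^ card (set As) * (\<Prod>A\<in>set As. (u + \<beta>) powr (\<alpha> - real (card A))) * (\<Prod>A\<in>set As. ?q (card A))"
          by (simp add: prod.distrib)
        also have "(\<Prod>A\<in>set As. (u + \<beta>) powr (\<alpha> - real (card A))) = (u + \<beta>) powr (\<Sum>A\<in>set As. \<alpha> - real (card A))"
          using u \<beta> by (subst powr_sum) auto
        also have "(\<Sum>A\<in>set As. \<alpha> - real (card A)) = real (length As) * \<alpha> - real n"
          using As(1) by (simp add: sum_subtractf distinct_card sumc[symmetric])
        also have "card (set As) = length As" using As(1) by (rule distinct_card)
        also have "(\<Prod>A\<in>set As. ?q (card A)) = Q" unfolding Q_def by (rule prod_blocks[OF As(1)])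
        finally show ?thesis
          using u Q by (simp add: ennreal_mult'[symmetric] mult_ac)
      qed simp
    qed
    also have "\<dots> = ennreal Q * W n (length As)"
      unfolding W_def by (rule nn_integral_cmult) measurable
    finally have eq: "ennreal (measure M {w\<in>space M. restrict_partition n (tie_partition (\<lambda>i. X i w)) = set As}) =
        ennreal Q * W n (length As)" .
    have "measure M {w\<in>space M. restrict_partition n (tie_partition (\<lambda>i. X i w)) = set As} =
        enn2real (ennreal Q * W n (length As))" unfolding eq[symmetric] by simp
    also have "\<dots> = V n (length As) * Q" using Q by (simp add: enn2real_mult V_def)
    also have "\<dots> = p (map card As)"
      using As(1) sumc by (simp add: p_def Q_def sum_list_distinct_conv_sum_set)
    finally show ?thesis .
  qed
  have "is_eppf M (\<lambda>w. tie_partition (\<lambda>i. X i w)) p"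
    unfolding is_eppf_def using sym prob by blast
  moreover have "gibbs_product_form \<alpha> p"
    unfolding gibbs_product_form_def
    by (rule exI[of _ V]) (auto simp: V_def p_def prod.list_conv_set_nth lessThan_atLeast0)
  ultimately show ?thesis by blast
qed

theorem proposition3:
  fixes M :: "'w measure"
    and P :: "'w \<Rightarrow> 's::polish_space measure"
    and X :: "nat \<Rightarrow> 'w \<Rightarrow> 's"
    and H :: "'s measure"
    and \<rho> :: "real \<Rightarrow> real"
    and \<alpha> :: real
  assumes "prob_space H" and "sets H = sets borel" and "nonatomic H"
    and "levy_density \<rho>"
    and "prob_space M" and "P \<in> M \<rightarrow>\<^sub>M prob_algebra borel"
    and "AE w in M. discrete_measure (P w)"
    and "has_nrm_law M P H \<rho>"
    and "cond_iid M P X"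
    and "\<alpha> < 1"
  shows "(\<exists>p. is_eppf M (\<lambda>w. tie_partition (\<lambda>i. X i w)) p \<and> gibbs_product_form \<alpha> p)
         \<longleftrightarrow> 0 \<le> \<alpha> \<and> \<alpha> < 1 \<and> has_ngg_law M P H \<alpha>"
proof
  assume "\<exists>p. is_eppf M (\<lambda>w. tie_partition (\<lambda>i. X i w)) p \<and> gibbs_product_form \<alpha> p"
  then obtain p where "is_eppf M (\<lambda>w. tie_partition (\<lambda>i. X i w)) p" "gibbs_product_form \<alpha> p" by blast
  then obtain K \<beta> where K: "K > 0" "\<beta> \<ge> 0"
    and AE: "AE x in lborel. x > 0 \<longrightarrow> \<rho> x = tilted_stable_density K \<alpha> \<beta> x"
    using density_of_gibbs_form[OF assms(1-6,8,9) _ _ assms(10)] by blast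
  have "levy_density (tilted_stable_density K \<alpha> \<beta>)"
    by (rule levy_density_cong_AE[OF assms(4) AE]) (use K in \<open>auto simp: tilted_stable_density_def\<close>)
  hence "0 \<le> \<alpha> \<and> (\<alpha> > 0 \<or> \<beta> > 0)" by (rule levy_density_tilted_stableD[OF _ K])
  thus "0 \<le> \<alpha> \<and> \<alpha> < 1 \<and> has_ngg_law M P H \<alpha>"
    using has_ngg_law_of_tilted_stable[OF has_nrm_law_cong_AE[OF assms(8) AE] K] assms(10) by blast
next
  assume "0 \<le> \<alpha> \<and> \<alpha> < 1 \<and> has_ngg_law M P H \<alpha>"
  hence "has_ngg_law M P H \<alpha>" by blast
  then obtain K \<beta> where "K > 0" "\<beta> \<ge> 0" "0 \<le> \<alpha>" "\<alpha> < 1" "\<alpha> > 0 \<or> \<beta> > 0"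
    "has_nrm_law M P H (tilted_stable_density K \<alpha> \<beta>)"
    by (rule tilted_stable_of_has_ngg_law)
  thus "\<exists>p. is_eppf M (\<lambda>w. tie_partition (\<lambda>i. X i w)) p \<and> gibbs_product_form \<alpha> p"
    using gibbs_form_of_tilted_stable[OF assms(1-3,5,6) _ assms(9)] by blast
qed

end
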